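(* Let $n,n_u$ be positive integers and consider the coupled PDE/ODE system, for $t\ge 0$, $z\in[0,1]$, $$\partial_t \xi(t,z) = -\Lambda\,\partial_z\xi(t,z),\qquad \xi(t,0)=H\xi(t,1)+B_uu(t)+B_vv(t),$$ $$\dot v(t)=Mv(t)+B_ww(t),\qquad y(t)=\xi(t,1)+D_vv(t),$$ $$u(t)=K_1\eta(t)+K_2y(t),\qquad \dot\eta(t)=R\eta(t)+Sy(t),$$ with $\xi(t,z)\in\mathbb{R}^n$, $y\in\mathbb{R}^n$, $u\in\mathbb{R}^{n_u}$, $v\in\mathbb{R}^{n_v}$, $w\in\mathbb{R}^{n_w}$, $\eta\in\mathbb{R}^{n_\eta}$, where $n_\eta=n_v=n_w=n$, $\Lambda,H,B_u,B_v,M,B_w,D_v$ are given real matrices of appropriate dimensions, $\Lambda$ is diagonal positive definite, $M$ is Hurwitz, and $M$, $B_w$, $D_v$ are diagonal. Suppose that the disturbance $w$ belongs to $$\mathcal{W}:=\{w\in (L^2(0,\infty))^{n_w} : w(t)^\top w(t)\le 1\}.$$ Let $\lambda$ be the smallest eigenvalue of $\Lambda$ and let $\alpha,\beta>0$ be given scalars with $$2\alpha+\beta\le e^{-1}\lambda .$$ Suppose there exist matrices $Q_1,Q_2,G\in\mathbb{D}^n$, $P_3,P_p\in\mathbb{S}^n$ with $P_p>0$, $K_1,K_p\in\mathbb{R}^{n_u\times n}$ and $R_p,S_p,L_p\in\mathbb{R}^{n\times n}$ such that $$\begin{bmatrix}\tilde\Psi_a & \star & \star\\ \tilde\Psi_b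 & -Q_1\Lambda & \star\\ \tilde\Psi_c & 0 & -Q_2\Lambda\end{bmatrix}<0,$$ where $$\tilde\Psi_b:=\Lambda\begin{bmatrix}0 & HG+B_uK_p & B_uK_1 & B_uK_pD_v & B_wG & 0 & 0\end{bmatrix},$$ $$\tilde\Psi_c:=\begin{bmatrix}H\Lambda G & 0 & 0 & -B_vMG & -B_vB_wG & -B_uK_1 & -B_uK_p\end{bmatrix},$$ and $\tilde\Psi_a=[\tilde\psi_{ij}]_{i,j=1,\dots,7}$ is the symmetric block matrix ($\tilde\psi_{ij}=\tilde\psi_{ji}^\top$, all blocks $n\times n$) given with $\vartheta:=\alpha+0.5\beta$ by $$\tilde\psi_{11}=e^{-1}\Lambda(Q_2-2G),\quad \tilde\psi_{22}=e^{-1}\Lambda(Q_1-2G),\quad \tilde\psi_{32}=S_p,\quad \tilde\psi_{33}=\mathrm{He}\{R_p+\vartheta P_3\},\quad \tilde\psi_{43}=D_vS_p^\top,$$ $$\tilde\psi_{44}=\mathrm{He}\{P_pM+\vartheta P_p\},\quad \tilde\psi_{54}=B_wP_p,\quad \tilde\psi_{55}=\beta(I-2G),$$ $$\tilde\psi_{62}=S_p,\quad \tilde\psi_{63}=R_p,\quad \tilde\psi_{64}=S_pD_v,\quad \tilde\psi_{66}=-2P_3,$$ $$\tilde\psi_{71}=-L_p\Lambda,\quad \tilde\psi_{74}=L_pD_vM,\quad \tilde\psi_{75}=L_pD_vB_w,\quad \tilde\psi_{77}=-L_p-L_p^\top,$$ all blocks not determined by these (and symmetry) being zero. Then the coupled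 system with the matrices $$K_1,\qquad K_2:=K_pG^{-1},\qquad R:=P_3^{-1}R_p,\qquad S:=P_3^{-1}S_pG^{-1}$$ is (exponentially) ISS with respect to $\mathcal{W}$. Moreover, the set $$\mathcal{R}:=\{(\xi,\partial_z\xi,v,\eta)\in \mathcal{L}_2^n\times\mathcal{L}_2^n\times\mathbb{R}^{n_v}\times\mathbb{R}^{n_\eta} : V(\xi,\partial_z\xi,v,\eta)\le 1\},$$ with $$V=\int_0^1 e^{-z}\xi^\top P_1\xi\,dz+\int_0^1 e^{-z}(\partial_z\xi)^\top P_2\,\partial_z\xi\,dz+\eta^\top P_3\eta+v^\top P_4v,\qquad P_1=Q_1^{-1},\ P_2=Q_2^{-1},\ P_4=G^{-1}P_pG^{-1},$$ is an estimate of the system's ultimate-bound set, i.e. for all compatible initial conditions and all $w\in\mathcal{W}$ the state trajectory converges to $\mathcal{R}$ as $t\to\infty$.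
   Context: Notation: $\mathbb{S}^m$ and $\mathbb{D}^m$ are the spaces of $m\times m$ real symmetric and real diagonal matrices; $\mathrm{He}\{W\}:=W+W^\top$; $\star$ denotes a block deduced by symmetry; $<0$ means negative definite. $\mathcal{L}_2^n$ is the space of square integrable functions $[0,1]\to\mathbb{R}^n$ with norm $\|z\|_{\mathcal{L}_2}=(\int_0^1 z(x)^\top z(x)\,dx)^{1/2}$. For a signal $s:\mathbb{R}_+\to\mathbb{R}^m$, $\|s\|_\infty:=(\sup_{t\ge0}s(t)^\top s(t))^{1/2}$. Initial conditions: $\xi(0,z)=\xi_0(z)$, $v(0)=v_0$, $\eta(0)=\eta_0$ with $\xi_0\in C^1([0,1];\mathbb{R}^n)$, $v_0\in\mathbb{R}^{n_v}$, $\eta_0\in\mathbb{R}^{n_\eta}$ satisfying the first-order compatibility conditions (the boundary condition, and its time derivative computed through the system equations, hold at $t=0$); such initial conditions are called compatible. Solutions are considered in the $H^1$ sense in $z$. Norm: $\|(\xi,v,\eta)\|_X:=\|\xi\|_{\mathcal{L}_2}+\|\partial_z\xi\|_{\mathcal{L}_2}+\|v\|_2+\|\eta\|_2$ (the system's $H_1$-norm). Definition (exponential ISS): the coupled system is (exponentially) ISS with respect to $w\in\mathcal{W}$ if there exist positive scalars $a,\rho,\varrho$ such that its solutions satisfy $$\|(\xi(t,\cdot),v(t),\eta(t))\|_X\le \rho e^{-at}\|(\xi_0,v_0,\eta_0)\|_X+\varrho\|w\|_\infty\qquad\forall t\ge0 .$$ The ultimate-bound set associated with such constants is $\{(\xi,\partial_z\xi,v,\eta):\|(\xi,v,\eta)\|_X^2\le\varrho\}$;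 the phrase "$\mathcal{R}$ is an estimate of the ultimate-bound set" means that trajectories from compatible initial conditions converge to $\mathcal{R}$ as $t\to\infty$. *)

theory Defs
  imports "HOL-Analysis.Analysis"
begin

section \<open>Matrices\<close>

definition diagonal_mx :: "real^'n^'n \<Rightarrow> bool" where
  "diagonal_mx A \<longleftrightarrow> (\<forall>i j. i \<noteq> j \<longrightarrow> A $ i $ j = 0)"

definition symmetric_mx :: "real^'n^'n \<Rightarrow> bool" where
  "symmetric_mx A \<longleftrightarrow> transpose A = A"

definition pos_def_mx :: "real^'n^'n \<Rightarrow> bool" where
  "pos_def_mx A \<longleftrightarrow> symmetric_mx A \<and> (\<forall>x. x \<noteq> 0 \<longrightarrow> 0 < x \<bullet> (A *v x))"

definition real_eigenvalues :: "real^'n^'n \<Rightarrow> real set" where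
  "real_eigenvalues A = {\<mu>. \<exists>x. x \<noteq> 0 \<and> A *v x = \<mu> *\<^sub>R x}"

definition hurwitz_mx :: "real^'n^'n \<Rightarrow> bool" where
  "hurwitz_mx A \<longleftrightarrow>
    (\<forall>(\<mu>::complex) x. x \<noteq> 0 \<and> map_matrix complex_of_real A *v x = \<mu> *s x \<longrightarrow> Re \<mu> < 0)"

definition He :: "real^'n^'n \<Rightarrow> real^'n^'n" where
  "He A = A + transpose A"

text \<open>A square matrix with \<open>k \<times> k\<close> blocks of size \<open>n \<times> n\<close> is given by its blocks
  \<open>B i j\<close>, \<open>i, j < k\<close>; it acts on stacked vectors \<open>(x 0, \<dots>, x (k - 1))\<close>.\<close>

definition neg_def_block_mx :: "nat \<Rightarrow> (nat \<Rightarrow> nat \<Rightarrow> real^'n^'n) \<Rightarrow> bool" where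
  "neg_def_block_mx k B \<longleftrightarrow>
    (\<forall>i<k. \<forall>j<k. transpose (B i j) = B j i) \<and>
    (\<forall>x :: nat \<Rightarrow> real^'n. (\<exists>i<k. x i \<noteq> 0) \<longrightarrow> (\<Sum>i<k. \<Sum>j<k. x i \<bullet> (B i j *v x j)) < 0)"

text \<open>Symmetric block matrix whose lower block triangle, diagonal included, is given row by row;
  the blocks above the diagonal are the starred ones.\<close>

definition symmetric_blocks :: "(real^'n^'n) list list \<Rightarrow> nat \<Rightarrow> nat \<Rightarrow> real^'n^'n" where
  "symmetric_blocks bs i j = (if j \<le> i then bs ! i ! j else transpose (bs ! j ! i))"

text \<open>Rows 1 to 7 below are the lower triangle of \<open>\<Psi>\<^sub>a\<close>; row 8 is
  \<open>(\<Psi>\<^sub>b, - Q\<^sub>1 \<Lambda>)\<close> and row 9 is \<open>(\<Psi>\<^sub>c, 0, - Q\<^sub>2 \<Lambda>)\<close>.\<close>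

definition design_blocks ::
  "real^'n^'n \<Rightarrow> real^'n^'n \<Rightarrow> real^'u^'n \<Rightarrow> real^'n^'n \<Rightarrow> real^'n^'n \<Rightarrow> real^'n^'n \<Rightarrow> real^'n^'n
   \<Rightarrow> real \<Rightarrow> real
   \<Rightarrow> real^'n^'n \<Rightarrow> real^'n^'n \<Rightarrow> real^'n^'n \<Rightarrow> real^'n^'n \<Rightarrow> real^'n^'n
   \<Rightarrow> real^'n^'u \<Rightarrow> real^'n^'u \<Rightarrow> real^'n^'n \<Rightarrow> real^'n^'n \<Rightarrow> real^'n^'n
   \<Rightarrow> nat \<Rightarrow> nat \<Rightarrow> real^'n^'n" where
  "design_blocks \<Lambda> H Bu Bv M Bw Dv \<alpha> \<beta> Q1 Q2 G P3 Pp K1 Kp Rp Sp Lp =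
    (let \<theta> = \<alpha> + \<beta> / 2 in
     symmetric_blocks
      [ [exp (- 1) *\<^sub>R (\<Lambda> ** (Q2 - 2 *\<^sub>R G))],
        [0, exp (- 1) *\<^sub>R (\<Lambda> ** (Q1 - 2 *\<^sub>R G))],
        [0, Sp, He (Rp + \<theta> *\<^sub>R P3)],
        [0, 0, Dv ** transpose Sp, He (Pp ** M + \<theta> *\<^sub>R Pp)],
        [0, 0, 0, Bw ** Pp, \<beta> *\<^sub>R (mat 1 - 2 *\<^sub>R G)],
        [0, Sp, Rp, Sp ** Dv, 0, - (2 *\<^sub>R P3)],
        [- (Lp ** \<Lambda>), 0, 0, Lp ** Dv ** M, Lp ** Dv ** Bw, 0, - Lp - transpose Lp],
        [0, \<Lambda> ** (H ** G + Bu ** Kp), \<Lambda> ** (Bu ** K1), \<Lambda> ** (Bu ** Kp ** Dv),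
           \<Lambda> ** (Bw ** G), 0, 0, - (Q1 ** \<Lambda>)],
        [H ** \<Lambda> ** G, 0, 0, - (Bv ** M ** G), - (Bv ** Bw ** G),
           - (Bu ** K1), - (Bu ** Kp), 0, - (Q2 ** \<Lambda>)] ])"

section \<open>Function spaces on the unit interval and norms\<close>

definition L2 :: "(real \<Rightarrow> real^'n) set" where
  "L2 = {f. f \<in> borel_measurable (lebesgue_on {0..1}) \<and>
            integrable (lebesgue_on {0..1}) (\<lambda>z. f z \<bullet> f z)}"

definition L2_norm :: "(real \<Rightarrow> real^'n) \<Rightarrow> real" where
  "L2_norm f = sqrt (integral {0..1} (\<lambda>z. f z \<bullet> f z))"

definition Dz :: "(real \<Rightarrow> real^'n) \<Rightarrow> real \<Rightarrow> real^'n" where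
  "Dz f z = vector_derivative f (at z within {0..1})"

text \<open>\<open>H\<^sup>1(0,1)\<close>: absolutely continuous functions, that is, indefinite integrals of their almost
  everywhere derivative, with square integrable derivative. Where \<open>f\<close> is not differentiable
  \<^term>\<open>Dz f\<close> is unspecified, which only concerns a null set.\<close>

definition H1 :: "(real \<Rightarrow> real^'n) set" where
  "H1 = {f. Dz f \<in> L2 \<and> (\<forall>z\<in>{0..1}. (Dz f has_integral (f z - f 0)) {0..z})}"

definition C1 :: "(real \<Rightarrow> real^'n) set" where
  "C1 = {f. (\<forall>z\<in>{0..1}. f differentiable (at z within {0..1})) \<and> continuous_on {0..1} (Dz f)}"

definition X_norm :: "(real \<Rightarrow> real^'n) \<Rightarrow> real^'v \<Rightarrow> real^'e \<Rightarrow> real" where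
  "X_norm \<xi> v \<eta> = L2_norm \<xi> + L2_norm (Dz \<xi>) + norm v + norm \<eta>"

definition signal_norm :: "(real \<Rightarrow> real^'m) \<Rightarrow> real" where
  "signal_norm s = sqrt (SUP t\<in>{0..}. s t \<bullet> s t)"

text \<open>Signals are pointwise defined representatives, since \<^const>\<open>signal_norm\<close> is a supremum and
  first-order compatibility refers to \<open>w 0\<close>.\<close>

definition disturbances :: "(real \<Rightarrow> real^'w) set" where
  "disturbances = {w. w \<in> borel_measurable (lebesgue_on {0<..}) \<and>
      integrable (lebesgue_on {0<..}) (\<lambda>t. w t \<bullet> w t) \<and> (\<forall>t\<ge>0. w t \<bullet> w t \<le> 1)}"

section \<open>The closed loop\<close>

definition compatible_ic ::
  "real^'n^'n \<Rightarrow> real^'n^'n \<Rightarrow> real^'u^'n \<Rightarrow> real^'v^'n \<Rightarrow> real^'v^'v \<Rightarrow> real^'w^'v \<Rightarrow> real^'v^'n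
   \<Rightarrow> real^'e^'u \<Rightarrow> real^'n^'u \<Rightarrow> real^'e^'e \<Rightarrow> real^'n^'e
   \<Rightarrow> (real \<Rightarrow> real^'w) \<Rightarrow> (real \<Rightarrow> real^'n) \<Rightarrow> real^'v \<Rightarrow> real^'e \<Rightarrow> bool" where
  "compatible_ic \<Lambda> H Bu Bv M Bw Dv K1 K2 R S w \<xi>0 v0 \<eta>0 \<longleftrightarrow>
    \<xi>0 \<in> C1 \<and>
    (let y0 = \<xi>0 1 + Dv *v v0;
         u0 = K1 *v \<eta>0 + K2 *v y0;
         \<xi>t = (\<lambda>z. - (\<Lambda> *v Dz \<xi>0 z));
         vt = M *v v0 + Bw *v w 0;
         \<eta>t = R *v \<eta>0 + S *v y0;
         yt = \<xi>t 1 + Dv *v vt;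
         ut = K1 *v \<eta>t + K2 *v yt
     in \<xi>0 0 = H *v \<xi>0 1 + Bu *v u0 + Bv *v v0 \<and>
        \<xi>t 0 = H *v \<xi>t 1 + Bu *v ut + Bv *v vt)"

text \<open>Solutions have \<open>\<xi> \<in> C([0,\<infinity>); H\<^sup>1) \<inter> C\<^sup>1([0,\<infinity>); L\<^sup>2)\<close>; the transport equation holds in \<open>L\<^sup>2\<close>
  for all \<open>t \<ge> 0\<close>, with the time derivative taken as a limit in \<open>L\<^sup>2\<close>. The disturbance is merely
  measurable, so \<open>v\<close> is a Caratheodory solution of its equation.\<close>

definition closed_loop_solution ::
  "real^'n^'n \<Rightarrow> real^'n^'n \<Rightarrow> real^'u^'n \<Rightarrow> real^'v^'n \<Rightarrow> real^'v^'v \<Rightarrow> real^'w^'v \<Rightarrow> real^'v^'n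
   \<Rightarrow> real^'e^'u \<Rightarrow> real^'n^'u \<Rightarrow> real^'e^'e \<Rightarrow> real^'n^'e
   \<Rightarrow> (real \<Rightarrow> real^'w) \<Rightarrow> (real \<Rightarrow> real^'n) \<Rightarrow> real^'v \<Rightarrow> real^'e
   \<Rightarrow> (real \<Rightarrow> real \<Rightarrow> real^'n) \<Rightarrow> (real \<Rightarrow> real^'v) \<Rightarrow> (real \<Rightarrow> real^'e) \<Rightarrow> bool" where
  "closed_loop_solution \<Lambda> H Bu Bv M Bw Dv K1 K2 R S w \<xi>0 v0 \<eta>0 \<xi> v \<eta> \<longleftrightarrow>
    (let y = (\<lambda>t. \<xi> t 1 + Dv *v v t);
         u = (\<lambda>t. K1 *v \<eta> t + K2 *v y t)
     in (\<forall>z\<in>{0..1}. \<xi> 0 z = \<xi>0 z) \<and> v 0 = v0 \<and> \<eta> 0 = \<eta>0 \<and>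
        (\<forall>t\<ge>0. \<xi> t \<in> H1) \<and>
        (\<forall>t\<ge>0. ((\<lambda>s. L2_norm (\<lambda>z. \<xi> s z - \<xi> t z)
                      + L2_norm (\<lambda>z. Dz (\<xi> s) z - Dz (\<xi> t) z)) \<longlongrightarrow> 0) (at t within {0..})) \<and>
        (\<forall>t\<ge>0. ((\<lambda>s. L2_norm (\<lambda>z. (1 / (s - t)) *\<^sub>R (\<xi> s z - \<xi> t z) - (- (\<Lambda> *v Dz (\<xi> t) z))))
                  \<longlongrightarrow> 0) (at t within {0..})) \<and>
        (\<forall>t\<ge>0. \<xi> t 0 = H *v \<xi> t 1 + Bu *v u t + Bv *v v t) \<and>
        (\<forall>t\<ge>0. ((\<lambda>s. M *v v s + Bw *v w s) has_integral (v t - v 0)) {0..t}) \<and>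
        (\<forall>t\<ge>0. (\<eta> has_vector_derivative (R *v \<eta> t + S *v y t)) (at t within {0..})))"

definition exponentially_ISS ::
  "real^'n^'n \<Rightarrow> real^'n^'n \<Rightarrow> real^'u^'n \<Rightarrow> real^'v^'n \<Rightarrow> real^'v^'v \<Rightarrow> real^'w^'v \<Rightarrow> real^'v^'n
   \<Rightarrow> real^'e^'u \<Rightarrow> real^'n^'u \<Rightarrow> real^'e^'e \<Rightarrow> real^'n^'e \<Rightarrow> (real \<Rightarrow> real^'w) set \<Rightarrow> bool" where
  "exponentially_ISS \<Lambda> H Bu Bv M Bw Dv K1 K2 R S W \<longleftrightarrow>
    (\<exists>a>0. \<exists>\<rho>>0. \<exists>\<kappa>>0. \<forall>w\<in>W. \<forall>\<xi>0 v0 \<eta>0 \<xi> v \<eta>.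
       compatible_ic \<Lambda> H Bu Bv M Bw Dv K1 K2 R S w \<xi>0 v0 \<eta>0 \<longrightarrow>
       closed_loop_solution \<Lambda> H Bu Bv M Bw Dv K1 K2 R S w \<xi>0 v0 \<eta>0 \<xi> v \<eta> \<longrightarrow>
       (\<forall>t\<ge>0. X_norm (\<xi> t) (v t) (\<eta> t) \<le> \<rho> * exp (- a * t) * X_norm \<xi>0 v0 \<eta>0 + \<kappa> * signal_norm w))"

text \<open>Points of the extended state space are quadruples \<open>(\<xi>, \<partial>\<^sub>z \<xi>, v, \<eta>)\<close>; the distance between two
  of them is the \<^const>\<open>X_norm\<close> of the difference.\<close>

definition X_dist ::
  "(real \<Rightarrow> real^'n) \<times> (real \<Rightarrow> real^'n) \<times> (real^'v) \<times> (real^'e)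
   \<Rightarrow> (real \<Rightarrow> real^'n) \<times> (real \<Rightarrow> real^'n) \<times> (real^'v) \<times> (real^'e) \<Rightarrow> real" where
  "X_dist p q = (case p of (\<xi>, \<omega>, v, \<eta>) \<Rightarrow> case q of (\<xi>', \<omega>', v', \<eta>') \<Rightarrow>
     L2_norm (\<lambda>z. \<xi> z - \<xi>' z) + L2_norm (\<lambda>z. \<omega> z - \<omega>' z) + norm (v - v') + norm (\<eta> - \<eta>'))"

definition ultimate_bound_estimate ::
  "real^'n^'n \<Rightarrow> real^'n^'n \<Rightarrow> real^'u^'n \<Rightarrow> real^'v^'n \<Rightarrow> real^'v^'v \<Rightarrow> real^'w^'v \<Rightarrow> real^'v^'n
   \<Rightarrow> real^'e^'u \<Rightarrow> real^'n^'u \<Rightarrow> real^'e^'e \<Rightarrow> real^'n^'e \<Rightarrow> (real \<Rightarrow> real^'w) set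
   \<Rightarrow> ((real \<Rightarrow> real^'n) \<times> (real \<Rightarrow> real^'n) \<times> (real^'v) \<times> (real^'e)) set \<Rightarrow> bool" where
  "ultimate_bound_estimate \<Lambda> H Bu Bv M Bw Dv K1 K2 R S W A \<longleftrightarrow>
    (\<forall>w\<in>W. \<forall>\<xi>0 v0 \<eta>0 \<xi> v \<eta>.
       compatible_ic \<Lambda> H Bu Bv M Bw Dv K1 K2 R S w \<xi>0 v0 \<eta>0 \<longrightarrow>
       closed_loop_solution \<Lambda> H Bu Bv M Bw Dv K1 K2 R S w \<xi>0 v0 \<eta>0 \<xi> v \<eta> \<longrightarrow>
       (\<forall>\<epsilon>>0. \<forall>\<^sub>F t in at_top. \<exists>q\<in>A. X_dist (\<xi> t, Dz (\<xi> t), v t, \<eta> t) q < \<epsilon>))"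

definition lyapunov_V ::
  "real^'n^'n \<Rightarrow> real^'n^'n \<Rightarrow> real^'e^'e \<Rightarrow> real^'v^'v
   \<Rightarrow> (real \<Rightarrow> real^'n) \<Rightarrow> (real \<Rightarrow> real^'n) \<Rightarrow> real^'v \<Rightarrow> real^'e \<Rightarrow> real" where
  "lyapunov_V P1 P2 P3 P4 \<xi> \<omega> v \<eta> =
     integral {0..1} (\<lambda>z. exp (- z) * (\<xi> z \<bullet> (P1 *v \<xi> z)))
   + integral {0..1} (\<lambda>z. exp (- z) * (\<omega> z \<bullet> (P2 *v \<omega> z)))
   + \<eta> \<bullet> (P3 *v \<eta>) + v \<bullet> (P4 *v v)"

definition sublevel_set ::
  "real^'n^'n \<Rightarrow> real^'n^'n \<Rightarrow> real^'e^'e \<Rightarrow> real^'v^'v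
   \<Rightarrow> ((real \<Rightarrow> real^'n) \<times> (real \<Rightarrow> real^'n) \<times> (real^'v) \<times> (real^'e)) set" where
  "sublevel_set P1 P2 P3 P4 =
     {(\<xi>, \<omega>, v, \<eta>). \<xi> \<in> L2 \<and> \<omega> \<in> L2 \<and> \<xi> \<in> H1 \<and> \<omega> = Dz \<xi> \<and> lyapunov_V P1 P2 P3 P4 \<xi> \<omega> v \<eta> \<le> 1}"

end

theory Submission
  imports Defs
begin

text \<open>Rows 2, 3 and 8 of the design inequality, after a Schur complement, say that
  \<open>V = \<integral> e\<^sup>-\<^sup>z \<xi>\<^sup>T Q\<^sub>1\<^sup>-\<^sup>1 \<xi> + \<eta>\<^sup>T P\<^sub>3 \<eta>\<close> decays exponentially along the transport part of the closed
  loop up to a multiple of \<open>\<bar>v\<bar>\<^sup>2\<close>. This is an \<open>L\<^sup>2\<close> estimate; since the equations are linear with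
  constant coefficients, it also holds for difference quotients in time, and letting the time step
  tend to 0 it bounds \<open>\<partial>\<^sub>t \<xi> = - \<Lambda> \<partial>\<^sub>z \<xi>\<close> and hence the \<open>H\<^sup>1\<close> norm. The equation for \<open>v\<close> is autonomous and
  stable, so a cascade argument bounds \<open>\<parallel>(\<xi>, v, \<eta>)\<parallel>\<^sup>2\<close> at time \<open>t\<close> by a multiple of
  \<open>e\<^sup>-\<^sup>c\<^sup>t \<parallel>(\<xi>\<^sub>0, v\<^sub>0, \<eta>\<^sub>0)\<parallel>\<^sup>2 + e\<^sup>-\<^sup>c\<^sup>t \<integral> e\<^sup>c\<^sup>s \<bar>w(s)\<bar>\<^sup>2 ds\<close>. The last term is at most \<open>\<parallel>w\<parallel>\<^sub>\<infinity>\<^sup>2 / c\<close>, and it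
  tends to 0 because \<open>w\<close> is square integrable; so trajectories even converge to the origin, which
  lies in the sublevel set.\<close>

section \<open>Products of absolutely continuous functions\<close>

text \<open>Solutions are only absolutely continuous in z, and \<open>v\<close> only in t, so
  squares are differentiated through indefinite integrals; one product rule serves both the boundary
  identity of the transport term and the energy of \<open>v\<close>. In that identity the derivative
  of the weight \<open>exp (- z)\<close> produces the interior decay. The boundary values are
  written with \<open>a = G^-1 \<xi>(t,1)\<close>, and \<open>- G^2 / Q1 \<le> Q1 - 2 G\<close>
  makes the design inequality dominate the outflow term. Strictness of the inequality gives a
  margin, which absorbs the cross terms with \<open>v\<close>. The main obstacle is that
  \<open>w\<close> is merely measurable: \<open>v\<close> need not be differentiable at every time,
  so its difference quotients need not converge. Their weighted energy is therefore bounded by that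
  of \<open>M v + Bw w\<close> before the time step h tends to 0. The decay rate is
  \<open>c = min (2 * \<alpha> + \<beta>) \<mu>\<close>, with \<open>- \<mu>\<close> the largest
  diagonal entry of \<open>M\<close>, so that the exponential weight does not outgrow the decay of
  \<open>v\<close>.\<close>

text \<open>Lebesgue integrability is demanded besides the indefinite integral because
  \<open>has_integral\<close> is the gauge integral, which may exist without absolute integrability;
  the product rule needs the integral of \<bar>f\<bar>.\<close>

definition is_primitive :: "real \<Rightarrow> real \<Rightarrow> (real \<Rightarrow> real) \<Rightarrow> (real \<Rightarrow> real) \<Rightarrow> bool" where
  "is_primitive a b F f \<longleftrightarrow>
     integrable (lebesgue_on {a..b}) f \<and> (\<forall>x\<in>{a..b}. (f has_integral (F x - F a)) {a..x})"

text \<open>Cutting [a, b] into equal pieces shorter than d and telescoping gives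
  \<open>F b - F a \<le> e * (\<psi> b - \<psi> a)\<close>; here e is arbitrary while \<psi> is
  fixed. This takes the place of a derivative test for functions that are differentiable only almost
  everywhere.\<close>

lemma nonincreasing_if_small_increments:
  fixes F \<psi> :: "real \<Rightarrow> real"
  assumes "a \<le> b"
    and small: "\<And>e. e > 0 \<Longrightarrow> \<exists>d>0. \<forall>x y. a \<le> x \<longrightarrow> x \<le> y \<longrightarrow> y \<le> b \<longrightarrow> y - x < d \<longrightarrow>
                  F y - F x \<le> e * (\<psi> y - \<psi> x)"
  shows "F b \<le> F a"
proof -
  have bound: "F b - F a \<le> e * (\<psi> b - \<psi> a)" if "e > 0" for e
  proof -
    obtain d where d: "d > 0" "\<And>x y. a \<le> x \<Longrightarrow> x \<le> y \<Longrightarrow> y \<le> b \<Longrightarrow> y - x < d \<Longrightarrow>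
                  F y - F x \<le> e * (\<psi> y - \<psi> x)"
      using small[OF \<open>e > 0\<close>] by blast
    obtain N :: nat where N: "N > 0" "(b - a) / real N < d"
    proof -
      obtain N :: nat where "N > 0" "(b - a) / d < real N"
        using \<open>a \<le> b\<close> d(1) reals_Archimedean2[of "(b - a) / d"]
        by (metis divide_nonneg_pos diff_ge_0_iff_ge le_less_trans of_nat_0_less_iff)
      then show ?thesis using d(1) by (intro that[of N]) (auto simp: field_simps)
    qed
    define p where "p k = a + real k * ((b - a) / real N)" for k :: nat
    have p0: "p 0 = a" and pN: "p N = b" using N by (auto simp: p_def)
    have step: "F (p (Suc k)) - F (p k) \<le> e * (\<psi> (p (Suc k)) - \<psi> (p k))" if "k < N" for k
    proof (rule d(2))
      have eq: "p (Suc k) = p k + (b - a) / real N" by (simp add: p_def distrib_right add_divide_distrib)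
      have nn: "0 \<le> (b - a) / real N" using \<open>a \<le> b\<close> by simp
      then show "p k \<le> p (Suc k)" "p (Suc k) - p k < d"
        unfolding eq using N(2) by simp_all
      show "a \<le> p k" unfolding p_def using mult_nonneg_nonneg[OF _ nn, of "real k"] by linarith
      have "real (Suc k) * ((b - a) / real N) \<le> real N * ((b - a) / real N)"
        using that \<open>a \<le> b\<close> by (intro mult_right_mono) auto
      then show "p (Suc k) \<le> b" using N by (simp add: p_def)
    qed
    have "F b - F a = (\<Sum>k<N. F (p (Suc k)) - F (p k))"
      using sum_lessThan_telescope[of "\<lambda>k. F (p k)" N] by (simp add: p0 pN)
    also have "\<dots> \<le> (\<Sum>k<N. e * (\<psi> (p (Suc k)) - \<psi> (p k)))"
      by (intro sum_mono step) auto
    also have "\<dots> = e * (\<psi> b - \<psi> a)"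
      using sum_lessThan_telescope[of "\<lambda>k. \<psi> (p k)" N]
      by (simp add: sum_distrib_left[symmetric] p0 pN)
    finally show ?thesis .
  qed
  show ?thesis
  proof (cases "\<psi> b - \<psi> a \<le> 0")
    case True
    then show ?thesis using bound[of 1] by simp
  next
    case False
    have "F b - F a \<le> 0"
    proof (rule field_le_epsilon)
      fix e :: real assume "e > 0"
      then show "F b - F a \<le> 0 + e" using bound[of "e / (\<psi> b - \<psi> a)"] False by simp
    qed
    then show ?thesis by simp
  qed
qed

lemma integrable_on_if_lebesgue_on:
  fixes f :: "real \<Rightarrow> 'a::euclidean_space"
  assumes "integrable (lebesgue_on {a..b}) f" "a \<le> x" "y \<le> b"
  shows "integrable (lebesgue_on {x..y}) f" "f integrable_on {x..y}"
proof -
  show "integrable (lebesgue_on {x..y}) f"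
    by (rule integrable_subinterval[OF _ _ ]) (use assms in auto)
  then show "f integrable_on {x..y}" by (intro integrable_on_lebesgue_on) auto
qed

lemma has_integral_lebesgue_on:
  fixes f :: "real \<Rightarrow> 'a::euclidean_space"
  assumes "integrable (lebesgue_on {a..b}) f"
  shows "(f has_integral (integral\<^sup>L (lebesgue_on {a..b}) f)) {a..b}"
  using has_integral_integral_lebesgue_on[OF assms] by auto

lemma integrable_lebesgue_on_mult_continuous:
  fixes f g :: "real \<Rightarrow> real"
  assumes f: "integrable (lebesgue_on {a..b}) f" and g: "continuous_on {a..b} g"
  shows "integrable (lebesgue_on {a..b}) (\<lambda>x. f x * g x)"
proof -
  obtain B where B: "\<And>x. x \<in> {a..b} \<Longrightarrow> norm (g x) \<le> B"
    using compact_continuous_image[OF g] compact_imp_bounded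
    by (metis bounded_iff compact_Icc image_eqI)
  have gm: "g \<in> borel_measurable (lebesgue_on {a..b})"
    by (rule continuous_imp_measurable_on_sets_lebesgue[OF g]) auto
  show ?thesis
  proof (rule Bochner_Integration.integrable_bound)
    show "integrable (lebesgue_on {a..b}) (\<lambda>x. B * f x)" using f by simp
    show "(\<lambda>x. f x * g x) \<in> borel_measurable (lebesgue_on {a..b})" using f gm by measurable
    show "AE x in lebesgue_on {a..b}. norm (f x * g x) \<le> norm (B * f x)"
    proof (rule AE_I2)
      fix x assume "x \<in> space (lebesgue_on {a..b})"
      then have "norm (g x) \<le> \<bar>B\<bar>" using B[of x] by auto
      then show "norm (f x * g x) \<le> norm (B * f x)"
        by (simp add: abs_mult mult.commute[of "\<bar>f x\<bar>"] mult_right_mono)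
    qed
  qed
qed

lemma is_primitive_continuous:
  assumes "is_primitive a b F f" shows "continuous_on {a..b} F"
proof -
  have i: "f integrable_on {a..b}"
    using assms integrable_on_if_lebesgue_on(2)[of a b f a b] by (auto simp: is_primitive_def)
  have "continuous_on {a..b} (\<lambda>x. F a + integral {a..x} f)"
    by (intro continuous_intros indefinite_integral_continuous_1 i)
  moreover have "F a + integral {a..x} f = F x" if "x \<in> {a..b}" for x
    using assms that by (auto simp: is_primitive_def dest!: bspec[of _ _ x] integral_unique)
  ultimately show ?thesis by (rule continuous_on_eq)
qed

lemma is_primitive_increment:
  assumes "is_primitive a b F f" "a \<le> x" "x \<le> y" "y \<le> b"
  shows "(f has_integral (F y - F x)) {x..y}"
proof -
  have 1: "f integrable_on {a..y}" "f integrable_on {x..y}"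
    using assms integrable_on_if_lebesgue_on(2)[of a b f a y]
      integrable_on_if_lebesgue_on(2)[of a b f x y] by (auto simp: is_primitive_def)
  have "integral {a..x} f + integral {x..y} f = integral {a..y} f"
    using assms 1 by (intro Henstock_Kurzweil_Integration.integral_combine) auto
  moreover have "integral {a..x} f = F x - F a" "integral {a..y} f = F y - F a"
    using assms by (auto simp: is_primitive_def intro!: integral_unique)
  ultimately have "integral {x..y} f = F y - F x" by simp
  then show ?thesis using 1(2) by (simp add: has_integral_integral)
qed

lemma is_primitive_of_derivative:
  assumes der: "\<And>x. x \<in> {a..b} \<Longrightarrow> (F has_real_derivative f x) (at x within {a..b})"
    and cont: "continuous_on {a..b} f"
  shows "is_primitive a b F f"
proof -
  have "integrable (lebesgue_on {a..b}) f"
    using absolutely_integrable_continuous_real[OF cont]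
    by (simp add: set_integrable_def integrable_restrict_space)
  moreover have "(f has_integral (F x - F a)) {a..x}" if "x \<in> {a..b}" for x
    by (rule fundamental_theorem_of_calculus)
       (use that in \<open>auto simp: has_real_derivative_iff_has_vector_derivative[symmetric]
          intro!: DERIV_subset[OF der]\<close>)
  ultimately show ?thesis by (auto simp: is_primitive_def)
qed

lemma is_primitive_sum:
  assumes "finite I" "\<And>i. i \<in> I \<Longrightarrow> is_primitive a b (F i) (f i)"
  shows "is_primitive a b (\<lambda>x. \<Sum>i\<in>I. F i x) (\<lambda>x. \<Sum>i\<in>I. f i x)"
  using assms by (auto simp: is_primitive_def sum_subtractf[symmetric] intro!: has_integral_sum)

text \<open>On a short interval the defect \<open>\<integral> f (G y - G) + (F x - F) g\<close> of the product rule is small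
  relative to \<open>\<integral> \<bar>f\<bar> + \<bar>g\<bar>\<close> by uniform continuity; hence it vanishes.\<close>

lemma is_primitive_mult:
  assumes F: "is_primitive a b F f" and G: "is_primitive a b G g"
  shows "is_primitive a b (\<lambda>x. F x * G x) (\<lambda>x. f x * G x + F x * g x)"
proof -
  let ?r = "\<lambda>x. f x * G x + F x * g x"
  have cF: "continuous_on {a..b} F" and cG: "continuous_on {a..b} G"
    using F G by (auto intro: is_primitive_continuous)
  have fi: "integrable (lebesgue_on {a..b}) f" and gi: "integrable (lebesgue_on {a..b}) g"
    using F G by (auto simp: is_primitive_def)
  have ri: "integrable (lebesgue_on {a..b}) ?r"
    using integrable_lebesgue_on_mult_continuous[OF fi cG]
      integrable_lebesgue_on_mult_continuous[OF gi cF] by (simp add: mult.commute)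
  define n where "n x = \<bar>f x\<bar> + \<bar>g x\<bar>" for x
  have ni: "integrable (lebesgue_on {a..b}) n" unfolding n_def using fi gi by auto
  note sub = integrable_on_if_lebesgue_on(2)
  \<comment> \<open>The two signs \<sigma> = 1 and \<sigma> = - 1 turn the one-sided monotonicity
    criterion into an equation.\<close>
  have main: "\<sigma> * (F x * G x - F a * G a - integral {a..x} ?r) \<le> 0"
    if x: "x \<in> {a..b}" and \<sigma>: "\<bar>\<sigma>\<bar> = 1" for x \<sigma>
  proof -
    define D where "D y = \<sigma> * (F y * G y - integral {a..y} ?r)" for y
    have "D x \<le> D a"
    proof (rule nonincreasing_if_small_increments[where F = D and a = a and b = x and \<psi> = "\<lambda>y. integral {a..y} n"])
      show "a \<le> x" using x by simp
      fix e :: real assume "e > 0"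
      obtain d1 where d1: "d1 > 0"
        "\<And>u v. u \<in> {a..b} \<Longrightarrow> v \<in> {a..b} \<Longrightarrow> dist v u < d1 \<Longrightarrow> dist (F v) (F u) < e"
        using uniformly_continuous_onE[OF compact_uniformly_continuous[OF cF compact_Icc] \<open>e > 0\<close>]
        by metis
      obtain d2 where d2: "d2 > 0"
        "\<And>u v. u \<in> {a..b} \<Longrightarrow> v \<in> {a..b} \<Longrightarrow> dist v u < d2 \<Longrightarrow> dist (G v) (G u) < e"
        using uniformly_continuous_onE[OF compact_uniformly_continuous[OF cG compact_Icc] \<open>e > 0\<close>]
        by metis
      show "\<exists>d>0. \<forall>u v. a \<le> u \<longrightarrow> u \<le> v \<longrightarrow> v \<le> x \<longrightarrow> v - u < d \<longrightarrow>
          D v - D u \<le> e * (integral {a..v} n - integral {a..u} n)"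
      proof (intro exI[of _ "min d1 d2"] conjI allI impI)
        show "min d1 d2 > 0" using d1 d2 by simp
        fix u v assume uv: "a \<le> u" "u \<le> v" "v \<le> x" "v - u < min d1 d2"
        have vb: "v \<le> b" using uv x by simp
        have nuv: "integral {a..v} n - integral {a..u} n = integral {u..v} n"
          using Henstock_Kurzweil_Integration.integral_combine[of a u v n] uv vb sub[OF ni, of a v] by simp
        have ruv: "integral {a..v} ?r - integral {a..u} ?r = integral {u..v} ?r"
          using Henstock_Kurzweil_Integration.integral_combine[of a u v ?r] uv vb sub[OF ri, of a v] by simp
        \<comment> \<open>Freezing \<open>G\<close> at the right end and \<open>F\<close> at the
          left end splits \<open>F v * G v - F u * G u\<close> exactly; subtracting the integral of
          \<open>?r\<close> then leaves only oscillations over [u, v].\<close>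
        have h1: "((\<lambda>s. f s * G v) has_integral ((F v - F u) * G v)) {u..v}"
          using is_primitive_increment[OF F uv(1,2) vb] by (rule has_integral_mult_left)
        have h2: "((\<lambda>s. F u * g s) has_integral (F u * (G v - G u))) {u..v}"
          using is_primitive_increment[OF G uv(1,2) vb] by (rule has_integral_mult_right)
        have h3: "(?r has_integral integral {u..v} ?r) {u..v}"
          using sub[OF ri, of u v] uv vb by (simp add: integrable_integral)
        have h: "((\<lambda>s. f s * (G v - G s) + (F u - F s) * g s) has_integral
                  (F v * G v - F u * G u - integral {u..v} ?r)) {u..v}"
          using has_integral_diff[OF has_integral_add[OF h1 h2] h3]
          by (simp add: algebra_simps)
        have hn: "((\<lambda>s. e * n s) has_integral (e * integral {u..v} n)) {u..v}"
          using sub[OF ni, of u v] uv vb by (intro has_integral_mult_right) (simp add: integrable_integral)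
        have "norm (F v * G v - F u * G u - integral {u..v} ?r) \<le> e * integral {u..v} n"
        proof -
          have "norm (integral {u..v} (\<lambda>s. f s * (G v - G s) + (F u - F s) * g s))
               \<le> integral {u..v} (\<lambda>s. e * n s)"
          proof (rule integral_norm_bound_integral)
            show "(\<lambda>s. f s * (G v - G s) + (F u - F s) * g s) integrable_on {u..v}" using h by blast
            show "(\<lambda>s. e * n s) integrable_on {u..v}" using hn by blast
            fix s assume s: "s \<in> {u..v}"
            have 1: "\<bar>G v - G s\<bar> \<le> e" using d2(2)[of s v] s uv vb by (auto simp: dist_real_def)
            have 2: "\<bar>F u - F s\<bar> \<le> e" using d1(2)[of s u] s uv vb by (auto simp: dist_real_def)
            have "\<bar>f s * (G v - G s) + (F u - F s) * g s\<bar>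
                \<le> \<bar>f s\<bar> * \<bar>G v - G s\<bar> + \<bar>F u - F s\<bar> * \<bar>g s\<bar>"
              by (metis abs_mult abs_triangle_ineq)
            also have "\<dots> \<le> \<bar>f s\<bar> * e + e * \<bar>g s\<bar>"
              using 1 2 by (intro add_mono mult_left_mono mult_right_mono) auto
            finally show "norm (f s * (G v - G s) + (F u - F s) * g s) \<le> e * n s"
              by (simp add: n_def algebra_simps)
          qed
          then show ?thesis using integral_unique[OF h] integral_unique[OF hn] by simp
        qed
        moreover have "D v - D u = \<sigma> * (F v * G v - F u * G u - integral {u..v} ?r)"
          using ruv by (simp add: D_def algebra_simps flip: ruv)
        moreover have "\<sigma> * z \<le> norm z" for z :: real
          using \<sigma> by (metis abs_ge_self abs_mult mult_1 real_norm_def)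
        ultimately show "D v - D u \<le> e * (integral {a..v} n - integral {a..u} n)"
          unfolding nuv by (metis order_trans)
      qed
    qed
    then show ?thesis by (simp add: D_def algebra_simps)
  qed
  have "(?r has_integral (F x * G x - F a * G a)) {a..x}" if x: "x \<in> {a..b}" for x
  proof -
    have "F x * G x - F a * G a = integral {a..x} ?r"
      using main[OF x, of 1] main[OF x, of "-1"] by simp
    then show ?thesis using sub[OF ri, of a x] x by (simp add: integrable_integral)
  qed
  then show ?thesis using ri by (auto simp: is_primitive_def)
qed

section \<open>Square integrable functions\<close>

abbreviation unit_measure :: "real measure" where
  "unit_measure \<equiv> lebesgue_on {0..1}"

text \<open>A Bochner integral, so that linearity and monotonicity follow from integrability;
  \<open>L2_norm\<close> is defined by the gauge integral, and the two meet in
  \<open>L2_norm_power2\<close>.\<close>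

definition ip :: "(real \<Rightarrow> real^'n) \<Rightarrow> (real \<Rightarrow> real^'n) \<Rightarrow> real" where
  "ip f g = integral\<^sup>L unit_measure (\<lambda>z. f z \<bullet> g z)"

text \<open>Multiplication by \<open>exp (- z)\<close> and by the diagonal matrix P with entries
  \<open>p\<close>, so that \<open>ip f (weighted p f)\<close> is the integral of e^(-z) f^T P f, as
  in the Lyapunov functional.\<close>

definition weighted :: "('n \<Rightarrow> real) \<Rightarrow> (real \<Rightarrow> real^'n) \<Rightarrow> real \<Rightarrow> real^'n" where
  "weighted p f z = exp (- z) *\<^sub>R (\<chi> i. p i * f z $ i)"

lemma L2_measurable: "f \<in> L2 \<Longrightarrow> f \<in> borel_measurable unit_measure"
  and L2_integrable: "f \<in> L2 \<Longrightarrow> integrable unit_measure (\<lambda>z. f z \<bullet> f z)"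
  by (auto simp: L2_def)

lemma L2_dominated:
  fixes f :: "real \<Rightarrow> real^'n" and g :: "real \<Rightarrow> real^'m"
  assumes g: "g \<in> L2" and f: "f \<in> borel_measurable unit_measure"
    and le: "\<And>z. z \<in> {0..1} \<Longrightarrow> norm (f z) \<le> K * norm (g z)"
  shows "f \<in> L2"
proof -
  have "integrable unit_measure (\<lambda>z. f z \<bullet> f z)"
  proof (rule Bochner_Integration.integrable_bound)
    show "integrable unit_measure (\<lambda>z. K\<^sup>2 * (g z \<bullet> g z))" using L2_integrable[OF g] by simp
    show "(\<lambda>z. f z \<bullet> f z) \<in> borel_measurable unit_measure" using f by measurable
    show "AE z in unit_measure. norm (f z \<bullet> f z) \<le> norm (K\<^sup>2 * (g z \<bullet> g z))"
    proof (rule AE_I2)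
      fix z assume "z \<in> space unit_measure"
      then have "(norm (f z))\<^sup>2 \<le> (K * norm (g z))\<^sup>2" by (intro power_mono le) auto
      then show "norm (f z \<bullet> f z) \<le> norm (K\<^sup>2 * (g z \<bullet> g z))"
        by (simp add: power_mult_distrib dot_square_norm)
    qed
  qed
  then show ?thesis using f by (auto simp: L2_def)
qed

lemma L2_inner_integrable:
  assumes "f \<in> L2" "g \<in> L2" shows "integrable unit_measure (\<lambda>z. f z \<bullet> g z)"
proof (rule Bochner_Integration.integrable_bound)
  show "integrable unit_measure (\<lambda>z. f z \<bullet> f z + g z \<bullet> g z)"
    using assms by (auto simp: L2_def)
  show "(\<lambda>z. f z \<bullet> g z) \<in> borel_measurable unit_measure"
    using assms[THEN L2_measurable] by measurable
  have "\<bar>x \<bullet> y\<bar> \<le> x \<bullet> x + y \<bullet> y" for x y :: "real^'a"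
  proof -
    have "0 \<le> (x - y) \<bullet> (x - y)" "0 \<le> (x + y) \<bullet> (x + y)" "0 \<le> x \<bullet> x" "0 \<le> y \<bullet> y" by simp_all
    then show ?thesis by (simp add: inner_diff_left inner_diff_right inner_add_left inner_add_right inner_commute)
  qed
  then show "AE z in unit_measure. norm (f z \<bullet> g z) \<le> norm (f z \<bullet> f z + g z \<bullet> g z)"
    by (intro AE_I2) simp
qed

lemma L2_add: assumes "f \<in> L2" "g \<in> L2" shows "(\<lambda>z. f z + g z) \<in> L2"
proof -
  have "integrable unit_measure (\<lambda>z. (f z + g z) \<bullet> (f z + g z))"
    using L2_inner_integrable[OF assms] L2_inner_integrable[OF assms(2,1)] assms[THEN L2_integrable]
    by (simp add: inner_add_left inner_add_right)
  then show ?thesis using assms[THEN L2_measurable] by (simp add: L2_def)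
qed

lemma L2_scaleR: "f \<in> L2 \<Longrightarrow> (\<lambda>z. c *\<^sub>R f z) \<in> L2"
  by (rule L2_dominated[where K = "\<bar>c\<bar>"]) (auto intro!: borel_measurable_scaleR dest: L2_measurable)

lemma L2_minus: "f \<in> L2 \<Longrightarrow> (\<lambda>z. - f z) \<in> L2"
  using L2_scaleR[of f "-1"] by simp

lemma L2_diff: "f \<in> L2 \<Longrightarrow> g \<in> L2 \<Longrightarrow> (\<lambda>z. f z - g z) \<in> L2"
  using L2_add[of f "\<lambda>z. - g z"] L2_minus[of g] by simp

lemma L2_cong:
  assumes "f \<in> L2" "\<And>z. z \<in> {0..1} \<Longrightarrow> f z = g z" shows "g \<in> L2"
proof (rule L2_dominated[OF assms(1), where K = 1])
  show "g \<in> borel_measurable unit_measure"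
    using L2_measurable[OF assms(1)] assms(2) by (subst measurable_cong[of _ _ f]) auto
qed (use assms(2) in auto)

lemma L2_continuous:
  assumes "continuous_on {0..1} f" shows "f \<in> L2"
proof -
  have "integrable unit_measure (\<lambda>z. f z \<bullet> f z)"
    using absolutely_integrable_continuous_real[of 0 1 "\<lambda>z. f z \<bullet> f z"] assms
    by (simp add: set_integrable_def integrable_restrict_space continuous_intros)
  moreover have "f \<in> borel_measurable unit_measure"
    by (rule continuous_imp_measurable_on_sets_lebesgue[OF assms]) auto
  ultimately show ?thesis by (simp add: L2_def)
qed

lemma borel_measurable_bounded_linear:
  "bounded_linear T \<Longrightarrow> f \<in> borel_measurable M \<Longrightarrow> (\<lambda>z. T (f z)) \<in> borel_measurable M"
  by (rule borel_measurable_continuous_on[of T f M]) (rule linear_continuous_on)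

lemma L2_matrix:
  fixes A :: "real^'n^'m"
  assumes "f \<in> L2" shows "(\<lambda>z. A *v f z) \<in> L2"
proof -
  have bl: "bounded_linear (\<lambda>x. A *v x)" by simp
  show ?thesis
  proof (rule L2_dominated[OF assms])
    show "(\<lambda>z. A *v f z) \<in> borel_measurable unit_measure"
      using bl L2_measurable[OF assms] by (rule borel_measurable_bounded_linear)
    show "norm (A *v f z) \<le> onorm (\<lambda>x. A *v x) * norm (f z)" for z
      using bl by (rule onorm)
  qed
qed

lemma weighted_dominated:
  assumes "\<And>i. \<bar>p i\<bar> \<le> P" "z \<in> {0..1}"
  shows "norm (weighted p f z) \<le> P * norm (f z)"
proof -
  have "P \<ge> 0" using assms(1)[of undefined] by linarith
  have "norm (\<chi> i. p i * f z $ i) \<le> norm (P *\<^sub>R f z)"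
    by (rule norm_le_componentwise_cart)
       (use assms(1) \<open>P \<ge> 0\<close> in \<open>simp add: abs_mult mult_right_mono\<close>)
  moreover have "norm (weighted p f z) \<le> 1 * norm (\<chi> i. p i * f z $ i)"
    unfolding weighted_def norm_scaleR by (rule mult_right_mono) (use assms(2) in auto)
  ultimately show ?thesis using \<open>P \<ge> 0\<close> by simp
qed

lemma L2_weighted:
  fixes f :: "real \<Rightarrow> real^'n"
  assumes "f \<in> L2" shows "weighted p f \<in> L2"
proof -
  define P where "P = Max (range (\<lambda>i. \<bar>p i\<bar>))"
  have P: "\<bar>p i\<bar> \<le> P" for i unfolding P_def by (rule Max_ge) auto
  have "(\<lambda>z. \<chi> i. p i * f z $ i) \<in> borel_measurable unit_measure"
  proof -
    have "bounded_linear (\<lambda>x. (\<chi> i. p i * x $ i) :: real^'n)"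
      by (auto simp: linear_conv_bounded_linear[symmetric] linear_iff vec_eq_iff algebra_simps)
    then show ?thesis by (rule borel_measurable_bounded_linear) (rule L2_measurable[OF assms])
  qed
  moreover have "(\<lambda>z::real. exp (- z)) \<in> borel_measurable unit_measure"
    by (rule continuous_imp_measurable_on_sets_lebesgue) (auto intro!: continuous_intros)
  ultimately have "weighted p f \<in> borel_measurable unit_measure"
    unfolding weighted_def[abs_def] by (rule borel_measurable_scaleR[rotated])
  then show ?thesis
    by (rule L2_dominated[OF assms, where K = P]) (rule weighted_dominated[of p P, OF P])
qed

section \<open>Inner product, norm and Cauchy-Schwarz inequality on L2\<close>

lemma ip_commute: "ip f g = ip g f"
  by (simp add: ip_def inner_commute)

lemma ip_add_left: "f \<in> L2 \<Longrightarrow> g \<in> L2 \<Longrightarrow> h \<in> L2 \<Longrightarrow> ip (\<lambda>z. f z + g z) h = ip f h + ip g h"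
  by (simp add: ip_def inner_add_left L2_inner_integrable)

lemma ip_add_right: "f \<in> L2 \<Longrightarrow> g \<in> L2 \<Longrightarrow> h \<in> L2 \<Longrightarrow> ip h (\<lambda>z. f z + g z) = ip h f + ip h g"
  by (simp add: ip_def inner_add_right L2_inner_integrable)

lemma ip_scaleR_left [simp]: "ip (\<lambda>z. c *\<^sub>R f z) g = c * ip f g"
  and ip_scaleR_right [simp]: "ip f (\<lambda>z. c *\<^sub>R g z) = c * ip f g"
  by (simp_all add: ip_def)

lemma ip_self_nonneg: "0 \<le> ip f f"
  unfolding ip_def by (rule Bochner_Integration.integral_nonneg) simp

lemma ip_weighted_commute: "ip f (weighted p g) = ip (weighted p f) g"
  by (simp add: ip_def weighted_def inner_vec_def mult_ac)

lemma L2_norm_nonneg: "0 \<le> L2_norm f"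
proof (cases "(\<lambda>z. f z \<bullet> f z) integrable_on {0..1}")
  case True
  then show ?thesis unfolding L2_norm_def by (simp add: Henstock_Kurzweil_Integration.integral_nonneg)
\<comment> \<open>A function that is not integrable has gauge integral 0 by convention.\<close>
qed (simp add: L2_norm_def not_integrable_integral)

lemma L2_norm_power2: "f \<in> L2 \<Longrightarrow> (L2_norm f)\<^sup>2 = ip f f"
  using ip_self_nonneg[of f] lebesgue_integral_eq_integral[of "{0..1}" "\<lambda>z. f z \<bullet> f z"]
  by (simp add: L2_norm_def ip_def L2_integrable)

lemma L2_norm_cong: "(\<And>z. z \<in> {0..1} \<Longrightarrow> f z = g z) \<Longrightarrow> L2_norm f = L2_norm g"
  unfolding L2_norm_def by (metis (mono_tags, lifting) Henstock_Kurzweil_Integration.integral_cong)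

text \<open>Nonnegativity at the minimiser t = - B / C is the claim; for C = 0 the polynomial is
  affine in t, which forces B = 0.\<close>

lemma discriminant_bound:
  fixes A B C :: real
  assumes "\<And>t. 0 \<le> A + 2 * t * B + t\<^sup>2 * C" "0 \<le> C"
  shows "B\<^sup>2 \<le> A * C"
proof (cases "C = 0")
  case True
  have "B = 0"
  proof (rule ccontr)
    assume "B \<noteq> 0"
    \<comment> \<open>At this t the affine polynomial takes the value - 1.\<close>
    then show False using assms(1)[of "- (A + 1) / (2 * B)"] True by (simp add: field_simps)
  qed
  then show ?thesis using True by simp
next
  case False
  have "0 \<le> C * (A + 2 * (- B / C) * B + (- B / C)\<^sup>2 * C)"
    using assms(1)[of "- B / C"] assms(2) by (intro mult_nonneg_nonneg)
  also have "\<dots> = A * C - B\<^sup>2" using False by (simp add: field_simps power2_eq_square)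
  finally show ?thesis by simp
qed

lemma ip_Cauchy_Schwarz:
  assumes "f \<in> L2" "g \<in> L2"
  shows "\<bar>ip f g\<bar> \<le> L2_norm f * L2_norm g"
proof -
  have "(ip f g)\<^sup>2 \<le> ip f f * ip g g"
  proof (rule discriminant_bound[OF _ ip_self_nonneg])
    fix t
    have "0 \<le> ip (\<lambda>z. f z + t *\<^sub>R g z) (\<lambda>z. f z + t *\<^sub>R g z)" by (rule ip_self_nonneg)
    also have "\<dots> = ip f f + 2 * t * ip f g + t\<^sup>2 * ip g g"
      using assms by (simp add: ip_add_left ip_add_right L2_add L2_scaleR ip_commute[of g f]
          power2_eq_square algebra_simps)
    finally show "0 \<le> ip f f + 2 * t * ip f g + t\<^sup>2 * ip g g" .
  qed
  also have "\<dots> = (L2_norm f * L2_norm g)\<^sup>2"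
    using assms by (simp add: power_mult_distrib L2_norm_power2)
  finally show ?thesis
    by (metis L2_norm_nonneg abs_le_square_iff abs_of_nonneg mult_nonneg_nonneg)
qed

lemma L2_norm_scaleR: "L2_norm (\<lambda>z. c *\<^sub>R f z) = \<bar>c\<bar> * L2_norm f"
proof -
  have "integral {0..1} (\<lambda>z. c *\<^sub>R f z \<bullet> c *\<^sub>R f z) = c\<^sup>2 * integral {0..1} (\<lambda>z. f z \<bullet> f z)"
    by (simp add: power2_eq_square mult.assoc)
  then show ?thesis by (simp add: L2_norm_def real_sqrt_mult)
qed

lemma L2_norm_minus: "L2_norm (\<lambda>z. - f z) = L2_norm f"
  by (simp add: L2_norm_def)

lemma L2_norm_triangle:
  assumes "f \<in> L2" "g \<in> L2"
  shows "L2_norm (\<lambda>z. f z + g z) \<le> L2_norm f + L2_norm g"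
proof (rule power2_le_imp_le)
  have "(L2_norm (\<lambda>z. f z + g z))\<^sup>2 = ip f f + 2 * ip f g + ip g g"
    using assms by (simp add: L2_norm_power2 L2_add ip_add_left ip_add_right ip_commute[of g f])
  also have "\<dots> \<le> (L2_norm f + L2_norm g)\<^sup>2"
    using ip_Cauchy_Schwarz[OF assms] assms by (simp add: power2_sum L2_norm_power2)
  finally show "(L2_norm (\<lambda>z. f z + g z))\<^sup>2 \<le> (L2_norm f + L2_norm g)\<^sup>2" .
qed (simp add: L2_norm_nonneg)

lemma L2_norm_triangle_diff:
  "f \<in> L2 \<Longrightarrow> g \<in> L2 \<Longrightarrow> L2_norm (\<lambda>z. f z - g z) \<le> L2_norm f + L2_norm g"
  using L2_norm_triangle[of f "\<lambda>z. - g z"] by (simp add: L2_minus L2_norm_minus)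

lemma ip_self_dominated:
  fixes f :: "real \<Rightarrow> real^'n" and g :: "real \<Rightarrow> real^'m"
  assumes "f \<in> L2" "g \<in> L2" "0 \<le> K" "\<And>z. z \<in> {0..1} \<Longrightarrow> norm (f z) \<le> K * norm (g z)"
  shows "ip f f \<le> K\<^sup>2 * ip g g"
proof -
  have "ip f f \<le> (\<integral>z. K\<^sup>2 * (g z \<bullet> g z) \<partial>unit_measure)" unfolding ip_def
  proof (rule integral_mono)
    fix z assume "z \<in> space unit_measure"
    then have "(norm (f z))\<^sup>2 \<le> (K * norm (g z))\<^sup>2" by (intro power_mono assms) auto
    then show "f z \<bullet> f z \<le> K\<^sup>2 * (g z \<bullet> g z)"
      by (simp add: power_mult_distrib dot_square_norm)
  qed (use assms L2_integrable in auto)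
  then show ?thesis by (simp add: ip_def)
qed

lemma L2_norm_dominated:
  fixes f :: "real \<Rightarrow> real^'n" and g :: "real \<Rightarrow> real^'m"
  assumes "f \<in> L2" "g \<in> L2" "0 \<le> K" "\<And>z. z \<in> {0..1} \<Longrightarrow> norm (f z) \<le> K * norm (g z)"
  shows "L2_norm f \<le> K * L2_norm g"
  by (rule power2_le_imp_le)
     (use ip_self_dominated[OF assms] assms in \<open>auto simp: power_mult_distrib L2_norm_power2 L2_norm_nonneg\<close>)

section \<open>The Lyapunov estimate\<close>

lemma diagonal_mx_vector_mult:
  assumes "diagonal_mx A" shows "A *v x = (\<chi> i. A $ i $ i * x $ i)"
proof -
  have "(\<Sum>j\<in>UNIV. A $ i $ j * x $ j) = (\<Sum>j\<in>UNIV. if j = i then A $ i $ i * x $ i else 0)" for i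
    using assms by (intro sum.cong) (auto simp: diagonal_mx_def)
  then show ?thesis by (simp add: matrix_vector_mult_def)
qed

lemma symmetric_mx_inner: "symmetric_mx A \<Longrightarrow> x \<bullet> (A *v y) = (A *v x) \<bullet> y"
  by (metis dot_lmul_matrix symmetric_mx_def transpose_matrix_vector)

text \<open>With \<open>\<zeta> s = \<zeta> t + (s - t) (\<phi> + r s)\<close> and
  \<open>r s\<close> tending to 0 in L2, the form expands exactly: its difference quotient is the
  claimed derivative plus a term linear in \<open>r s\<close> and a term with the factor s - t.
  Differentiability in time is thus needed only as a limit in L2.\<close>

lemma L2_quadratic_has_derivative:
  fixes \<zeta> :: "real \<Rightarrow> real \<Rightarrow> real^'n"
  assumes L2: "\<And>s. 0 \<le> s \<Longrightarrow> \<zeta> s \<in> L2" and \<phi>: "\<phi> \<in> L2" and t: "0 \<le> t"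
    and lim: "((\<lambda>s. L2_norm (\<lambda>z. (1 / (s - t)) *\<^sub>R (\<zeta> s z - \<zeta> t z) - \<phi> z)) \<longlongrightarrow> 0) (at t within {0..})"
  shows "((\<lambda>s. ip (\<zeta> s) (weighted p (\<zeta> s))) has_real_derivative 2 * ip \<phi> (weighted p (\<zeta> t)))
           (at t within {0..})"
proof -
  define P where "P = Max (range (\<lambda>i. \<bar>p i\<bar>))"
  have P: "\<bar>p i\<bar> \<le> P" for i unfolding P_def by (rule Max_ge) auto
  have P0: "P \<ge> 0" using P[of undefined] by linarith
  define r where "r s z = (1 / (s - t)) *\<^sub>R (\<zeta> s z - \<zeta> t z) - \<phi> z" for s z
  define f where "f s z = \<phi> z + r s z" for s z
  have ev: "\<forall>\<^sub>F s in at t within {0..}. 0 \<le> s \<and> s \<noteq> t"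
    by (auto simp: eventually_at_filter)
  have rL: "r s \<in> L2" if "0 \<le> s" for s
    unfolding r_def[abs_def] using L2[OF that] L2[OF t] \<phi> by (intro L2_diff L2_scaleR) auto
  have fL: "f s \<in> L2" if "0 \<le> s" for s
    unfolding f_def[abs_def] using rL[OF that] \<phi> by (intro L2_add) auto
  have rlim: "((\<lambda>s. L2_norm (r s)) \<longlongrightarrow> 0) (at t within {0..})"
    using lim unfolding r_def[abs_def] .
  have quot: "(ip (\<zeta> s) (weighted p (\<zeta> s)) - ip (\<zeta> t) (weighted p (\<zeta> t))) / (s - t)
      = 2 * ip \<phi> (weighted p (\<zeta> t)) + 2 * ip (r s) (weighted p (\<zeta> t)) + (s - t) * ip (f s) (weighted p (f s))"
    if s: "0 \<le> s \<and> s \<noteq> t" for s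
  proof -
    have eq: "\<zeta> s z = \<zeta> t z + (s - t) *\<^sub>R f s z" for z
      using s by (simp add: f_def r_def)
    have weq: "weighted p (\<zeta> s) z = weighted p (\<zeta> t) z + (s - t) *\<^sub>R weighted p (f s) z" for z
      by (simp add: weighted_def vec_eq_iff algebra_simps eq)
    have g: "(\<lambda>z. (s - t) *\<^sub>R f s z) \<in> L2" using fL[of s] s by (intro L2_scaleR) auto
    have "ip (\<zeta> s) (weighted p (\<zeta> s)) = ip (\<lambda>z. \<zeta> t z + (s - t) *\<^sub>R f s z)
             (\<lambda>z. weighted p (\<zeta> t) z + (s - t) *\<^sub>R weighted p (f s) z)"
      unfolding ip_def by (simp only: eq[symmetric] weq[symmetric])
    also have "\<dots> = ip (\<zeta> t) (weighted p (\<zeta> t)) + (s - t) * ip (f s) (weighted p (\<zeta> t))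
       + ((s - t) * ip (\<zeta> t) (weighted p (f s)) + (s - t) * ((s - t) * ip (f s) (weighted p (f s))))"
      using s t by (simp add: ip_add_left ip_add_right L2_add g L2 fL L2_weighted L2_scaleR)
         (simp add: algebra_simps)
    \<comment> \<open>The weight is a symmetric operator, so the two mixed terms coincide.\<close>
    also have "ip (\<zeta> t) (weighted p (f s)) = ip (f s) (weighted p (\<zeta> t))"
      using ip_weighted_commute[of "\<zeta> t" p "f s"] ip_commute[of "weighted p (\<zeta> t)" "f s"] by simp
    finally have "(ip (\<zeta> s) (weighted p (\<zeta> s)) - ip (\<zeta> t) (weighted p (\<zeta> t)))
        = (s - t) * (2 * ip (f s) (weighted p (\<zeta> t)) + (s - t) * ip (f s) (weighted p (f s)))"
      by (simp add: algebra_simps)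
    moreover have "ip (f s) (weighted p (\<zeta> t)) = ip \<phi> (weighted p (\<zeta> t)) + ip (r s) (weighted p (\<zeta> t))"
      unfolding f_def[abs_def] using s t by (intro ip_add_left) (auto simp: \<phi> rL L2 L2_weighted)
    ultimately show ?thesis using s by simp
  qed
  have wb: "L2_norm (weighted p g) \<le> P * L2_norm g" if "g \<in> L2" for g :: "real \<Rightarrow> real^'n"
    using that P0 by (intro L2_norm_dominated L2_weighted) (auto intro: weighted_dominated[OF P])
  have lim1: "((\<lambda>s. ip (r s) (weighted p (\<zeta> t))) \<longlongrightarrow> 0) (at t within {0..})"
  proof (rule tendsto_0_le[OF rlim, where K = "L2_norm (weighted p (\<zeta> t))"])
    show "\<forall>\<^sub>F s in at t within {0..}. norm (ip (r s) (weighted p (\<zeta> t)))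
        \<le> norm (L2_norm (r s)) * L2_norm (weighted p (\<zeta> t))"
      using ev
    proof eventually_elim
      case (elim s)
      then show ?case
        using ip_Cauchy_Schwarz[OF rL[of s] L2_weighted[OF L2[OF t], of p]] by (simp add: L2_norm_nonneg)
    qed
  qed
  have lim2: "((\<lambda>s. (s - t) * ip (f s) (weighted p (f s))) \<longlongrightarrow> 0) (at t within {0..})"
  proof (rule Lim_null_comparison)
    show "\<forall>\<^sub>F s in at t within {0..}. norm ((s - t) * ip (f s) (weighted p (f s)))
       \<le> \<bar>s - t\<bar> * (P * (L2_norm \<phi> + L2_norm (r s))\<^sup>2)"
      using ev
    proof eventually_elim
      case (elim s)
      have tri: "L2_norm (f s) \<le> L2_norm \<phi> + L2_norm (r s)"
        unfolding f_def[abs_def] using elim by (intro L2_norm_triangle \<phi> rL) auto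
      have "\<bar>ip (f s) (weighted p (f s))\<bar> \<le> L2_norm (f s) * (P * L2_norm (f s))"
        using elim fL by (intro order_trans[OF ip_Cauchy_Schwarz] mult_left_mono wb L2_weighted)
          (auto simp: L2_norm_nonneg)
      also have "\<dots> = P * (L2_norm (f s))\<^sup>2" by (simp add: power2_eq_square)
      also have "\<dots> \<le> P * (L2_norm \<phi> + L2_norm (r s))\<^sup>2"
        using tri P0 by (intro mult_left_mono power_mono) (auto simp: L2_norm_nonneg)
      finally show ?case by (simp add: abs_mult mult_left_mono)
    qed
    have "((\<lambda>s. \<bar>s - t\<bar> * (P * (L2_norm \<phi> + L2_norm (r s))\<^sup>2))
        \<longlongrightarrow> \<bar>t - t\<bar> * (P * (L2_norm \<phi> + 0)\<^sup>2)) (at t within {0..})"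
      by (intro tendsto_intros rlim)
    then show "((\<lambda>s. \<bar>s - t\<bar> * (P * (L2_norm \<phi> + L2_norm (r s))\<^sup>2)) \<longlongrightarrow> 0) (at t within {0..})" by simp
  qed
  have "((\<lambda>s. 2 * ip \<phi> (weighted p (\<zeta> t)) + 2 * ip (r s) (weighted p (\<zeta> t))
         + (s - t) * ip (f s) (weighted p (f s)))
      \<longlongrightarrow> 2 * ip \<phi> (weighted p (\<zeta> t)) + 2 * 0 + 0) (at t within {0..})"
    by (intro tendsto_intros lim1 lim2)
  moreover have "\<forall>\<^sub>F s in at t within {0..}.
      (ip (\<zeta> s) (weighted p (\<zeta> s)) - ip (\<zeta> t) (weighted p (\<zeta> t))) / (s - t)
      = 2 * ip \<phi> (weighted p (\<zeta> t)) + 2 * ip (r s) (weighted p (\<zeta> t)) + (s - t) * ip (f s) (weighted p (f s))"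
    using ev by eventually_elim (rule quot)
  ultimately show ?thesis
    unfolding has_field_derivative_iff by (simp add: tendsto_cong)
qed

lemma L2_component_integrable:
  fixes f :: "real \<Rightarrow> real^'n"
  assumes "f \<in> L2" shows "integrable unit_measure (\<lambda>z. f z $ i)"
proof -
  have "(\<lambda>z::real. axis i 1 :: real^'n) \<in> L2" by (rule L2_continuous) simp
  from L2_inner_integrable[OF assms this] show ?thesis by (simp add: inner_axis)
qed

lemma has_integral_component:
  fixes f :: "real \<Rightarrow> real^'n"
  assumes "(f has_integral I) S" shows "((\<lambda>x. f x $ i) has_integral I $ i) S"
  using has_integral_linear[OF assms bounded_linear_vec_nth[of i]] by (simp add: o_def)

lemma is_primitive_component:
  fixes \<zeta> \<omega> :: "real \<Rightarrow> real^'n"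
  assumes "\<omega> \<in> L2" "\<And>z. z \<in> {0..1} \<Longrightarrow> (\<omega> has_integral (\<zeta> z - \<zeta> 0)) {0..z}"
  shows "is_primitive 0 1 (\<lambda>z. \<zeta> z $ i) (\<lambda>z. \<omega> z $ i)"
  unfolding is_primitive_def
  using L2_component_integrable[OF assms(1)] has_integral_component[OF assms(2)] by auto

lemma L2_primitive:
  fixes \<zeta> \<omega> :: "real \<Rightarrow> real^'n"
  assumes "\<omega> \<in> L2" "\<And>z. z \<in> {0..1} \<Longrightarrow> (\<omega> has_integral (\<zeta> z - \<zeta> 0)) {0..z}"
  shows "\<zeta> \<in> L2"
proof (rule L2_continuous)
  have "continuous_on {0..1} (\<lambda>z. \<chi> i. \<zeta> z $ i)"
    by (intro continuous_on_vec_lambda is_primitive_continuous[OF is_primitive_component[OF assms]])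
  then show "continuous_on {0..1} \<zeta>" by simp
qed

lemma is_primitive_const: "is_primitive a b (\<lambda>_. c) (\<lambda>_. 0)"
  by (auto simp: is_primitive_def)

lemma is_primitive_lebesgue_integral:
  assumes "is_primitive a b F f" "a \<le> b"
  shows "integral\<^sup>L (lebesgue_on {a..b}) f = F b - F a"
proof -
  have "(f has_integral (F b - F a)) {a..b}" using assms by (auto simp: is_primitive_def)
  moreover have "(f has_integral (integral\<^sup>L (lebesgue_on {a..b}) f)) {a..b}"
    using assms by (intro has_integral_lebesgue_on) (auto simp: is_primitive_def)
  ultimately show ?thesis by (rule has_integral_unique[symmetric])
qed

text \<open>Integrate over [0, 1] the z-derivative of e^(-z) \<zeta>_i^2 multiplied by
  \<open>p i * \<Lambda> $ i $ i\<close>: the end points give the boundary flux, and differentiating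
  the exponential gives the negative interior term, which is the source of the decay of
  \<xi>.\<close>

lemma transport_dissipation:
  fixes \<zeta> \<omega> :: "real \<Rightarrow> real^'n"
  assumes \<Lambda>: "diagonal_mx \<Lambda>" and \<omega>: "\<omega> \<in> L2"
    and prim: "\<And>z. z \<in> {0..1} \<Longrightarrow> (\<omega> has_integral (\<zeta> z - \<zeta> 0)) {0..z}"
  shows "2 * ip (\<lambda>z. - (\<Lambda> *v \<omega> z)) (weighted p \<zeta>) =
     (\<Sum>i\<in>UNIV. p i * \<Lambda> $ i $ i * ((\<zeta> 0 $ i)\<^sup>2 - exp (- 1) * (\<zeta> 1 $ i)\<^sup>2))
     - ip \<zeta> (weighted (\<lambda>i. p i * \<Lambda> $ i $ i) \<zeta>)"
proof -
  let ?l = "\<lambda>i. p i * \<Lambda> $ i $ i"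
  let ?f = "\<lambda>z. \<Sum>i\<in>UNIV. ?l i * (- exp (- z) * (\<zeta> z $ i * \<zeta> z $ i)
      + exp (- z) * (\<omega> z $ i * \<zeta> z $ i + \<zeta> z $ i * \<omega> z $ i))"
  have pe: "is_primitive 0 1 (\<lambda>z. exp (- z)) (\<lambda>z. - exp (- z))"
    by (rule is_primitive_of_derivative) (auto intro!: derivative_eq_intros continuous_intros)
  have pi: "is_primitive 0 1 (\<lambda>z. ?l i * (exp (- z) * (\<zeta> z $ i * \<zeta> z $ i)))
     (\<lambda>z. ?l i * (- exp (- z) * (\<zeta> z $ i * \<zeta> z $ i)
      + exp (- z) * (\<omega> z $ i * \<zeta> z $ i + \<zeta> z $ i * \<omega> z $ i)))" for i
  proof -
    note pc = is_primitive_component[OF \<omega> prim, of i]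
    from is_primitive_mult[OF is_primitive_const[of 0 1 "?l i"] is_primitive_mult[OF pe is_primitive_mult[OF pc pc]]]
    show ?thesis by simp
  qed
  have "integral\<^sup>L unit_measure ?f = (\<Sum>i\<in>UNIV. ?l i * (exp (- 1) * (\<zeta> 1 $ i * \<zeta> 1 $ i)))
      - (\<Sum>i\<in>UNIV. ?l i * (exp (- 0) * (\<zeta> 0 $ i * \<zeta> 0 $ i)))"
    by (rule is_primitive_lebesgue_integral[OF is_primitive_sum]) (use pi in auto)
  moreover have "integral\<^sup>L unit_measure ?f =
      integral\<^sup>L unit_measure (\<lambda>z. - (2 * ((- (\<Lambda> *v \<omega> z)) \<bullet> weighted p \<zeta> z) + \<zeta> z \<bullet> weighted ?l \<zeta> z))"
  proof (intro Bochner_Integration.integral_cong refl)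
    fix z
    have 1: "(- (\<Lambda> *v \<omega> z)) \<bullet> weighted p \<zeta> z
        = (\<Sum>i\<in>UNIV. - (\<Lambda> $ i $ i * \<omega> z $ i) * (exp (- z) * (p i * \<zeta> z $ i)))"
      by (simp add: diagonal_mx_vector_mult[OF \<Lambda>] weighted_def inner_vec_def)
    have 2: "\<zeta> z \<bullet> weighted ?l \<zeta> z = (\<Sum>i\<in>UNIV. \<zeta> z $ i * (exp (- z) * (?l i * \<zeta> z $ i)))"
      by (simp add: weighted_def inner_vec_def)
    show "?f z = - (2 * ((- (\<Lambda> *v \<omega> z)) \<bullet> weighted p \<zeta> z) + \<zeta> z \<bullet> weighted ?l \<zeta> z)"
      unfolding 1 2 sum_distrib_left sum.distrib[symmetric] sum_negf[symmetric]
      by (intro sum.cong refl) (simp add: algebra_simps)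
  qed
  moreover have "\<dots> = - (2 * ip (\<lambda>z. - (\<Lambda> *v \<omega> z)) (weighted p \<zeta>) + ip \<zeta> (weighted ?l \<zeta>))"
    using L2_inner_integrable[OF L2_minus[OF L2_matrix[OF \<omega>, of \<Lambda>]] L2_weighted[OF L2_primitive[OF \<omega> prim], of p]]
      L2_inner_integrable[OF L2_primitive[OF \<omega> prim] L2_weighted[OF L2_primitive[OF \<omega> prim], of ?l]]
    unfolding ip_def by simp
  ultimately show ?thesis
    by (simp add: right_diff_distrib sum_subtractf power2_eq_square)
qed


section \<open>Gronwall estimate for the Lyapunov functional\<close>

lemma nonincreasing_if_derivative_nonpos:
  fixes F :: "real \<Rightarrow> real"
  assumes "a \<le> b"
    and der: "\<And>x. x \<in> {a..b} \<Longrightarrow> (F has_real_derivative F' x) (at x within {a..b})"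
    and nonpos: "\<And>x. x \<in> {a..b} \<Longrightarrow> F' x \<le> 0"
  shows "F b \<le> F a"
proof (rule DERIV_nonpos_imp_decreasing_open[OF \<open>a \<le> b\<close>])
  fix x assume x: "a < x" "x < b"
  then have "(F has_real_derivative F' x) (at x)"
    using der[of x] by (simp add: at_within_Icc_at)
  then show "\<exists>y. (F has_real_derivative y) (at x) \<and> y \<le> 0" using nonpos[of x] x by auto
next
  show "continuous_on {a..b} F" using der by (rule DERIV_continuous_on)
qed

text \<open>Gronwall's argument for \<open>exp (c * t) * V t\<close>, with \<open>q\<close> as the
  supply coming from the disturbed part. The density \<open>\<omega>\<close> is abstract instead of
  being \<open>Dz\<close> of \<open>\<zeta>\<close>, so that the same estimate applies to the state
  and to its difference quotients in time.\<close>

lemma lyapunov_growth: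
  fixes \<zeta> \<omega> :: "real \<Rightarrow> real \<Rightarrow> real^'n" and \<eta> \<eta>' :: "real \<Rightarrow> real^'m" and q :: "real \<Rightarrow> real"
    and p :: "'n \<Rightarrow> real" and P3 :: "real^'m^'m"
  defines "V \<equiv> \<lambda>t. ip (\<zeta> t) (weighted p (\<zeta> t)) + \<eta> t \<bullet> (P3 *v \<eta> t)"
  assumes \<Lambda>: "diagonal_mx \<Lambda>" and cl: "\<And>i. c \<le> \<Lambda> $ i $ i" and p: "\<And>i. 0 \<le> p i"
    and P3: "symmetric_mx P3"
    and \<omega>: "\<And>t. 0 \<le> t \<Longrightarrow> \<omega> t \<in> L2"
    and prim: "\<And>t z. 0 \<le> t \<Longrightarrow> z \<in> {0..1} \<Longrightarrow> (\<omega> t has_integral (\<zeta> t z - \<zeta> t 0)) {0..z}"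
    and transport: "\<And>t. 0 \<le> t \<Longrightarrow>
      ((\<lambda>s. L2_norm (\<lambda>z. (1 / (s - t)) *\<^sub>R (\<zeta> s z - \<zeta> t z) - (- (\<Lambda> *v \<omega> t z)))) \<longlongrightarrow> 0) (at t within {0..})"
    and \<eta>: "\<And>t. 0 \<le> t \<Longrightarrow> (\<eta> has_vector_derivative \<eta>' t) (at t within {0..})"
    and q: "continuous_on {0..} q"
    and dissipation: "\<And>t. 0 \<le> t \<Longrightarrow>
      (\<Sum>i\<in>UNIV. p i * \<Lambda> $ i $ i * ((\<zeta> t 0 $ i)\<^sup>2 - exp (- 1) * (\<zeta> t 1 $ i)\<^sup>2)) + 2 * (\<eta> t \<bullet> (P3 *v \<eta>' t))
        \<le> - c * (\<eta> t \<bullet> (P3 *v \<eta> t)) + q t"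
    and T: "0 \<le> T"
  shows "exp (c * T) * V T \<le> V 0 + integral {0..T} (\<lambda>s. exp (c * s) * q s)"
proof -
  have \<zeta>L: "\<zeta> t \<in> L2" if "0 \<le> t" for t by (rule L2_primitive[OF \<omega>[OF that] prim[OF that]])
  define V' where "V' t = 2 * ip (\<lambda>z. - (\<Lambda> *v \<omega> t z)) (weighted p (\<zeta> t)) + 2 * (\<eta> t \<bullet> (P3 *v \<eta>' t))" for t
  have V'le: "V' t \<le> - c * V t + q t" if t: "0 \<le> t" for t
  proof -
    \<comment> \<open>The transport identity carries the weights
      \<open>p i * \<Lambda> $ i $ i\<close>; since \<open>p\<close> is nonnegative,
      \<open>c \<le> \<Lambda> $ i $ i\<close> gives back c times the first summand of
      \<open>V\<close>.\<close>
    have "c * ip (\<zeta> t) (weighted p (\<zeta> t)) \<le> ip (\<zeta> t) (weighted (\<lambda>i. p i * \<Lambda> $ i $ i) (\<zeta> t))"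
      unfolding ip_def integral_mult_right_zero[symmetric]
    proof (rule integral_mono)
      show "integrable unit_measure (\<lambda>z. c * (\<zeta> t z \<bullet> weighted p (\<zeta> t) z))"
        by (intro integrable_mult_right L2_inner_integrable L2_weighted \<zeta>L t)
      show "integrable unit_measure (\<lambda>z. \<zeta> t z \<bullet> weighted (\<lambda>i. p i * \<Lambda> $ i $ i) (\<zeta> t) z)"
        by (intro L2_inner_integrable L2_weighted \<zeta>L t)
      fix z
      have "c * (p i * (exp (- z) * (\<zeta> t z $ i)\<^sup>2)) \<le> \<Lambda> $ i $ i * (p i * (exp (- z) * (\<zeta> t z $ i)\<^sup>2))" for i
        by (intro mult_right_mono cl mult_nonneg_nonneg p) auto
      then show "c * (\<zeta> t z \<bullet> weighted p (\<zeta> t) z) \<le> \<zeta> t z \<bullet> weighted (\<lambda>i. p i * \<Lambda> $ i $ i) (\<zeta> t) z"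
        unfolding weighted_def inner_vec_def sum_distrib_left
        by (intro sum_mono) (simp add: power2_eq_square mult_ac)
    qed
    then show ?thesis
      using dissipation[OF t] transport_dissipation[OF \<Lambda> \<omega>[OF t] prim[OF t], where p = p]
      by (simp add: V'_def V_def distrib_left)
  qed
  have der: "(V has_real_derivative V' t) (at t within {0..})" if t: "0 \<le> t" for t
  proof -
    have "((\<lambda>t. ip (\<zeta> t) (weighted p (\<zeta> t))) has_real_derivative
        2 * ip (\<lambda>z. - (\<Lambda> *v \<omega> t z)) (weighted p (\<zeta> t))) (at t within {0..})"
      by (rule L2_quadratic_has_derivative[OF \<zeta>L L2_minus[OF L2_matrix[OF \<omega>[OF t]]] t transport[OF t]])
    moreover have "((\<lambda>t. \<eta> t \<bullet> (P3 *v \<eta> t)) has_real_derivative 2 * (\<eta> t \<bullet> (P3 *v \<eta>' t))) (at t within {0..})"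
    proof -
      have "((\<lambda>t. P3 *v \<eta> t) has_vector_derivative (P3 *v \<eta>' t)) (at t within {0..})"
        by (rule bounded_linear.has_vector_derivative[OF _ \<eta>[OF t]]) simp
      from bounded_bilinear.has_vector_derivative[OF bounded_bilinear_inner \<eta>[OF t] this]
      show ?thesis
        using symmetric_mx_inner[OF P3, of "\<eta> t" "\<eta>' t"]
        by (simp add: has_real_derivative_iff_has_vector_derivative inner_commute)
    qed
    ultimately show ?thesis unfolding V_def V'_def by (rule DERIV_add)
  qed
  let ?g = "\<lambda>s. exp (c * s) * q s"
  have gc: "continuous_on {0..T} ?g"
    by (intro continuous_intros continuous_on_subset[OF q]) auto
  have "exp (c * T) * V T - integral {0..T} ?g \<le> exp (c * 0) * V 0 - integral {0..0} ?g"
  proof (rule nonincreasing_if_derivative_nonpos[OF T,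
        where F = "\<lambda>t. exp (c * t) * V t - integral {0..t} ?g"])
    fix t assume t: "t \<in> {0..T}"
    have V: "(V has_real_derivative V' t) (at t within {0..T})"
      by (rule DERIV_subset[OF der]) (use t in auto)
    have I: "((\<lambda>t. integral {0..t} ?g) has_real_derivative ?g t) (at t within {0..T})"
      by (rule integral_has_real_derivative[OF gc t])
    have E: "((\<lambda>t. exp (c * t)) has_real_derivative exp (c * t) * c) (at t within {0..T})"
      by (auto intro!: derivative_eq_intros)
    show "((\<lambda>t. exp (c * t) * V t - integral {0..t} ?g) has_real_derivative
         exp (c * t) * c * V t + V' t * exp (c * t) - ?g t) (at t within {0..T})"
      by (intro DERIV_diff DERIV_mult V I E)
    have "exp (c * t) * c * V t + V' t * exp (c * t) - ?g t = exp (c * t) * (V' t - (- c * V t + q t))"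
      by (simp add: algebra_simps)
    also have "\<dots> \<le> 0" using V'le[of t] t by (intro mult_nonneg_nonpos) auto
    finally show "exp (c * t) * c * V t + V' t * exp (c * t) - ?g t \<le> 0" .
  qed
  then show ?thesis by simp
qed

section \<open>Energy of the disturbed subsystem\<close>

definition weighted_energy :: "real \<Rightarrow> (real \<Rightarrow> real^'n) \<Rightarrow> real \<Rightarrow> real" where
  "weighted_energy c f T = integral {0..T} (\<lambda>s. exp (c * s) * (f s \<bullet> f s))"

text \<open>Measurability is given on the open half line; the single value \<open>w 0\<close> is
  added back through an indicator.\<close>

lemma disturbance_measurable:
  assumes "w \<in> disturbances" shows "w \<in> borel_measurable (lebesgue_on {0..T})"
proof -
  have "(\<lambda>x. if x \<in> {0<..} then w x else 0) \<in> borel_measurable lebesgue"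
    using assms by (intro borel_measurable_if_I) (auto simp: disturbances_def)
  then have "(\<lambda>x. (if x \<in> {0<..} then w x else 0) + indicator {0} x *\<^sub>R w 0) \<in> borel_measurable lebesgue"
    by (intro borel_measurable_add borel_measurable_scaleR borel_measurable_indicator) auto
  then have "(\<lambda>x. (if x \<in> {0<..} then w x else 0) + indicator {0} x *\<^sub>R w 0) \<in> borel_measurable (lebesgue_on {0..T})"
    by (rule measurable_restrict_space1)
  then show ?thesis
    by (rule measurable_cong[THEN iffD1, rotated]) auto
qed

lemma bounded_energy_integrable:
  fixes f :: "real \<Rightarrow> real^'n"
  assumes "f \<in> borel_measurable (lebesgue_on {0..T})" "\<And>s. s \<in> {0..T} \<Longrightarrow> f s \<bullet> f s \<le> B"
  shows "integrable (lebesgue_on {0..T}) (\<lambda>s. exp (c * s) * (f s \<bullet> f s))"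
proof -
  have "integrable (lebesgue_on {0..T}) (\<lambda>s. f s \<bullet> f s)"
  proof (rule finite_measure.integrable_const_bound)
    show "finite_measure (lebesgue_on {0..T})" by (rule finite_measure_lebesgue_on) simp
    show "AE s in lebesgue_on {0..T}. norm (f s \<bullet> f s) \<le> B" using assms(2) by (intro AE_I2) simp
    show "(\<lambda>s. f s \<bullet> f s) \<in> borel_measurable (lebesgue_on {0..T})" using assms(1) by measurable
  qed
  from integrable_lebesgue_on_mult_continuous[OF this, of "\<lambda>s. exp (c * s)"]
  show ?thesis by (simp add: continuous_intros mult.commute)
qed

lemma continuous_energy_integrable:
  fixes f :: "real \<Rightarrow> real^'n"
  assumes "continuous_on {0..T} f"
  shows "integrable (lebesgue_on {0..T}) (\<lambda>s. exp (c * s) * (f s \<bullet> f s))"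
proof -
  have "continuous_on {0..T} (\<lambda>s. exp (c * s) * (f s \<bullet> f s))"
    using assms by (intro continuous_intros)
  from absolutely_integrable_continuous_real[OF this] show ?thesis
    by (simp add: set_integrable_def integrable_restrict_space)
qed

lemma disturbance_energy_integrable:
  "w \<in> disturbances \<Longrightarrow> integrable (lebesgue_on {0..T}) (\<lambda>s. exp (c * s) * (w s \<bullet> w s))"
  by (rule bounded_energy_integrable[OF disturbance_measurable, where B = 1])
     (auto simp: disturbances_def)

lemma integrable_on_lebesgue_on_interval:
  fixes f :: "real \<Rightarrow> 'a::euclidean_space"
  shows "integrable (lebesgue_on {a..b}) f \<Longrightarrow> f integrable_on {a..b}"
  by (rule integrable_on_if_lebesgue_on(2)[of a b]) auto

lemma continuous_on_nonneg_if_intervals: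
  fixes f :: "real \<Rightarrow> 'a::topological_space"
  assumes "\<And>T. 0 \<le> T \<Longrightarrow> continuous_on {0..T} f" shows "continuous_on {0..} f"
  unfolding continuous_on_eq_continuous_within
proof
  fix t :: real assume t: "t \<in> {0..}"
  have "continuous (at t within {0..t + 1}) f"
    using assms[of "t + 1"] t by (auto simp: continuous_on_eq_continuous_within)
  moreover have "at t within {0..} = at t within {0..t + 1}"
    by (rule at_within_nhd[of t "{..<t + 1}"]) auto
  ultimately show "continuous (at t within {0..}) f" by simp
qed

section \<open>The equation of \<open>v\<close> with a merely measurable input\<close>

lemma integral_solution_continuous:
  fixes v :: "real \<Rightarrow> real^'n"
  assumes "\<And>t. 0 \<le> t \<Longrightarrow> (g has_integral (v t - v 0)) {0..t}"
  shows "continuous_on {0..} v"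
proof (rule continuous_on_nonneg_if_intervals)
  fix T :: real assume "0 \<le> T"
  have "continuous_on {0..T} (\<lambda>t. v 0 + integral {0..t} g)"
    using assms[OF \<open>0 \<le> T\<close>] by (intro continuous_intros indefinite_integral_continuous_1) blast
  moreover have "v 0 + integral {0..t} g = v t" if "t \<in> {0..T}" for t
    using integral_unique[OF assms, of t] that by simp
  ultimately show "continuous_on {0..T} v" by (rule continuous_on_eq)
qed

lemma disturbed_rhs_measurable:
  fixes v w :: "real \<Rightarrow> real^'n"
  assumes "w \<in> disturbances" "continuous_on {0..} v"
  shows "(\<lambda>s. M *v v s + Bw *v w s) \<in> borel_measurable (lebesgue_on {0..T})"
proof -
  have "v \<in> borel_measurable (lebesgue_on {0..T})"
    by (rule continuous_imp_measurable_on_sets_lebesgue)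
       (auto intro: continuous_on_subset[OF assms(2)])
  then show ?thesis
    using disturbance_measurable[OF assms(1)]
    by (intro borel_measurable_add borel_measurable_bounded_linear[of "\<lambda>x. M *v x"]
        borel_measurable_bounded_linear[of "\<lambda>x. Bw *v x"]) auto
qed

lemma disturbed_rhs_bound:
  fixes x y :: "real^'n"
  shows "(M *v x + Bw *v y) \<bullet> (M *v x + Bw *v y)
     \<le> 2 * (onorm ((*v) M))\<^sup>2 * (x \<bullet> x) + 2 * (onorm ((*v) Bw))\<^sup>2 * (y \<bullet> y)"
proof -
  have "norm (M *v x) \<le> onorm ((*v) M) * norm x" "norm (Bw *v y) \<le> onorm ((*v) Bw) * norm y"
    by (auto intro!: onorm)
  then have 1: "(norm (M *v x))\<^sup>2 \<le> (onorm ((*v) M))\<^sup>2 * (x \<bullet> x)"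
    "(norm (Bw *v y))\<^sup>2 \<le> (onorm ((*v) Bw))\<^sup>2 * (y \<bullet> y)"
    by (auto simp: power_mult_distrib[symmetric] dot_square_norm intro!: power_mono)
  have "(norm (M *v x + Bw *v y))\<^sup>2 \<le> (norm (M *v x) + norm (Bw *v y))\<^sup>2"
    by (intro power_mono norm_triangle_ineq) auto
  also have "\<dots> \<le> 2 * (norm (M *v x))\<^sup>2 + 2 * (norm (Bw *v y))\<^sup>2"
    using sum_squares_bound[of "norm (M *v x)" "norm (Bw *v y)"] by (simp add: power2_sum)
  finally show ?thesis using 1 by (simp add: dot_square_norm)
qed

lemma disturbed_rhs_energy_integrable:
  fixes v w :: "real \<Rightarrow> real^'n"
  assumes w: "w \<in> disturbances" and v: "continuous_on {0..} v"
  shows "integrable (lebesgue_on {0..T}) (\<lambda>s. exp (c * s) * ((M *v v s + Bw *v w s) \<bullet> (M *v v s + Bw *v w s)))"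
proof -
  have vc: "continuous_on {0..T} v" by (rule continuous_on_subset[OF v]) auto
  have "compact ((\<lambda>s. v s \<bullet> v s) ` {0..T})"
    by (intro compact_continuous_image continuous_intros vc compact_Icc)
  then obtain b where b: "\<And>s. s \<in> {0..T} \<Longrightarrow> norm (v s \<bullet> v s) \<le> b"
    by (meson bounded_iff compact_imp_bounded image_eqI)
  show ?thesis
  proof (rule bounded_energy_integrable[OF disturbed_rhs_measurable[OF w v]])
    fix s assume s: "s \<in> {0..T}"
    have "w s \<bullet> w s \<le> 1" using w s by (auto simp: disturbances_def)
    moreover have "v s \<bullet> v s \<le> b" using b[OF s] by simp
    ultimately show "(M *v v s + Bw *v w s) \<bullet> (M *v v s + Bw *v w s)
        \<le> 2 * (onorm ((*v) M))\<^sup>2 * b + 2 * (onorm ((*v) Bw))\<^sup>2 * 1"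
      by (intro order_trans[OF disturbed_rhs_bound] add_mono mult_left_mono) auto
  qed
qed

text \<open>Young's inequality splits the cross term \<open>2 v b w\<close>.\<close>

lemma disturbed_energy_bound:
  fixes v w :: "real \<Rightarrow> real^'n"
  assumes M: "diagonal_mx M" and Bw: "diagonal_mx Bw" and \<mu>: "0 < \<mu>" "\<And>i. M $ i $ i \<le> - \<mu>" and c: "c \<le> \<mu>"
    and K: "\<And>i. 2 * (Bw $ i $ i)\<^sup>2 / \<mu> \<le> K"
    and w: "w \<in> disturbances"
    and v: "\<And>t. 0 \<le> t \<Longrightarrow> ((\<lambda>s. M *v v s + Bw *v w s) has_integral (v t - v 0)) {0..t}"
    and T: "0 \<le> T"
  shows "exp (c * T) * (v T \<bullet> v T) + \<mu> / 2 * weighted_energy c v T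
     \<le> v 0 \<bullet> v 0 + K * weighted_energy c w T"
proof -
  have vc: "continuous_on {0..T} v"
    by (rule continuous_on_subset[OF integral_solution_continuous[OF v]]) auto
  let ?m = "\<lambda>i. M $ i $ i" and ?b = "\<lambda>i. Bw $ i $ i"
  \<comment> \<open>\<open>M\<close> and \<open>Bw\<close> are diagonal, so every component of
    \<open>v\<close> solves a scalar equation whose right-hand side is merely integrable.\<close>
  have comp: "is_primitive 0 T (\<lambda>s. v s $ i) (\<lambda>s. ?m i * v s $ i + ?b i * w s $ i)" for i
    unfolding is_primitive_def
  proof
    have w1: "integrable (lebesgue_on {0..T}) (\<lambda>s. w s $ i)"
    proof (rule finite_measure.integrable_const_bound)
      show "finite_measure (lebesgue_on {0..T})" by (rule finite_measure_lebesgue_on) simp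
      have "norm (w s $ i) \<le> 1" if "s \<in> {0..T}" for s
      proof -
        have "(norm (w s))\<^sup>2 \<le> 1" using w that by (auto simp: disturbances_def dot_square_norm)
        then have "norm (w s) \<le> 1" by (simp add: power2_le_iff_abs_le abs_square_le_1)
        then show ?thesis using component_le_norm_cart[of "w s" i] by simp
      qed
      then show "AE s in lebesgue_on {0..T}. norm (w s $ i) \<le> 1" by (intro AE_I2) simp
      show "(\<lambda>s. w s $ i) \<in> borel_measurable (lebesgue_on {0..T})"
        by (rule borel_measurable_bounded_linear[OF bounded_linear_vec_nth disturbance_measurable[OF w]])
    qed
    have v1: "integrable (lebesgue_on {0..T}) (\<lambda>s. v s $ i)"
      using absolutely_integrable_continuous_real[of 0 T "\<lambda>s. v s $ i"] vc
      by (simp add: set_integrable_def integrable_restrict_space continuous_intros)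
    show "integrable (lebesgue_on {0..T}) (\<lambda>s. ?m i * v s $ i + ?b i * w s $ i)"
      using v1 w1 by simp
    show "\<forall>x\<in>{0..T}. ((\<lambda>s. ?m i * v s $ i + ?b i * w s $ i) has_integral v x $ i - v 0 $ i) {0..x}"
      using has_integral_component[OF v, of _ i]
      by (simp add: diagonal_mx_vector_mult[OF M] diagonal_mx_vector_mult[OF Bw])
  qed
  have pe: "is_primitive 0 T (\<lambda>s. exp (c * s)) (\<lambda>s. c * exp (c * s))"
    by (rule is_primitive_of_derivative) (auto intro!: derivative_eq_intros continuous_intros)
  let ?d = "\<lambda>i s. ?m i * v s $ i + ?b i * w s $ i"
  have ps: "is_primitive 0 T (\<lambda>s. \<Sum>i\<in>UNIV. exp (c * s) * (v s $ i * v s $ i))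
     (\<lambda>s. \<Sum>i\<in>UNIV. c * exp (c * s) * (v s $ i * v s $ i) + exp (c * s) * (?d i s * v s $ i + v s $ i * ?d i s))"
    by (intro is_primitive_sum is_primitive_mult pe comp) auto
  let ?f = "\<lambda>s. \<Sum>i\<in>UNIV. c * exp (c * s) * (v s $ i * v s $ i) + exp (c * s) * (?d i s * v s $ i + v s $ i * ?d i s)"
  have vi: "(\<lambda>s. exp (c * s) * (v s \<bullet> v s)) integrable_on {0..T}"
    by (rule integrable_on_lebesgue_on_interval[OF continuous_energy_integrable[OF vc]])
  have wi: "(\<lambda>s. exp (c * s) * (w s \<bullet> w s)) integrable_on {0..T}"
    by (rule integrable_on_lebesgue_on_interval[OF disturbance_energy_integrable[OF w]])
  let ?g = "\<lambda>s. - (\<mu> / 2) * (exp (c * s) * (v s \<bullet> v s)) + K * (exp (c * s) * (w s \<bullet> w s))"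
  have fI: "(?f has_integral ((\<Sum>i\<in>UNIV. exp (c * T) * (v T $ i * v T $ i))
      - (\<Sum>i\<in>UNIV. exp (c * 0) * (v 0 $ i * v 0 $ i)))) {0..T}"
    using ps T unfolding is_primitive_def by auto
  have gI: "(?g has_integral (- (\<mu> / 2) * weighted_energy c v T + K * weighted_energy c w T)) {0..T}"
    unfolding weighted_energy_def
    by (intro has_integral_add has_integral_mult_right integrable_integral vi wi)
  have "?f s \<le> ?g s" for s
  proof -
    \<comment> \<open>Of the decay - 2 \<mu> coming from \<open>M\<close>, the exponential weight
      costs c \<le> \<mu> and Young's inequality costs \<mu> / 2; what remains is - \<mu> / 2. The
      square below is scaled so that y^2 receives the coefficient 2 b^2 / \<mu>, which
      \<open>K\<close> bounds.\<close>
    have e: "c * (x * x) + ((?m i * x + ?b i * y) * x + x * (?m i * x + ?b i * y))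
       \<le> - (\<mu> / 2) * (x * x) + K * (y * y)" for i x y
    proof -
      have "0 \<le> (\<mu> / 2 * x - ?b i * y)\<^sup>2 * (2 / \<mu>)" using \<mu>(1) by simp
      also have "\<dots> = \<mu> / 2 * (x * x) - 2 * ?b i * x * y + (2 * (?b i)\<^sup>2 / \<mu>) * (y * y)"
        using \<mu>(1) by (simp add: power2_eq_square field_simps)
      also have "\<dots> \<le> \<mu> / 2 * (x * x) - 2 * ?b i * x * y + K * (y * y)"
        using K[of i] by (intro add_mono mult_right_mono) auto
      finally have 1: "2 * ?b i * x * y \<le> \<mu> / 2 * (x * x) + K * (y * y)" by simp
      have 2: "c * (x * x) \<le> \<mu> * (x * x)" "?m i * (x * x) \<le> - \<mu> * (x * x)"
        by (intro mult_right_mono c \<mu>(2); simp)+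
      have "c * (x * x) + ((?m i * x + ?b i * y) * x + x * (?m i * x + ?b i * y))
        = c * (x * x) + 2 * (?m i * (x * x)) + 2 * ?b i * x * y" by (simp add: algebra_simps)
      then show ?thesis using 1 2 by (simp add: algebra_simps)
    qed
    have "?f s = (\<Sum>i\<in>UNIV. exp (c * s) * (c * (v s $ i * v s $ i) + (?d i s * v s $ i + v s $ i * ?d i s)))"
      by (intro sum.cong refl) (simp add: distrib_left mult_ac)
    also have "\<dots> \<le> (\<Sum>i\<in>UNIV. exp (c * s) * (- (\<mu> / 2) * (v s $ i * v s $ i) + K * (w s $ i * w s $ i)))"
      by (intro sum_mono mult_left_mono e) auto
    also have "\<dots> = ?g s"
      by (simp add: inner_vec_def sum_distrib_left sum.distrib[symmetric] distrib_left mult_ac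
          sum_negf[symmetric] sum_subtractf[symmetric] right_diff_distrib)
    finally show ?thesis .
  qed
  then have "(\<Sum>i\<in>UNIV. exp (c * T) * (v T $ i * v T $ i)) - (\<Sum>i\<in>UNIV. exp (c * 0) * (v 0 $ i * v 0 $ i))
     \<le> - (\<mu> / 2) * weighted_energy c v T + K * weighted_energy c w T"
    using has_integral_le[OF fI gI] by blast
  then show ?thesis by (simp add: inner_vec_def sum_distrib_left[symmetric])
qed

section \<open>Energy of difference quotients in time\<close>

text \<open>Expand the nonnegative integral of |g - m|^2, where m is the mean value of
  \<open>g\<close> on [a, b].\<close>

lemma has_integral_norm_square_le:
  fixes g :: "real \<Rightarrow> real^'n"
  assumes g: "(g has_integral I) {a..b}" and gg: "(\<lambda>s. g s \<bullet> g s) integrable_on {a..b}" and ab: "a < b"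
  shows "I \<bullet> I \<le> (b - a) * integral {a..b} (\<lambda>s. g s \<bullet> g s)"
proof -
  define m where "m = (1 / (b - a)) *\<^sub>R I"
  have "((\<lambda>s. g s \<bullet> g s - 2 * (g s \<bullet> m) + m \<bullet> m) has_integral
      (integral {a..b} (\<lambda>s. g s \<bullet> g s) - 2 * (I \<bullet> m) + (b - a) * (m \<bullet> m))) {a..b}"
    using has_integral_linear[OF g bounded_linear_inner_left[of m]] ab
      has_integral_const_real[of "m \<bullet> m" a b]
    by (intro has_integral_add has_integral_diff has_integral_mult_right integrable_integral gg)
       (simp_all add: o_def)
  moreover have "0 \<le> g s \<bullet> g s - 2 * (g s \<bullet> m) + m \<bullet> m" for s
    using inner_ge_zero[of "g s - m"] by (simp add: inner_diff_left inner_diff_right inner_commute)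
  ultimately have "0 \<le> integral {a..b} (\<lambda>s. g s \<bullet> g s) - 2 * (I \<bullet> m) + (b - a) * (m \<bullet> m)"
    using has_integral_nonneg by blast
  moreover have "I \<bullet> m = (I \<bullet> I) / (b - a)" "(b - a) * (m \<bullet> m) = (I \<bullet> I) / (b - a)"
    using ab by (simp_all add: m_def)
  ultimately have "(I \<bullet> I) / (b - a) \<le> integral {a..b} (\<lambda>s. g s \<bullet> g s)" by simp
  then show ?thesis using ab by (simp add: pos_divide_le_eq mult.commute)
qed

text \<open>By Jensen's inequality the weighted square of the difference quotient is at most the
  difference quotient of \<open>\<Phi> = weighted_energy c g\<close>, which telescopes under the integral.\<close>

lemma difference_quotient_energy_bound:
  fixes v g :: "real \<Rightarrow> real^'n"
  assumes v: "\<And>t. 0 \<le> t \<Longrightarrow> (g has_integral (v t - v 0)) {0..t}"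
    and gg: "\<And>T. integrable (lebesgue_on {0..T}) (\<lambda>s. exp (c * s) * (g s \<bullet> g s))"
    and gg1: "\<And>T. integrable (lebesgue_on {0..T}) (\<lambda>s. g s \<bullet> g s)"
    and c: "0 \<le> c" and h: "0 < h" and T: "0 \<le> T"
  shows "weighted_energy c (\<lambda>s. (1 / h) *\<^sub>R (v (s + h) - v s)) T \<le> weighted_energy c g (T + h)"
proof -
  let ?\<Phi> = "weighted_energy c g"
  let ?G = "\<lambda>s. exp (c * s) * (g s \<bullet> g s)"
  have GI: "?G integrable_on {a..b}" if "0 \<le> a" for a b
    using integrable_on_if_lebesgue_on(2)[OF gg, of a b b] that by simp
  have inc: "?\<Phi> b - ?\<Phi> a = integral {a..b} ?G" if "0 \<le> a" "a \<le> b" for a b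
    using Henstock_Kurzweil_Integration.integral_combine[of 0 a b ?G] that GI[of 0 b]
    by (simp add: weighted_energy_def)
  have mono: "?\<Phi> a \<le> ?\<Phi> b" if "0 \<le> a" "a \<le> b" for a b
    using inc[OF that] Henstock_Kurzweil_Integration.integral_nonneg[OF GI[OF that(1)], of b] by simp
  have \<Phi>0: "?\<Phi> 0 = 0" by (simp add: weighted_energy_def)
  have \<Phi>c: "continuous_on {0..b} ?\<Phi>" for b
    unfolding weighted_energy_def[abs_def] by (intro indefinite_integral_continuous_1 GI) simp
  have \<Phi>I: "?\<Phi> integrable_on {a..b}" if "0 \<le> a" for a b
    by (rule integrable_continuous_real[OF continuous_on_subset[OF \<Phi>c[of b]]]) (use that in auto)
  have vc: "continuous_on {0..} v" by (rule integral_solution_continuous[OF v])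
  have le: "exp (c * s) * ((1 / h) *\<^sub>R (v (s + h) - v s) \<bullet> (1 / h) *\<^sub>R (v (s + h) - v s))
      \<le> (1 / h) * (?\<Phi> (s + h) - ?\<Phi> s)" if s: "0 \<le> s" for s
  proof -
    have gI: "g integrable_on {0..s + h}" using v[of "s + h"] s h by auto
    have "integral {0..s} g + integral {s..s + h} g = integral {0..s + h} g"
      by (rule Henstock_Kurzweil_Integration.integral_combine[OF _ _ gI]) (use s h in auto)
    moreover have "integral {0..s} g = v s - v 0" "integral {0..s + h} g = v (s + h) - v 0"
      using v[of s] v[of "s + h"] s h by auto
    moreover have "g integrable_on {s..s + h}"
      by (rule integrable_subinterval_real[OF gI]) (use s in auto)
    ultimately have "(g has_integral (v (s + h) - v s)) {s..s + h}"
      by (metis (no_types, lifting) add_diff_cancel_left' diff_diff_eq2 integrable_integral diff_add_cancel)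
    moreover have ggI: "(\<lambda>s. g s \<bullet> g s) integrable_on {s..s + h}"
      using integrable_on_if_lebesgue_on(2)[OF gg1, of s "s + h" "s + h"] s by simp
    ultimately have J: "(v (s + h) - v s) \<bullet> (v (s + h) - v s) \<le> h * integral {s..s + h} (\<lambda>s. g s \<bullet> g s)"
      using has_integral_norm_square_le[of g _ s "s + h"] h by simp
    have "exp (c * s) * integral {s..s + h} (\<lambda>s. g s \<bullet> g s) = integral {s..s + h} (\<lambda>r. exp (c * s) * (g r \<bullet> g r))"
      by simp
    \<comment> \<open>On [s, s + h] the exponential weight is at least its value at s, because c
      \<ge> 0.\<close>
    also have "\<dots> \<le> integral {s..s + h} ?G"
    proof (rule integral_le)
      show "(\<lambda>r. exp (c * s) * (g r \<bullet> g r)) integrable_on {s..s + h}"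
        using integrable_on_mult_right[OF ggI, of "exp (c * s)"] by simp
      show "?G integrable_on {s..s + h}" by (rule GI[OF s])
      show "exp (c * s) * (g r \<bullet> g r) \<le> ?G r" if "r \<in> {s..s + h}" for r
        using that c by (intro mult_right_mono) (auto intro: mult_left_mono)
    qed
    also have "\<dots> = ?\<Phi> (s + h) - ?\<Phi> s" using inc[of s "s + h"] s h by simp
    finally have E: "exp (c * s) * integral {s..s + h} (\<lambda>s. g s \<bullet> g s) \<le> ?\<Phi> (s + h) - ?\<Phi> s" .
    have "exp (c * s) * ((1 / h) *\<^sub>R (v (s + h) - v s) \<bullet> (1 / h) *\<^sub>R (v (s + h) - v s))
        = (1 / h)\<^sup>2 * (exp (c * s) * ((v (s + h) - v s) \<bullet> (v (s + h) - v s)))"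
      by (simp only: inner_scaleR_left inner_scaleR_right power2_eq_square mult_ac)
    also have "\<dots> \<le> (1 / h)\<^sup>2 * (exp (c * s) * (h * integral {s..s + h} (\<lambda>s. g s \<bullet> g s)))"
      by (intro mult_left_mono J) auto
    also have "\<dots> = (1 / h) * (exp (c * s) * integral {s..s + h} (\<lambda>s. g s \<bullet> g s))"
      using h by (simp add: power2_eq_square)
    also have "\<dots> \<le> (1 / h) * (?\<Phi> (s + h) - ?\<Phi> s)"
      using h by (intro mult_left_mono E) auto
    finally show ?thesis .
  qed
  have sI: "((\<lambda>s. ?\<Phi> (s + h)) has_integral integral {h..T + h} ?\<Phi>) {0..T}"
    using has_integral_shift_real_ivl[OF integrable_integral[OF \<Phi>I[of h "T + h"]], of h] h by simp
  have R: "((\<lambda>s. (1 / h) * (?\<Phi> (s + h) - ?\<Phi> s)) has_integral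
     (1 / h) * (integral {h..T + h} ?\<Phi> - integral {0..T} ?\<Phi>)) {0..T}"
    by (intro has_integral_mult_right has_integral_diff sI integrable_integral \<Phi>I) auto
  have L: "((\<lambda>s. exp (c * s) * ((1 / h) *\<^sub>R (v (s + h) - v s) \<bullet> (1 / h) *\<^sub>R (v (s + h) - v s)))
      has_integral weighted_energy c (\<lambda>s. (1 / h) *\<^sub>R (v (s + h) - v s)) T) {0..T}"
    unfolding weighted_energy_def
    by (intro integrable_integral integrable_continuous_real continuous_intros
        continuous_on_compose2[OF vc] continuous_on_subset[OF vc]) (use h in auto)
  have "weighted_energy c (\<lambda>s. (1 / h) *\<^sub>R (v (s + h) - v s)) T
      \<le> (1 / h) * (integral {h..T + h} ?\<Phi> - integral {0..T} ?\<Phi>)"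
    by (rule has_integral_le[OF L R]) (use le in auto)
  \<comment> \<open>The two integrals differ only in the end strips: the one over [0, h] is
    nonnegative and dropped, and on [T, T + h] the nondecreasing \<Phi> is at most its final
    value.\<close>
  also have "integral {h..T + h} ?\<Phi> - integral {0..T} ?\<Phi> \<le> h * ?\<Phi> (T + h)"
  proof -
    have 1: "integral {0..h} ?\<Phi> + integral {h..T + h} ?\<Phi> = integral {0..T + h} ?\<Phi>"
      by (rule Henstock_Kurzweil_Integration.integral_combine[OF _ _ \<Phi>I]) (use h T in auto)
    have 2: "integral {0..T} ?\<Phi> + integral {T..T + h} ?\<Phi> = integral {0..T + h} ?\<Phi>"
      by (rule Henstock_Kurzweil_Integration.integral_combine[OF _ _ \<Phi>I]) (use h T in auto)
    have 3: "0 \<le> integral {0..h} ?\<Phi>"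
      by (rule Henstock_Kurzweil_Integration.integral_nonneg[OF \<Phi>I]) (use mono[of 0] \<Phi>0 in auto)
    have "integral {T..T + h} ?\<Phi> \<le> integral {T..T + h} (\<lambda>_. ?\<Phi> (T + h))"
      by (rule integral_le[OF \<Phi>I]) (use T mono in auto)
    also have "\<dots> = h * ?\<Phi> (T + h)" using h by simp
    finally show ?thesis using 1 2 3 by simp
  qed
  finally show ?thesis using h by (simp add: divide_right_mono)
qed

section \<open>The design inequality\<close>

text \<open>The maximum over the compact unit sphere is attained and negative, and homogeneity of
  degree 2 carries the bound to all vectors. This extracts a quantitative margin from strict
  definiteness.\<close>

lemma quadratic_neg_definite_bound:
  fixes f :: "'a::euclidean_space \<Rightarrow> real"
  assumes cont: "continuous_on UNIV f" and hom: "\<And>c x. f (c *\<^sub>R x) = c\<^sup>2 * f x"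
    and neg: "\<And>x. x \<noteq> 0 \<Longrightarrow> f x < 0"
  obtains e where "0 < e" "\<And>x. f x \<le> - e * (norm x)\<^sup>2"
proof -
  have "\<exists>y\<in>sphere 0 1. \<forall>x\<in>sphere 0 1. f x \<le> f y"
    by (rule continuous_attains_sup) (auto intro: continuous_on_subset[OF cont])
  then obtain y :: 'a where y: "y \<in> sphere 0 1" "\<And>x. x \<in> sphere 0 1 \<Longrightarrow> f x \<le> f y" by blast
  show ?thesis
  proof (rule that)
    have "y \<noteq> 0" using y(1) by auto
    then show "0 < - f y" using neg by simp
    show "f x \<le> - (- f y) * (norm x)\<^sup>2" for x
    proof (cases "x = 0")
      case True
      then show ?thesis using hom[of 0 0] by simp
    next
      case False
      then have "f x = (norm x)\<^sup>2 * f ((1 / norm x) *\<^sub>R x)"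
        by (subst hom[symmetric]) simp
      also have "\<dots> \<le> (norm x)\<^sup>2 * f y"
        using False by (intro mult_left_mono y(2)) auto
      finally show ?thesis by (simp add: mult.commute)
    qed
  qed
qed

text \<open>Block vectors that vanish outside \<open>I\<close> test exactly the principal submatrix
  with rows and columns in \<open>I\<close>.\<close>

lemma neg_def_block_mx_principal:
  assumes B: "neg_def_block_mx k B" and I: "I \<subseteq> {..<k}" and x: "\<exists>i\<in>I. x i \<noteq> 0"
  shows "(\<Sum>i\<in>I. \<Sum>j\<in>I. x i \<bullet> (B i j *v x j)) < 0"
proof -
  define y where "y i = (if i \<in> I then x i else 0)" for i
  have "(\<Sum>i<k. \<Sum>j<k. y i \<bullet> (B i j *v y j)) < 0"
  proof -
    have "\<exists>i<k. y i \<noteq> 0" using I x by (force simp: y_def)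
    then show ?thesis using B unfolding neg_def_block_mx_def by blast
  qed
  also have "(\<Sum>i<k. \<Sum>j<k. y i \<bullet> (B i j *v y j)) = (\<Sum>i\<in>I. \<Sum>j<k. y i \<bullet> (B i j *v y j))"
    by (rule sum.mono_neutral_right) (use I in \<open>auto simp: y_def\<close>)
  also have "\<dots> = (\<Sum>i\<in>I. \<Sum>j\<in>I. y i \<bullet> (B i j *v y j))"
    by (intro sum.cong refl sum.mono_neutral_right) (use I in \<open>auto simp: y_def\<close>)
  also have "\<dots> = (\<Sum>i\<in>I. \<Sum>j\<in>I. x i \<bullet> (B i j *v x j))"
    by (intro sum.cong refl) (auto simp: y_def)
  finally show ?thesis .
qed

lemma matrix_scaleR_vector: "(c *\<^sub>R A) *v x = c *\<^sub>R (A *v x)"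
  for A :: "real^'n^'m" by (rule scaleR_matrix_vector_assoc[symmetric])

lemma diagonal_mx_product_vector:
  fixes A B :: "real^'n^'n"
  assumes "diagonal_mx A" "diagonal_mx B"
  shows "((A ** B) *v x) $ i = A $ i $ i * B $ i $ i * x $ i"
proof -
  have "(A ** B) *v x = A *v (B *v x)" by (simp add: matrix_vector_mul_assoc)
  then show ?thesis using assms by (simp add: diagonal_mx_vector_mult)
qed

lemma pos_def_diagonal_entry:
  assumes "pos_def_mx A" "diagonal_mx A" shows "0 < A $ i $ i"
proof -
  have "0 < axis i 1 \<bullet> (A *v axis i 1)" using assms(1) by (auto simp: pos_def_mx_def axis_eq_0_iff)
  then show ?thesis using assms(2) by (simp add: diagonal_mx_vector_mult inner_axis')
qed

lemma matrix_inv_right: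
  fixes A :: "real^'n^'n"
  assumes "invertible A" shows "A ** matrix_inv A = mat 1"
proof -
  have "\<exists>B. A ** B = mat 1 \<and> B ** A = mat 1" using assms by (simp add: invertible_def)
  then show ?thesis unfolding matrix_inv_def by (rule someI2_ex) simp
qed

lemma invertible_pos_def:
  fixes A :: "real^'n^'n"
  assumes "\<And>x. x \<noteq> 0 \<Longrightarrow> 0 < x \<bullet> (A *v x)" shows "invertible A"
proof -
  have "x = 0" if "A *v x = 0" for x using assms[of x] that by (cases "x = 0") auto
  then show ?thesis
    by (simp add: invertible_left_inverse matrix_left_invertible_ker)
qed

section \<open>From the design inequality to a dissipation inequality for the closed loop\<close>

context
  fixes \<Lambda> H Bv M Bw Dv :: "real^'n^'n"
    and Bu :: "real^'u^'n"
    and Q1 Q2 G P3 Pp Rp Sp Lp :: "real^'n^'n"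
    and K1 Kp :: "real^'n^'u"
    and \<alpha> \<beta> :: real
  assumes \<Lambda>: "diagonal_mx \<Lambda>" "pos_def_mx \<Lambda>"
    and Q1: "diagonal_mx Q1" and G: "diagonal_mx G" and P3: "symmetric_mx P3"
    and lmi: "neg_def_block_mx 9
           (design_blocks \<Lambda> H Bu Bv M Bw Dv \<alpha> \<beta> Q1 Q2 G P3 Pp K1 Kp Rp Sp Lp)"
begin

text \<open>The diagonal block of row 6 is - 2 P3; blocks are numbered from 0, so this row has index
  5.\<close>

lemma design_P3_positive: assumes "x \<noteq> 0" shows "0 < x \<bullet> (P3 *v x)"
proof -
  have "x \<bullet> (- (2 *\<^sub>R P3) *v x) < 0"
    using neg_def_block_mx_principal[OF lmi, of "{5}" "\<lambda>_. x"] assms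
    by (simp add: design_blocks_def symmetric_blocks_def Let_def)
  then have "x \<bullet> (- (2 *\<^sub>R (P3 *v x))) < 0"
    by (metis matrix_scaleR_vector scaleR_minus_left)
  then show ?thesis by simp
qed

text \<open>The diagonal block of row 8 (index 7) is - Q1 \<Lambda>, here tested on a unit
  vector.\<close>

lemma design_Q1_positive: "0 < Q1 $ i $ i"
proof -
  let ?x = "axis i 1 :: real^'n"
  have "?x \<bullet> (- (Q1 ** \<Lambda>) *v ?x) < 0"
    using neg_def_block_mx_principal[OF lmi, of "{7}" "\<lambda>_. ?x"]
    by (simp add: design_blocks_def symmetric_blocks_def Let_def axis_eq_0_iff)
  moreover have "- (Q1 ** \<Lambda>) *v ?x = - ((Q1 ** \<Lambda>) *v ?x)"
    using matrix_scaleR_vector[of "-1" "Q1 ** \<Lambda>" ?x] by simp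
  ultimately have "0 < Q1 $ i $ i * \<Lambda> $ i $ i"
    by (simp add: inner_axis' diagonal_mx_product_vector[OF Q1 \<Lambda>(1)])
  then show ?thesis using pos_def_diagonal_entry[OF \<Lambda>(2,1), of i] by (simp add: zero_less_mult_iff)
qed

lemma design_diagonal_block:
  "a \<bullet> ((exp (- 1) *\<^sub>R (\<Lambda> ** (Q1 - 2 *\<^sub>R G))) *v a)
    = exp (- 1) * (\<Sum>i\<in>UNIV. \<Lambda> $ i $ i * (Q1 $ i $ i - 2 * G $ i $ i) * (a $ i)\<^sup>2)"
proof -
  have d: "diagonal_mx (Q1 - 2 *\<^sub>R G)" using Q1 G by (simp add: diagonal_mx_def)
  show ?thesis
    unfolding matrix_scaleR_vector inner_scaleR_right
    by (simp add: inner_vec_def diagonal_mx_product_vector[OF \<Lambda>(1) d] power2_eq_square mult_ac)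
qed

text \<open>Row 2 (index 1), tested on a unit vector, gives Q1 < 2 G entrywise, and Q1 is already
  known to be positive.\<close>

lemma design_G_positive: "0 < G $ i $ i"
proof -
  let ?x = "axis i 1 :: real^'n"
  have "?x \<bullet> ((exp (- 1) *\<^sub>R (\<Lambda> ** (Q1 - 2 *\<^sub>R G))) *v ?x) < 0"
    using neg_def_block_mx_principal[OF lmi, of "{1}" "\<lambda>_. ?x"]
    by (simp add: design_blocks_def symmetric_blocks_def Let_def axis_eq_0_iff)
  moreover have "(\<Sum>j\<in>UNIV. \<Lambda> $ j $ j * (Q1 $ j $ j - 2 * G $ j $ j) * (?x $ j)\<^sup>2)
      = (\<Sum>j\<in>UNIV. if j = i then \<Lambda> $ i $ i * (Q1 $ i $ i - 2 * G $ i $ i) else 0)"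
    by (intro sum.cong refl) (auto simp: axis_def)
  ultimately have "\<Lambda> $ i $ i * (Q1 $ i $ i - 2 * G $ i $ i) < 0"
    unfolding design_diagonal_block by (simp add: mult_less_0_iff)
  then have "Q1 $ i $ i < 2 * G $ i $ i"
    using pos_def_diagonal_entry[OF \<Lambda>(2,1), of i] by (simp add: mult_less_0_iff)
  then show ?thesis using design_Q1_positive[of i] by simp
qed

text \<open>The boundary value at z = 0 of the closed loop for v = 0, expressed in
  \<open>a = G^-1 \<xi>(t,1)\<close>. In this variable the inverse in \<open>K2 = Kp G^-1\<close>
  cancels, and the expression agrees with row 8 up to the factor \<Lambda>.\<close>

definition inflow :: "real^'n \<Rightarrow> real^'n \<Rightarrow> real^'n" where
  "inflow a \<eta> = (H ** G + Bu ** Kp) *v a + (Bu ** K1) *v \<eta>"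

lemma inflow_add: "inflow (a + a') (\<eta> + \<eta>') = inflow a \<eta> + inflow a' \<eta>'"
  by (simp add: inflow_def matrix_vector_right_distrib)

lemma inflow_scaleR: "inflow (c *\<^sub>R a) (c *\<^sub>R \<eta>) = c *\<^sub>R inflow a \<eta>"
  by (simp add: inflow_def matrix_vector_mult_scaleR scaleR_add_right)

text \<open>What is left of rows 2, 3 and 8 after eliminating the variable of row 8. For the outflow
  \<open>G *v a\<close> and v = 0 it is an upper bound for the boundary flux plus the derivative of
  \<eta>^T P3 \<eta> plus \<open>2 * \<alpha> + \<beta>\<close> times \<eta>^T P3 \<eta>.\<close>

definition design_form :: "(real^'n) \<times> (real^'n) \<Rightarrow> real" where
  "design_form y = (case y of (a, \<eta>) \<Rightarrow>
      exp (- 1) * (\<Sum>i\<in>UNIV. \<Lambda> $ i $ i * (Q1 $ i $ i - 2 * G $ i $ i) * (a $ i)\<^sup>2)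
      + 2 * (\<eta> \<bullet> (Sp *v a)) + 2 * (\<eta> \<bullet> (Rp *v \<eta>)) + (2 * \<alpha> + \<beta>) * (\<eta> \<bullet> (P3 *v \<eta>))
      + (\<Sum>i\<in>UNIV. \<Lambda> $ i $ i / Q1 $ i $ i * (inflow a \<eta> $ i)\<^sup>2))"

text \<open>Schur complement of rows 2, 3 and 8 with respect to \<open>- Q\<^sub>1 \<Lambda>\<close>: the maximising choice in row 8 is
  \<open>Q\<^sub>1\<^sup>-\<^sup>1\<close> times the inflow.\<close>

lemma design_form_negative:
  assumes "y \<noteq> 0" shows "design_form y < 0"
proof -
  obtain a \<eta> where y: "y = (a, \<eta>)" by (cases y)
  define N where "N = inflow a \<eta>"
  define s :: "real^'n" where "s = (\<chi> i. N $ i / Q1 $ i $ i)"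
  let ?X = "Rp + (\<alpha> + \<beta> / 2) *\<^sub>R P3"
  \<comment> \<open>Blocks are numbered from 0, so 1, 2 and 7 are rows 2, 3 and 8.\<close>
  have "(\<Sum>i\<in>{1,2,7}. \<Sum>j\<in>{1,2,7}. (\<lambda>i::nat. if i = 1 then a else if i = 2 then \<eta> else s) i \<bullet>
      (design_blocks \<Lambda> H Bu Bv M Bw Dv \<alpha> \<beta> Q1 Q2 G P3 Pp K1 Kp Rp Sp Lp i j *v
        (\<lambda>i::nat. if i = 1 then a else if i = 2 then \<eta> else s) j)) < 0"
    by (rule neg_def_block_mx_principal[OF lmi]) (use assms y in \<open>auto simp: prod_eq_iff\<close>)
  then have "a \<bullet> ((exp (- 1) *\<^sub>R (\<Lambda> ** (Q1 - 2 *\<^sub>R G))) *v a) + a \<bullet> (transpose Sp *v \<eta>)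
      + a \<bullet> (transpose (\<Lambda> ** (H ** G + Bu ** Kp)) *v s)
      + (\<eta> \<bullet> (Sp *v a) + \<eta> \<bullet> (He ?X *v \<eta>) + \<eta> \<bullet> (transpose (\<Lambda> ** (Bu ** K1)) *v s))
      + (s \<bullet> ((\<Lambda> ** (H ** G + Bu ** Kp)) *v a) + s \<bullet> ((\<Lambda> ** (Bu ** K1)) *v \<eta>) + s \<bullet> (- (Q1 ** \<Lambda>) *v s)) < 0"
    by (simp add: design_blocks_def symmetric_blocks_def Let_def add.assoc)
  moreover have tr: "x \<bullet> (transpose A *v z) = z \<bullet> (A *v x)" for A :: "real^'n^'n" and x z
    by (metis dot_lmul_matrix inner_commute transpose_matrix_vector)
  have He: "\<eta> \<bullet> (He ?X *v \<eta>) = 2 * (\<eta> \<bullet> (Rp *v \<eta>)) + (2 * \<alpha> + \<beta>) * (\<eta> \<bullet> (P3 *v \<eta>))"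
    unfolding He_def matrix_vector_mult_add_rdistrib inner_add_right tr
    by (simp add: matrix_scaleR_vector algebra_simps)
  have row: "s \<bullet> ((\<Lambda> ** (H ** G + Bu ** Kp)) *v a) + s \<bullet> ((\<Lambda> ** (Bu ** K1)) *v \<eta>) = s \<bullet> (\<Lambda> *v N)"
    unfolding N_def inflow_def
    by (simp add: matrix_vector_mul_assoc[symmetric] matrix_vector_right_distrib inner_add_right)
  have neg: "s \<bullet> (- (Q1 ** \<Lambda>) *v s) = - (s \<bullet> ((Q1 ** \<Lambda>) *v s))"
    using matrix_scaleR_vector[of "-1" "Q1 ** \<Lambda>" s] by simp
  \<comment> \<open>At the maximiser the terms of row 8 collapse to the last sum of
    \<open>design_form\<close>.\<close>
  have "2 * (s \<bullet> (\<Lambda> *v N)) - s \<bullet> ((Q1 ** \<Lambda>) *v s) = (\<Sum>i\<in>UNIV. \<Lambda> $ i $ i / Q1 $ i $ i * (N $ i)\<^sup>2)"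
    unfolding inner_vec_def diagonal_mx_product_vector[OF Q1 \<Lambda>(1)] diagonal_mx_vector_mult[OF \<Lambda>(1)]
      sum_distrib_left sum_subtractf[symmetric]
  proof (intro sum.cong refl)
    fix i
    show "2 * (s $ i \<bullet> (\<chi> i. \<Lambda> $ i $ i * N $ i) $ i) - s $ i \<bullet> (Q1 $ i $ i * \<Lambda> $ i $ i * s $ i)
        = \<Lambda> $ i $ i / Q1 $ i $ i * (N $ i)\<^sup>2"
      using design_Q1_positive[of i] by (simp add: s_def power2_eq_square field_simps)
  qed
  ultimately show ?thesis
    using row unfolding y design_form_def N_def[symmetric] tr He neg design_diagonal_block
    by (simp add: N_def[symmetric])
qed

lemma design_form_bound:
  obtains e where "0 < e" "\<And>a \<eta>. design_form (a, \<eta>) \<le> - e * (norm (a, \<eta>))\<^sup>2"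
proof -
  have hom: "design_form (c *\<^sub>R y) = c\<^sup>2 * design_form y" for c y
  proof -
    obtain a \<eta> where y: "y = (a, \<eta>)" by (cases y)
    have s: "(\<Sum>i\<in>UNIV. k i * (c * b i)\<^sup>2) = c\<^sup>2 * (\<Sum>i\<in>UNIV. k i * (b i)\<^sup>2)" for k b :: "'n \<Rightarrow> real"
      by (simp add: sum_distrib_left power_mult_distrib mult_ac)
    show ?thesis
      unfolding y scaleR_Pair design_form_def prod.case inflow_scaleR vector_scaleR_component real_scaleR_def s
        matrix_vector_mult_scaleR inner_scaleR_left inner_scaleR_right
      by (simp add: power2_eq_square[of c] distrib_left mult_ac)
  qed
  have mv: "continuous_on UNIV (\<lambda>y. A *v f y)" if "continuous_on UNIV f"
    for A :: "real^'a^'b" and f :: "(real^'n) \<times> (real^'n) \<Rightarrow> real^'a"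
    by (rule bounded_linear.continuous_on[OF _ that]) simp
  have cont: "continuous_on UNIV design_form"
    unfolding design_form_def[abs_def] inflow_def case_prod_unfold
    by (intro continuous_on_add continuous_on_mult continuous_on_sum continuous_on_inner continuous_on_power
        continuous_on_component continuous_on_fst continuous_on_snd continuous_on_id mv
        continuous_on_const)
  obtain e where "0 < e" "\<And>y. design_form y \<le> - e * (norm y)\<^sup>2"
    using quadratic_neg_definite_bound[OF cont hom design_form_negative] by blast
  then show ?thesis using that by blast
qed

text \<open>For x = 0 the left-hand side is at most \<open>design_form\<close> minus the decay term.
  The influence of x = v is linear or quadratic: the margin in \<open>design_form_bound\<close>
  absorbs the linear part, at the price of the constant \<open>C\<close>.\<close>

lemma closed_loop_dissipation:
  defines "K2 \<equiv> Kp ** matrix_inv G" and "R \<equiv> matrix_inv P3 ** Rp"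
    and "S \<equiv> matrix_inv P3 ** Sp ** matrix_inv G"
  obtains C where "0 \<le> C" "\<And>z1 \<eta> x.
     (\<Sum>i\<in>UNIV. 1 / Q1 $ i $ i * \<Lambda> $ i $ i *
        (((H *v z1 + Bu *v (K1 *v \<eta> + K2 *v (z1 + Dv *v x)) + Bv *v x) $ i)\<^sup>2 - exp (- 1) * (z1 $ i)\<^sup>2))
     + 2 * (\<eta> \<bullet> (P3 *v (R *v \<eta> + S *v (z1 + Dv *v x))))
     \<le> - (2 * \<alpha> + \<beta>) * (\<eta> \<bullet> (P3 *v \<eta>)) + C * (x \<bullet> x)"
proof -
  obtain e where e: "0 < e" "\<And>a \<eta>. design_form (a, \<eta>) \<le> - e * (norm (a, \<eta>))\<^sup>2"
    using design_form_bound by blast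
  \<comment> \<open>\<open>E1\<close> is the effect of v on the inflow and \<open>E2\<close> its
    effect on P3 times the rate of \<eta>; \<open>h1\<close> and \<open>h2\<close> collect the terms
    linear in x, \<open>g\<close> the quadratic ones.\<close>
  define E1 where "E1 = Bu ** K2 ** Dv + Bv"
  define E2 where "E2 = Sp ** matrix_inv G ** Dv"
  define k where "k i = \<Lambda> $ i $ i / Q1 $ i $ i" for i
  define h1 where "h1 y x = (\<chi> i. 2 * k i * inflow (fst y) (snd y) $ i) \<bullet> (E1 *v x)"
    for y :: "(real^'n) \<times> (real^'n)" and x
  define h2 where "h2 y x = snd y \<bullet> (E2 *v x)" for y :: "(real^'n) \<times> (real^'n)" and x
  define g where "g x x' = (\<chi> i. k i * (E1 *v x) $ i) \<bullet> (E1 *v x')" for x x'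
  have lin: "bounded_linear (\<lambda>y::(real^'n) \<times> (real^'n). \<chi> i. 2 * k i * inflow (fst y) (snd y) $ i)"
    "bounded_linear (\<lambda>x. \<chi> i. k i * (E1 *v x) $ i)"
    unfolding linear_conv_bounded_linear[symmetric] linear_iff
    by (simp_all add: inflow_add inflow_scaleR vec_eq_iff matrix_vector_right_distrib
        matrix_vector_mult_scaleR distrib_left mult_ac)
  have "bounded_bilinear h1" "bounded_bilinear h2" "bounded_bilinear g"
    unfolding h1_def h2_def g_def
    by (rule bounded_bilinear.comp[OF bounded_bilinear_inner]; simp add: lin bounded_linear_snd)+
  then obtain L1 L2 L' where L12: "\<And>y x. norm (h1 y x) \<le> norm y * norm x * L1"
      "\<And>y x. norm (h2 y x) \<le> norm y * norm x * L2" and L': "\<And>y x. norm (g y x) \<le> norm y * norm x * L'"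
    by (metis bounded_bilinear.bounded)
  define h where "h y x = h1 y x + 2 * h2 y x" for y x
  define L where "L = L1 + 2 * L2"
  have L: "norm (h y x) \<le> L * norm y * norm x" for y x
  proof -
    have "norm (h y x) \<le> norm (h1 y x) + 2 * norm (h2 y x)" unfolding h_def by simp
    also have "\<dots> \<le> norm y * norm x * L1 + 2 * (norm y * norm x * L2)"
      by (intro add_mono mult_left_mono L12) auto
    finally show ?thesis by (simp add: L_def algebra_simps)
  qed
  \<comment> \<open>Absorbing L |y| |x| into e |y|^2 leaves L^2 / (4 e) |x|^2; the other summand
    bounds \<open>g\<close>.\<close>
  define C where "C = L\<^sup>2 / (4 * e) + \<bar>L'\<bar>"
  have Gdiag: "G *v (matrix_inv G *v z) = z" for z
  proof -
    have "0 < x \<bullet> (G *v x)" if x: "x \<noteq> 0" for x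
    proof -
      obtain j where j: "x $ j \<noteq> 0" using x by (metis vec_eq_iff zero_index)
      have "0 < (\<Sum>i\<in>UNIV. G $ i $ i * (x $ i)\<^sup>2)"
        by (rule sum_pos2[of _ j]) (use j design_G_positive in \<open>auto simp: less_imp_le\<close>)
      then show ?thesis by (simp add: inner_vec_def diagonal_mx_vector_mult[OF G] power2_eq_square mult_ac)
    qed
    then have "G ** matrix_inv G = mat 1" by (intro matrix_inv_right invertible_pos_def)
    then show ?thesis by (simp add: matrix_vector_mul_assoc)
  qed
  have P3inv: "P3 ** matrix_inv P3 = mat 1"
    by (intro matrix_inv_right invertible_pos_def design_P3_positive)
  \<comment> \<open>\<open>R\<close> and \<open>S\<close> are built to cancel against P3: P3 R = Rp
    and P3 S = Sp G^-1.\<close>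
  have P3R: "P3 *v (R *v \<eta> + S *v z) = Rp *v \<eta> + Sp *v (matrix_inv G *v z)" for \<eta> z
    unfolding R_def S_def
    by (simp add: matrix_vector_right_distrib matrix_vector_mul_assoc matrix_mul_assoc P3inv)
  show ?thesis
  proof (rule that[of C])
    show "0 \<le> C" using e(1) by (simp add: C_def)
    fix z1 \<eta> x :: "real^'n"
    define a where "a = matrix_inv G *v z1"
    have z1: "z1 $ i = G $ i $ i * a $ i" for i
    proof -
      have "z1 $ i = (G *v a) $ i" by (simp add: Gdiag a_def)
      then show ?thesis by (simp add: diagonal_mx_vector_mult[OF G])
    qed
    define N where "N = inflow a \<eta>"
    define d where "d = E1 *v x"
    have z0: "H *v z1 + Bu *v (K1 *v \<eta> + K2 *v (z1 + Dv *v x)) + Bv *v x = N + d"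
      unfolding N_def d_def inflow_def E1_def K2_def
      by (simp add: matrix_vector_right_distrib matrix_vector_mult_add_rdistrib Gdiag
          a_def matrix_vector_mul_assoc[symmetric])
    have P: "P3 *v (R *v \<eta> + S *v (z1 + Dv *v x)) = Rp *v \<eta> + Sp *v a + E2 *v x"
      unfolding P3R E2_def a_def by (simp add: matrix_vector_right_distrib matrix_vector_mul_assoc[symmetric])
    have entry: "1 / Q1 $ i $ i * \<Lambda> $ i $ i * (((N + d) $ i)\<^sup>2 - exp (- 1) * (z1 $ i)\<^sup>2)
       \<le> k i * (N $ i)\<^sup>2 + exp (- 1) * (\<Lambda> $ i $ i * (Q1 $ i $ i - 2 * G $ i $ i) * (a $ i)\<^sup>2)
         + 2 * k i * N $ i * d $ i + k i * d $ i * d $ i" for i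
    proof -
      let ?Q = "Q1 $ i $ i" and ?G = "G $ i $ i"
      \<comment> \<open>Expanding this square bounds the outflow coefficient - G^2 / Q1 by Q1 - 2 G,
        an expression linear in the design variables; this explains the entry of row 2.\<close>
      have "0 \<le> (?Q - ?G)\<^sup>2 / ?Q" using design_Q1_positive[of i] by simp
      also have "\<dots> = ?Q - 2 * ?G + ?G\<^sup>2 / ?Q"
        using design_Q1_positive[of i] by (simp add: power2_eq_square field_simps)
      finally have "- (?G\<^sup>2 / ?Q) \<le> ?Q - 2 * ?G" by simp
      then have "(exp (- 1) * \<Lambda> $ i $ i * (a $ i)\<^sup>2) * (- (?G\<^sup>2 / ?Q)) \<le> (exp (- 1) * \<Lambda> $ i $ i * (a $ i)\<^sup>2) * (?Q - 2 * ?G)"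
        using pos_def_diagonal_entry[OF \<Lambda>(2,1), of i] by (intro mult_left_mono) auto
      moreover have "1 / ?Q * \<Lambda> $ i $ i * (((N + d) $ i)\<^sup>2 - exp (- 1) * (z1 $ i)\<^sup>2)
         = k i * (N $ i)\<^sup>2 + 2 * k i * N $ i * d $ i + k i * d $ i * d $ i
           + (exp (- 1) * \<Lambda> $ i $ i * (a $ i)\<^sup>2) * (- (?G\<^sup>2 / ?Q))"
        unfolding z1 k_def by (simp add: power2_sum power_mult_distrib algebra_simps power2_eq_square add_divide_distrib)
      ultimately show ?thesis by (simp add: mult_ac)
    qed
    have "(\<Sum>i\<in>UNIV. 1 / Q1 $ i $ i * \<Lambda> $ i $ i * (((N + d) $ i)\<^sup>2 - exp (- 1) * (z1 $ i)\<^sup>2))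
       \<le> (\<Sum>i\<in>UNIV. k i * (N $ i)\<^sup>2 + exp (- 1) * (\<Lambda> $ i $ i * (Q1 $ i $ i - 2 * G $ i $ i) * (a $ i)\<^sup>2)
         + 2 * k i * N $ i * d $ i + k i * d $ i * d $ i)"
      by (intro sum_mono entry)
    then have "(\<Sum>i\<in>UNIV. 1 / Q1 $ i $ i * \<Lambda> $ i $ i * (((N + d) $ i)\<^sup>2 - exp (- 1) * (z1 $ i)\<^sup>2))
        + 2 * (\<eta> \<bullet> (Rp *v \<eta> + Sp *v a + E2 *v x))
       \<le> design_form (a, \<eta>) - (2 * \<alpha> + \<beta>) * (\<eta> \<bullet> (P3 *v \<eta>)) + h (a, \<eta>) x + g x x"
      unfolding design_form_def h_def h1_def h2_def g_def N_def[symmetric] d_def[symmetric] fst_conv snd_conv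
      by (simp add: inner_vec_def[of _ d] sum.distrib sum_distrib_left inner_add_right N_def[symmetric] k_def[symmetric])
    also have "h (a, \<eta>) x \<le> e * (norm (a, \<eta>))\<^sup>2 + L\<^sup>2 / (4 * e) * (x \<bullet> x)"
    proof -
      have "h (a, \<eta>) x \<le> L * norm (a, \<eta>) * norm x" using L[of "(a, \<eta>)" x] by simp
      moreover have "0 \<le> (2 * e * norm (a, \<eta>) - L * norm x)\<^sup>2 / (4 * e)" using e(1) by simp
      moreover have "(2 * e * norm (a, \<eta>) - L * norm x)\<^sup>2 / (4 * e)
          = e * (norm (a, \<eta>))\<^sup>2 - L * norm (a, \<eta>) * norm x + L\<^sup>2 / (4 * e) * (norm x)\<^sup>2"
        using e(1) by (simp add: power2_diff power_mult_distrib field_simps power2_eq_square)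
      ultimately show ?thesis unfolding dot_square_norm by linarith
    qed
    also have "g x x \<le> \<bar>L'\<bar> * (x \<bullet> x)"
    proof -
      have "g x x \<le> L' * (norm x * norm x)" using L'[of x x] by (simp add: mult_ac)
      also have "\<dots> \<le> \<bar>L'\<bar> * (norm x * norm x)" by (intro mult_right_mono) auto
      finally show ?thesis by (simp add: dot_square_norm power2_eq_square)
    qed
    finally show "(\<Sum>i\<in>UNIV. 1 / Q1 $ i $ i * \<Lambda> $ i $ i *
        (((H *v z1 + Bu *v (K1 *v \<eta> + K2 *v (z1 + Dv *v x)) + Bv *v x) $ i)\<^sup>2 - exp (- 1) * (z1 $ i)\<^sup>2))
     + 2 * (\<eta> \<bullet> (P3 *v (R *v \<eta> + S *v (z1 + Dv *v x))))
     \<le> - (2 * \<alpha> + \<beta>) * (\<eta> \<bullet> (P3 *v \<eta>)) + C * (x \<bullet> x)"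
      using e(2)[of a \<eta>] unfolding z0 P C_def by (simp add: distrib_right left_diff_distrib)
  qed
qed

end

section \<open>Traces, norm equivalence and limits of the weighted form\<close>

text \<open>The unit vectors are eigenvectors of a diagonal matrix, and its diagonal entries are the
  eigenvalues.\<close>

lemma hurwitz_diagonal_entry:
  fixes M :: "real^'n^'n"
  assumes "hurwitz_mx M" "diagonal_mx M" shows "M $ i $ i < 0"
proof -
  let ?x = "axis i 1 :: complex^'n"
  have "map_matrix complex_of_real M *v ?x = complex_of_real (M $ i $ i) *s ?x"
  proof (simp add: vec_eq_iff, rule allI)
    fix k
    have "(\<Sum>j\<in>UNIV. complex_of_real (M $ k $ j) * ?x $ j)
        = (\<Sum>j\<in>UNIV. if j = i then complex_of_real (M $ k $ i) else 0)"
      by (intro sum.cong refl) (simp add: axis_def)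
    then show "(map_matrix complex_of_real M *v ?x) $ k = complex_of_real (M $ i $ i) * ?x $ k"
      using assms(2) by (auto simp: matrix_vector_mult_def map_matrix_def axis_def diagonal_mx_def)
  qed
  moreover have "?x \<noteq> 0" by (simp add: axis_eq_0_iff)
  ultimately show ?thesis using assms(1) unfolding hurwitz_mx_def by fastforce
qed

text \<open>Holds even where no derivative exists: \<open>vector_derivative\<close> is a choice from
  a predicate on D, the two predicates coincide, and hence so do the chosen values.\<close>

lemma Dz_cong:
  assumes "\<And>z. z \<in> {0..1} \<Longrightarrow> f z = g z" "z \<in> {0..1}"
  shows "Dz f z = Dz g z"
proof -
  have "(f has_vector_derivative D) (at z within {0..1}) \<longleftrightarrow> (g has_vector_derivative D) (at z within {0..1})" for D
    using assms has_vector_derivative_transform[of z "{0..1}"] by metis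
  then show ?thesis by (simp add: Dz_def vector_derivative_def)
qed

text \<open>Integrate the derivative of z |\<zeta>(z)|^2; the factor z removes the value at 0. The
  bound is needed for \<xi>(0,1), which enters the initial rate of \<eta>.\<close>

lemma trace_bound:
  fixes \<zeta> \<omega> :: "real \<Rightarrow> real^'n"
  assumes \<omega>: "\<omega> \<in> L2" and prim: "\<And>z. z \<in> {0..1} \<Longrightarrow> (\<omega> has_integral (\<zeta> z - \<zeta> 0)) {0..z}"
  shows "\<zeta> 1 \<bullet> \<zeta> 1 \<le> 2 * ip \<zeta> \<zeta> + ip \<omega> \<omega>"
proof -
  have pz: "is_primitive 0 1 (\<lambda>z. z) (\<lambda>z. 1)"
    by (rule is_primitive_of_derivative) (auto intro!: derivative_eq_intros)
  have \<zeta>: "\<zeta> \<in> L2" by (rule L2_primitive[OF \<omega> prim])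
  let ?f = "\<lambda>z. \<Sum>i\<in>UNIV. 1 * (\<zeta> z $ i * \<zeta> z $ i) + z * (\<omega> z $ i * \<zeta> z $ i + \<zeta> z $ i * \<omega> z $ i)"
  have p: "is_primitive 0 1 (\<lambda>z. \<Sum>i\<in>UNIV. z * (\<zeta> z $ i * \<zeta> z $ i)) ?f"
    by (intro is_primitive_sum is_primitive_mult pz is_primitive_component[OF \<omega> prim]) auto
  have "\<zeta> 1 \<bullet> \<zeta> 1 = integral\<^sup>L unit_measure ?f"
    using is_primitive_lebesgue_integral[OF p] by (simp add: inner_vec_def)
  also have "\<dots> \<le> (\<integral>z. 2 * (\<zeta> z \<bullet> \<zeta> z) + \<omega> z \<bullet> \<omega> z \<partial>unit_measure)"
  proof (rule integral_mono)
    show "integrable unit_measure ?f" using p by (simp add: is_primitive_def)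
    show "integrable unit_measure (\<lambda>z. 2 * (\<zeta> z \<bullet> \<zeta> z) + \<omega> z \<bullet> \<omega> z)"
      using L2_integrable[OF \<zeta>] L2_integrable[OF \<omega>] by simp
    fix z assume "z \<in> space unit_measure"
    then have z: "0 \<le> z" "z \<le> 1" by auto
    have "1 * (x * x) + z * (y * x + x * y) \<le> 2 * (x * x) + y * y" for x y :: real
    proof -
      have "z * (2 * x * y) \<le> z * (x\<^sup>2 + y\<^sup>2)"
        using sum_squares_bound[of x y] z by (intro mult_left_mono) auto
      also have "\<dots> \<le> 1 * (x\<^sup>2 + y\<^sup>2)" using z by (intro mult_right_mono) auto
      finally show ?thesis by (simp add: power2_eq_square algebra_simps)
    qed
    then have "?f z \<le> (\<Sum>i\<in>UNIV. 2 * (\<zeta> z $ i * \<zeta> z $ i) + \<omega> z $ i * \<omega> z $ i)"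
      by (intro sum_mono)
    then show "?f z \<le> 2 * (\<zeta> z \<bullet> \<zeta> z) + \<omega> z \<bullet> \<omega> z"
      by (simp add: inner_vec_def sum.distrib sum_distrib_left)
  qed
  also have "\<dots> = 2 * ip \<zeta> \<zeta> + ip \<omega> \<omega>"
    using L2_integrable[OF \<zeta>] L2_integrable[OF \<omega>] by (simp add: ip_def)
  finally show ?thesis .
qed

lemma weighted_form_le:
  assumes "f \<in> L2" "\<And>i. \<bar>p i\<bar> \<le> P"
  shows "ip f (weighted p f) \<le> P * ip f f"
proof -
  have P0: "P \<ge> 0" using assms(2)[of undefined] by linarith
  have "L2_norm (weighted p f) \<le> P * L2_norm f"
    using assms P0 by (intro L2_norm_dominated L2_weighted weighted_dominated) auto
  then have "L2_norm f * L2_norm (weighted p f) \<le> L2_norm f * (P * L2_norm f)"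
    by (intro mult_left_mono L2_norm_nonneg)
  moreover have "\<dots> = P * ip f f"
    using L2_norm_power2[OF assms(1)] by (simp add: power2_eq_square)
  ultimately show ?thesis
    using ip_Cauchy_Schwarz[OF assms(1) L2_weighted[OF assms(1), of p]] by linarith
qed

text \<open>On [0, 1] the factor \<open>exp (- z)\<close> is at least
  \<open>exp (- 1)\<close>.\<close>

lemma weighted_form_ge:
  fixes f :: "real \<Rightarrow> real^'n"
  assumes f: "f \<in> L2" and m: "0 \<le> m" "\<And>i. m \<le> p i"
  shows "exp (- 1) * m * ip f f \<le> ip f (weighted p f)"
proof -
  have "(\<integral>z. (exp (- 1) * m) * (f z \<bullet> f z) \<partial>unit_measure) \<le> (\<integral>z. f z \<bullet> weighted p f z \<partial>unit_measure)"
  proof (rule integral_mono)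
    show "integrable unit_measure (\<lambda>z. (exp (- 1) * m) * (f z \<bullet> f z))"
      using L2_integrable[OF f] by simp
    show "integrable unit_measure (\<lambda>z. f z \<bullet> weighted p f z)"
      by (intro L2_inner_integrable L2_weighted f)
    fix z assume "z \<in> space unit_measure"
    then have "exp (- 1) * m * (f z $ i)\<^sup>2 \<le> exp (- z) * p i * (f z $ i)\<^sup>2" for i
      using m by (intro mult_right_mono mult_mono) auto
    then show "(exp (- 1) * m) * (f z \<bullet> f z) \<le> f z \<bullet> weighted p f z"
      unfolding weighted_def inner_vec_def sum_distrib_left
      by (intro sum_mono) (simp add: power2_eq_square mult_ac)
  qed
  then show ?thesis by (simp add: ip_def)
qed

text \<open>By symmetry of the weight, the difference of the two forms is the inner product of f - g
  with the weighted f + g; Cauchy-Schwarz bounds it by the L2 distance times a bounded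
  factor.\<close>

lemma tendsto_weighted_form:
  fixes f :: "'a \<Rightarrow> real \<Rightarrow> real^'n"
  assumes f: "\<forall>\<^sub>F h in F. f h \<in> L2" and g: "g \<in> L2"
    and lim: "((\<lambda>h. L2_norm (\<lambda>z. f h z - g z)) \<longlongrightarrow> 0) F"
  shows "((\<lambda>h. ip (f h) (weighted p (f h))) \<longlongrightarrow> ip g (weighted p g)) F"
proof -
  define P where "P = Max (range (\<lambda>i. \<bar>p i\<bar>))"
  have P: "\<bar>p i\<bar> \<le> P" for i unfolding P_def by (rule Max_ge) auto
  have P0: "P \<ge> 0" using P[of undefined] by linarith
  let ?d = "\<lambda>h. L2_norm (\<lambda>z. f h z - g z)"
  have "((\<lambda>h. ip (f h) (weighted p (f h)) - ip g (weighted p g)) \<longlongrightarrow> 0) F"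
  proof (rule Lim_null_comparison)
    show "\<forall>\<^sub>F h in F. norm (ip (f h) (weighted p (f h)) - ip g (weighted p g))
        \<le> ?d h * (P * (2 * L2_norm g + ?d h))"
      using f
    proof eventually_elim
      case (elim h)
      let ?r = "\<lambda>z. f h z - g z"
      have r: "?r \<in> L2" by (intro L2_diff elim g)
      have W: "weighted p (f h) = (\<lambda>z. weighted p g z + weighted p ?r z)"
        by (auto simp: weighted_def fun_eq_iff vec_eq_iff algebra_simps)
      have s: "(\<lambda>z. weighted p g z + weighted p (f h) z) \<in> L2"
        by (intro L2_add L2_weighted elim g)
      have "ip (f h) (weighted p (f h)) - ip g (weighted p g)
          = ip ?r (\<lambda>z. weighted p g z + weighted p (f h) z)"
      proof -
        have "ip (f h) (weighted p (f h)) = ip ?r (weighted p (f h)) + ip g (weighted p (f h))"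
          using ip_add_left[OF r g L2_weighted[OF elim, of p]] by simp
        moreover have "ip (f h) (weighted p g) = ip ?r (weighted p g) + ip g (weighted p g)"
          using ip_add_left[OF r g L2_weighted[OF g, of p]] by simp
        moreover have "ip g (weighted p (f h)) = ip (f h) (weighted p g)"
          using ip_weighted_commute[of g p "f h"] ip_commute[of "weighted p g" "f h"] by simp
        ultimately show ?thesis
          using ip_add_right[OF L2_weighted[OF g, of p] L2_weighted[OF elim, of p] r] by simp
      qed
      moreover have "L2_norm (\<lambda>z. weighted p g z + weighted p (f h) z) \<le> P * (2 * L2_norm g + ?d h)"
      proof -
        have wb: "L2_norm (weighted p u) \<le> P * L2_norm u" if "u \<in> L2" for u :: "real \<Rightarrow> real^'n"
          using that P P0 by (intro L2_norm_dominated L2_weighted weighted_dominated) auto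
        have "L2_norm (f h) \<le> L2_norm g + ?d h" using L2_norm_triangle[OF g r] by simp
        then have "P * L2_norm g + P * L2_norm (f h) \<le> P * L2_norm g + P * (L2_norm g + ?d h)"
          using P0 by (intro add_mono mult_left_mono) auto
        moreover from wb have "L2_norm (weighted p g) \<le> P * L2_norm g" "L2_norm (weighted p (f h)) \<le> P * L2_norm (f h)"
          using g elim by auto
        ultimately show ?thesis
          using L2_norm_triangle[OF L2_weighted[OF g, of p] L2_weighted[OF elim, of p]]
          by (simp add: distrib_left)
      qed
      ultimately show ?case
        using ip_Cauchy_Schwarz[OF r s]
        by (simp add: L2_norm_nonneg mult_left_mono order_trans)
    qed
    have "((\<lambda>h. ?d h * (P * (2 * L2_norm g + ?d h))) \<longlongrightarrow> 0 * (P * (2 * L2_norm g + 0))) F"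
      by (intro tendsto_intros lim)
    then show "((\<lambda>h. ?d h * (P * (2 * L2_norm g + ?d h))) \<longlongrightarrow> 0) F" by simp
  qed
  then show ?thesis by (rule LIM_zero_cancel)
qed

text \<open>A shift by h \<ge> 0 maps the half line into itself, so limits at t + h within
  \<open>{0..}\<close> can be pulled back to t.\<close>

lemma filterlim_shift_within:
  assumes "0 \<le> t" "0 \<le> (h::real)"
  shows "filterlim (\<lambda>s. s + h) (at (t + h) within {0..}) (at t within {0..})"
  unfolding filterlim_at
  using assms by (auto intro!: tendsto_eq_intros simp: eventually_at_filter)

lemma filterlim_add_at_right:
  assumes "0 \<le> (t::real)"
  shows "filterlim (\<lambda>h. t + h) (at t within {0..}) (at_right 0)"
  unfolding filterlim_at
  using assms by (auto intro!: tendsto_eq_intros simp: eventually_at_filter)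

section \<open>Growth of the closed-loop energy\<close>

context
  fixes \<Lambda> H Bv M Bw Dv P3 R S :: "real^'n^'n"
    and Bu :: "real^'u^'n"
    and K1 K2 :: "real^'n^'u"
    and p :: "'n \<Rightarrow> real" and c C :: real
    and w v \<eta> :: "real \<Rightarrow> real^'n" and \<xi> :: "real \<Rightarrow> real \<Rightarrow> real^'n"
    and \<xi>0 :: "real \<Rightarrow> real^'n" and v0 \<eta>0 :: "real^'n"
  assumes \<Lambda>: "diagonal_mx \<Lambda>" "\<And>i. c \<le> \<Lambda> $ i $ i" and c: "0 < c" and C: "0 \<le> C"
    and p: "\<And>i. 0 < p i" and P3: "symmetric_mx P3"
    and dissipation: "\<And>z1 \<eta> x.
     (\<Sum>i\<in>UNIV. p i * \<Lambda> $ i $ i *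
        (((H *v z1 + Bu *v (K1 *v \<eta> + K2 *v (z1 + Dv *v x)) + Bv *v x) $ i)\<^sup>2 - exp (- 1) * (z1 $ i)\<^sup>2))
     + 2 * (\<eta> \<bullet> (P3 *v (R *v \<eta> + S *v (z1 + Dv *v x))))
     \<le> - c * (\<eta> \<bullet> (P3 *v \<eta>)) + C * (x \<bullet> x)"
    and w: "w \<in> disturbances"
    and sol: "closed_loop_solution \<Lambda> H Bu Bv M Bw Dv K1 K2 R S w \<xi>0 v0 \<eta>0 \<xi> v \<eta>"
begin

abbreviation rate :: "real \<Rightarrow> real^'n" where
  "rate t \<equiv> R *v \<eta> t + S *v (\<xi> t 1 + Dv *v v t)"

abbreviation disturbed_rhs :: "real \<Rightarrow> real^'n" where
  "disturbed_rhs s \<equiv> M *v v s + Bw *v w s"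

abbreviation velocity :: "real \<Rightarrow> real \<Rightarrow> real^'n" where
  "velocity t z \<equiv> - (\<Lambda> *v Dz (\<xi> t) z)"

lemma solution_facts:
  shows initial: "\<And>z. z \<in> {0..1} \<Longrightarrow> \<xi> 0 z = \<xi>0 z" "v 0 = v0" "\<eta> 0 = \<eta>0"
    and Dz_L2: "\<And>t. 0 \<le> t \<Longrightarrow> Dz (\<xi> t) \<in> L2"
    and Dz_primitive: "\<And>t z. 0 \<le> t \<Longrightarrow> z \<in> {0..1} \<Longrightarrow> (Dz (\<xi> t) has_integral (\<xi> t z - \<xi> t 0)) {0..z}"
    and transport: "\<And>t. 0 \<le> t \<Longrightarrow>
      ((\<lambda>s. L2_norm (\<lambda>z. (1 / (s - t)) *\<^sub>R (\<xi> s z - \<xi> t z) - velocity t z)) \<longlongrightarrow> 0) (at t within {0..})"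
    and boundary: "\<And>t. 0 \<le> t \<Longrightarrow>
      \<xi> t 0 = H *v \<xi> t 1 + Bu *v (K1 *v \<eta> t + K2 *v (\<xi> t 1 + Dv *v v t)) + Bv *v v t"
    and v_integral: "\<And>t. 0 \<le> t \<Longrightarrow> (disturbed_rhs has_integral (v t - v 0)) {0..t}"
    and \<eta>_derivative: "\<And>t. 0 \<le> t \<Longrightarrow> (\<eta> has_vector_derivative rate t) (at t within {0..})"
  using sol unfolding closed_loop_solution_def Let_def H1_def by auto

lemma \<xi>_L2: "0 \<le> t \<Longrightarrow> \<xi> t \<in> L2"
  by (rule L2_primitive[OF Dz_L2 Dz_primitive])

lemma velocity_L2: "0 \<le> t \<Longrightarrow> velocity t \<in> L2"
  by (intro L2_minus L2_matrix Dz_L2)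

lemma v_continuous: "continuous_on {0..} v"
  by (rule integral_solution_continuous[OF v_integral])

lemma weighted_energy_cmult: "integral {0..T} (\<lambda>s. exp (c * s) * (C * (f s \<bullet> f s))) = C * weighted_energy c f T"
  for f :: "real \<Rightarrow> real^'n"
  unfolding weighted_energy_def integral_mult_right[symmetric] by (simp add: mult_ac)

lemma state_energy_growth:
  assumes T: "0 \<le> T"
  shows "exp (c * T) * (ip (\<xi> T) (weighted p (\<xi> T)) + \<eta> T \<bullet> (P3 *v \<eta> T))
     \<le> ip (\<xi> 0) (weighted p (\<xi> 0)) + \<eta> 0 \<bullet> (P3 *v \<eta> 0) + C * weighted_energy c v T"
proof -
  have "exp (c * T) * (ip (\<xi> T) (weighted p (\<xi> T)) + \<eta> T \<bullet> (P3 *v \<eta> T))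
     \<le> ip (\<xi> 0) (weighted p (\<xi> 0)) + \<eta> 0 \<bullet> (P3 *v \<eta> 0)
       + integral {0..T} (\<lambda>s. exp (c * s) * (C * (v s \<bullet> v s)))"
  proof (rule lyapunov_growth[OF \<Lambda> less_imp_le[OF p] P3 Dz_L2 Dz_primitive transport \<eta>_derivative _ _ T])
    show "continuous_on {0..} (\<lambda>s. C * (v s \<bullet> v s))" by (intro continuous_intros v_continuous)
    fix t :: real assume t: "0 \<le> t"
    show "(\<Sum>i\<in>UNIV. p i * \<Lambda> $ i $ i * ((\<xi> t 0 $ i)\<^sup>2 - exp (- 1) * (\<xi> t 1 $ i)\<^sup>2)) + 2 * (\<eta> t \<bullet> (P3 *v rate t))
        \<le> - c * (\<eta> t \<bullet> (P3 *v \<eta> t)) + C * (v t \<bullet> v t)"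
      unfolding boundary[OF t] by (rule dissipation)
  qed
  then show ?thesis by (simp only: weighted_energy_cmult)
qed

text \<open>Difference quotients in time solve the same linear equations, so the \<open>L\<^sup>2\<close> estimate applies to
  them; in the limit it controls \<open>\<partial>\<^sub>t \<xi> = - \<Lambda> \<partial>\<^sub>z \<xi>\<close> although that function has no boundary traces.\<close>

lemma quotient_energy_growth:
  assumes T: "0 \<le> T" and h: "0 < h"
  defines "q\<xi> \<equiv> \<lambda>t z. (1 / h) *\<^sub>R (\<xi> (t + h) z - \<xi> t z)" and "q\<eta> \<equiv> \<lambda>t. (1 / h) *\<^sub>R (\<eta> (t + h) - \<eta> t)"
  shows "exp (c * T) * (ip (q\<xi> T) (weighted p (q\<xi> T)) + q\<eta> T \<bullet> (P3 *v q\<eta> T))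
     \<le> ip (q\<xi> 0) (weighted p (q\<xi> 0)) + q\<eta> 0 \<bullet> (P3 *v q\<eta> 0)
       + C * weighted_energy c (\<lambda>s. (1 / h) *\<^sub>R (v (s + h) - v s)) T"
proof -
  \<comment> \<open>The quotient of the z-derivatives serves as density of \<open>q\<xi>\<close>, so
    that no z-derivative of a quotient has to be computed.\<close>
  define q\<omega> where "q\<omega> t z = (1 / h) *\<^sub>R (Dz (\<xi> (t + h)) z - Dz (\<xi> t) z)" for t z
  define qv where "qv t = (1 / h) *\<^sub>R (v (t + h) - v t)" for t
  define qr where "qr t = (1 / h) *\<^sub>R (rate (t + h) - rate t)" for t
  have th: "0 \<le> t + h" if "0 \<le> t" for t using that h by simp
  have "exp (c * T) * (ip (q\<xi> T) (weighted p (q\<xi> T)) + q\<eta> T \<bullet> (P3 *v q\<eta> T))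
     \<le> ip (q\<xi> 0) (weighted p (q\<xi> 0)) + q\<eta> 0 \<bullet> (P3 *v q\<eta> 0)
       + integral {0..T} (\<lambda>s. exp (c * s) * (C * (qv s \<bullet> qv s)))"
  proof (rule lyapunov_growth[where \<omega> = q\<omega> and \<eta>' = qr, OF \<Lambda> less_imp_le[OF p] P3 _ _ _ _ _ _ T])
    fix t :: real assume t: "0 \<le> t"
    show "q\<omega> t \<in> L2" unfolding q\<omega>_def[abs_def] by (intro L2_scaleR L2_diff Dz_L2 t th)
    show "(q\<omega> t has_integral (q\<xi> t z - q\<xi> t 0)) {0..z}" if z: "z \<in> {0..1}" for z
    proof -
      have "((\<lambda>z. (1 / h) *\<^sub>R (Dz (\<xi> (t + h)) z - Dz (\<xi> t) z)) has_integral
          (1 / h) *\<^sub>R ((\<xi> (t + h) z - \<xi> (t + h) 0) - (\<xi> t z - \<xi> t 0))) {0..z}"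
        by (intro has_integral_cmul has_integral_diff Dz_primitive t th z)
      moreover have "(1 / h) *\<^sub>R ((\<xi> (t + h) z - \<xi> (t + h) 0) - (\<xi> t z - \<xi> t 0)) = q\<xi> t z - q\<xi> t 0"
        unfolding q\<xi>_def by (simp add: scaleR_diff_right)
      ultimately show ?thesis by (simp add: q\<omega>_def[abs_def])
    qed
    show "((\<lambda>s. L2_norm (\<lambda>z. (1 / (s - t)) *\<^sub>R (q\<xi> s z - q\<xi> t z) - - (\<Lambda> *v q\<omega> t z))) \<longlongrightarrow> 0) (at t within {0..})"
    proof (rule Lim_null_comparison)
      let ?D = "\<lambda>t s z. (1 / (s - t)) *\<^sub>R (\<xi> s z - \<xi> t z) - velocity t z"
      have DL: "?D t s \<in> L2" if "0 \<le> t" "0 \<le> s" for t s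
        by (intro L2_diff L2_scaleR \<xi>_L2 velocity_L2 that)
      have "\<forall>\<^sub>F s in at t within {0..}. 0 \<le> s" by (simp add: eventually_at_filter)
      then show "\<forall>\<^sub>F s in at t within {0..}.
          norm (L2_norm (\<lambda>z. (1 / (s - t)) *\<^sub>R (q\<xi> s z - q\<xi> t z) - - (\<Lambda> *v q\<omega> t z)))
          \<le> (1 / h) * (L2_norm (?D (t + h) (s + h)) + L2_norm (?D t s))"
      proof eventually_elim
        case (elim s)
        \<comment> \<open>The transport remainder of the difference quotient is the difference of
          the remainders of \<xi> at times t + h and t, divided by h.\<close>
        have "(1 / (s - t)) *\<^sub>R (q\<xi> s z - q\<xi> t z) - - (\<Lambda> *v q\<omega> t z) = (1 / h) *\<^sub>R (?D (t + h) (s + h) z - ?D t s z)" for z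
          unfolding q\<xi>_def q\<omega>_def
          by (simp add: matrix_vector_mult_scaleR matrix_vector_mult_diff_distrib scaleR_diff_right
              scaleR_add_right scaleR_scaleR mult.commute)
        then show ?case
          using L2_norm_triangle_diff[OF DL[OF th[OF t] th[OF elim]] DL[OF t elim]] h
          by (simp add: L2_norm_scaleR L2_norm_nonneg divide_right_mono)
      qed
      have "((\<lambda>s. L2_norm (?D (t + h) (s + h))) \<longlongrightarrow> 0) (at t within {0..})"
        by (rule filterlim_compose[OF transport[OF th[OF t]] filterlim_shift_within]) (use t h in auto)
      then have "((\<lambda>s. (1 / h) * (L2_norm (?D (t + h) (s + h)) + L2_norm (?D t s)))
          \<longlongrightarrow> (1 / h) * (0 + 0)) (at t within {0..})"
        by (intro tendsto_intros transport t)
      then show "((\<lambda>s. (1 / h) * (L2_norm (?D (t + h) (s + h)) + L2_norm (?D t s))) \<longlongrightarrow> 0) (at t within {0..})"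
        by simp
    qed
    show "(q\<eta> has_vector_derivative qr t) (at t within {0..})"
    proof -
      have "(\<eta> has_vector_derivative rate (t + h)) (at (t + h) within (\<lambda>s. s + h) ` {0..})"
        by (rule has_vector_derivative_within_subset[OF \<eta>_derivative[OF th[OF t]]]) (use h in auto)
      moreover have "((\<lambda>s. s + h) has_vector_derivative 1) (at t within {0..})"
        by (auto intro!: derivative_eq_intros)
      ultimately have "((\<eta> \<circ> (\<lambda>s. s + h)) has_vector_derivative 1 *\<^sub>R rate (t + h)) (at t within {0..})"
        by (intro vector_diff_chain_within)
      then have "((\<lambda>s. \<eta> (s + h)) has_vector_derivative rate (t + h)) (at t within {0..})"
        by (simp add: o_def)
      then show ?thesis
        unfolding q\<eta>_def qr_def
        using bounded_linear.has_vector_derivative[OF bounded_linear_scaleR_right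
            has_vector_derivative_diff[OF _ \<eta>_derivative[OF t]], of "\<lambda>s. \<eta> (s + h)" "rate (t + h)" "1 / h"]
        by blast
    qed
    show "(\<Sum>i\<in>UNIV. p i * \<Lambda> $ i $ i * ((q\<xi> t 0 $ i)\<^sup>2 - exp (- 1) * (q\<xi> t 1 $ i)\<^sup>2)) + 2 * (q\<eta> t \<bullet> (P3 *v qr t))
        \<le> - c * (q\<eta> t \<bullet> (P3 *v q\<eta> t)) + C * (qv t \<bullet> qv t)"
    proof -
      have e1: "q\<xi> t 0 = H *v q\<xi> t 1 + Bu *v (K1 *v q\<eta> t + K2 *v (q\<xi> t 1 + Dv *v qv t)) + Bv *v qv t"
        unfolding q\<xi>_def q\<eta>_def qv_def boundary[OF t] boundary[OF th[OF t]]
        by (simp add: matrix_vector_right_distrib matrix_vector_mult_diff_distrib matrix_vector_mult_scaleR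
            scaleR_add_right scaleR_diff_right algebra_simps)
      have e2: "qr t = R *v q\<eta> t + S *v (q\<xi> t 1 + Dv *v qv t)"
        unfolding q\<xi>_def q\<eta>_def qv_def qr_def
        by (simp add: matrix_vector_right_distrib matrix_vector_mult_diff_distrib matrix_vector_mult_scaleR
            scaleR_add_right scaleR_diff_right algebra_simps)
      show ?thesis unfolding e1 e2 by (rule dissipation)
    qed
  next
    have "continuous_on {0..} (\<lambda>t. v (t + h))"
      by (rule continuous_on_compose2[OF v_continuous, of _ "\<lambda>t. t + h"])
         (use h in \<open>auto intro!: continuous_intros\<close>)
    then have "continuous_on {0..} qv"
      unfolding qv_def[abs_def] by (intro continuous_on_scaleR continuous_on_const continuous_on_diff v_continuous)
    then show "continuous_on {0..} (\<lambda>s. C * (qv s \<bullet> qv s))"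
      by (intro continuous_on_mult continuous_on_const continuous_on_inner)
  qed
  then show ?thesis by (simp only: weighted_energy_cmult qv_def)
qed

lemma rhs_energy_integrable: "integrable (lebesgue_on {0..T}) (\<lambda>s. exp (b * s) * (disturbed_rhs s \<bullet> disturbed_rhs s))"
  by (rule disturbed_rhs_energy_integrable[OF w v_continuous])

text \<open>The transport equation gives the limit of the first summand in L2, and differentiability
  of \<eta> that of the second. Limits are taken from the right, so that T = 0 is included.\<close>

lemma quotient_energy_tendsto:
  assumes T: "0 \<le> T"
  shows "((\<lambda>h. ip (\<lambda>z. (1 / h) *\<^sub>R (\<xi> (T + h) z - \<xi> T z)) (weighted p (\<lambda>z. (1 / h) *\<^sub>R (\<xi> (T + h) z - \<xi> T z)))
      + ((1 / h) *\<^sub>R (\<eta> (T + h) - \<eta> T)) \<bullet> (P3 *v ((1 / h) *\<^sub>R (\<eta> (T + h) - \<eta> T))))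
     \<longlongrightarrow> ip (velocity T) (weighted p (velocity T)) + rate T \<bullet> (P3 *v rate T)) (at_right 0)"
proof (rule tendsto_add)
  have pos: "\<forall>\<^sub>F h in at_right 0. (0::real) < h" by (simp add: eventually_at_right_less)
  show "((\<lambda>h. ip (\<lambda>z. (1 / h) *\<^sub>R (\<xi> (T + h) z - \<xi> T z)) (weighted p (\<lambda>z. (1 / h) *\<^sub>R (\<xi> (T + h) z - \<xi> T z))))
      \<longlongrightarrow> ip (velocity T) (weighted p (velocity T))) (at_right 0)"
  proof (rule tendsto_weighted_form)
    show "\<forall>\<^sub>F h in at_right 0. (\<lambda>z. (1 / h) *\<^sub>R (\<xi> (T + h) z - \<xi> T z)) \<in> L2"
      using pos by eventually_elim (use T in \<open>intro L2_scaleR L2_diff \<xi>_L2; simp\<close>)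
    show "velocity T \<in> L2" by (rule velocity_L2[OF T])
    show "((\<lambda>h. L2_norm (\<lambda>z. (1 / h) *\<^sub>R (\<xi> (T + h) z - \<xi> T z) - velocity T z)) \<longlongrightarrow> 0) (at_right 0)"
      using filterlim_compose[OF transport[OF T] filterlim_add_at_right[OF T]] by simp
  qed
  have lim: "((\<lambda>h. (1 / h) *\<^sub>R (\<eta> (T + h) - \<eta> T)) \<longlongrightarrow> rate T) (at_right 0)"
  proof -
    have "((\<lambda>y. (1 / norm (y - T)) *\<^sub>R (\<eta> y - (\<eta> T + (y - T) *\<^sub>R rate T))) \<longlongrightarrow> 0) (at T within {0..})"
      using \<eta>_derivative[OF T] unfolding has_vector_derivative_def has_derivative_within by blast
    from filterlim_compose[OF this filterlim_add_at_right[OF T]]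
    have "((\<lambda>h. (1 / \<bar>h\<bar>) *\<^sub>R (\<eta> (T + h) - (\<eta> T + h *\<^sub>R rate T))) \<longlongrightarrow> 0) (at_right 0)" by simp
    moreover have "\<forall>\<^sub>F h in at_right 0. (1 / \<bar>h\<bar>) *\<^sub>R (\<eta> (T + h) - (\<eta> T + h *\<^sub>R rate T))
        = (1 / h) *\<^sub>R (\<eta> (T + h) - \<eta> T) - rate T"
      using pos by eventually_elim (simp add: scaleR_diff_right scaleR_add_right)
    ultimately have "((\<lambda>h. (1 / h) *\<^sub>R (\<eta> (T + h) - \<eta> T) - rate T) \<longlongrightarrow> 0) (at_right 0)"
      by (simp only: tendsto_cong)
    then show ?thesis by (rule LIM_zero_cancel)
  qed
  show "((\<lambda>h. ((1 / h) *\<^sub>R (\<eta> (T + h) - \<eta> T)) \<bullet> (P3 *v ((1 / h) *\<^sub>R (\<eta> (T + h) - \<eta> T))))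
      \<longlongrightarrow> rate T \<bullet> (P3 *v rate T)) (at_right 0)"
    by (intro tendsto_inner lim bounded_linear.tendsto[OF matrix_vector_mul_bounded_linear])
qed

text \<open>This is \<open>quotient_energy_growth\<close> as h tends to 0. Since the quotients of
  \<open>v\<close> need not converge, their energy is first replaced by that of
  \<open>disturbed_rhs\<close> on [0, T + h], which is continuous in its end point.\<close>

lemma velocity_energy_growth:
  assumes T: "0 \<le> T"
  shows "exp (c * T) * (ip (velocity T) (weighted p (velocity T)) + rate T \<bullet> (P3 *v rate T))
     \<le> ip (velocity 0) (weighted p (velocity 0)) + rate 0 \<bullet> (P3 *v rate 0)
       + C * weighted_energy c disturbed_rhs T"
proof (rule tendsto_le)
  let ?V = "\<lambda>t h. ip (\<lambda>z. (1 / h) *\<^sub>R (\<xi> (t + h) z - \<xi> t z)) (weighted p (\<lambda>z. (1 / h) *\<^sub>R (\<xi> (t + h) z - \<xi> t z)))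
      + ((1 / h) *\<^sub>R (\<eta> (t + h) - \<eta> t)) \<bullet> (P3 *v ((1 / h) *\<^sub>R (\<eta> (t + h) - \<eta> t)))"
  show "at_right (0::real) \<noteq> bot" by simp
  show "((\<lambda>h. exp (c * T) * ?V T h) \<longlongrightarrow>
      exp (c * T) * (ip (velocity T) (weighted p (velocity T)) + rate T \<bullet> (P3 *v rate T))) (at_right 0)"
    by (intro tendsto_mult tendsto_const quotient_energy_tendsto T)
  have "continuous_on {0..} (weighted_energy c disturbed_rhs)"
  proof (rule continuous_on_nonneg_if_intervals)
    fix b :: real
    show "continuous_on {0..b} (weighted_energy c disturbed_rhs)"
      unfolding weighted_energy_def[abs_def]
      by (intro indefinite_integral_continuous_1 integrable_on_lebesgue_on_interval rhs_energy_integrable)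
  qed
  then have "(weighted_energy c disturbed_rhs \<longlongrightarrow> weighted_energy c disturbed_rhs T) (at T within {0..})"
    using T by (simp add: continuous_on)
  from filterlim_compose[OF this filterlim_add_at_right[OF T]]
  have E: "((\<lambda>h. weighted_energy c disturbed_rhs (T + h)) \<longlongrightarrow> weighted_energy c disturbed_rhs T) (at_right 0)" .
  show "((\<lambda>h. ?V 0 h + C * weighted_energy c disturbed_rhs (T + h)) \<longlongrightarrow>
     ip (velocity 0) (weighted p (velocity 0)) + rate 0 \<bullet> (P3 *v rate 0)
       + C * weighted_energy c disturbed_rhs T) (at_right 0)"
    by (intro tendsto_add[OF quotient_energy_tendsto tendsto_mult[OF tendsto_const E]]) simp
  have "\<forall>\<^sub>F h in at_right 0. (0::real) < h" by (simp add: eventually_at_right_less)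
  then show "\<forall>\<^sub>F h in at_right 0. exp (c * T) * ?V T h \<le> ?V 0 h + C * weighted_energy c disturbed_rhs (T + h)"
  proof eventually_elim
    case (elim h)
    have "weighted_energy c (\<lambda>s. (1 / h) *\<^sub>R (v (s + h) - v s)) T \<le> weighted_energy c disturbed_rhs (T + h)"
      by (rule difference_quotient_energy_bound[OF v_integral rhs_energy_integrable _ less_imp_le[OF c] elim T])
         (use rhs_energy_integrable[of _ 0] in simp_all)
    then have "C * weighted_energy c (\<lambda>s. (1 / h) *\<^sub>R (v (s + h) - v s)) T \<le> C * weighted_energy c disturbed_rhs (T + h)"
      using C by (rule mult_left_mono)
    then show ?case using quotient_energy_growth[OF T elim] by linarith
  qed
qed

text \<open>The energy of \<open>v\<close> over [0, T] enters with factor \<open>C\<close> through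
  the state and with \<open>C\<close> times twice the squared operator norm of \<open>M\<close>
  through the velocity. By \<open>disturbed_energy_bound\<close> it is at most 2 / \<mu> times
  initial value plus input, whence \<open>A\<close>; the summand 1 in \<open>A\<close> pays for
  \<open>v T \<bullet> v T\<close>.\<close>

lemma total_energy_growth:
  assumes diag: "diagonal_mx M" "diagonal_mx Bw"
    and \<mu>: "0 < \<mu>" "\<And>i. M $ i $ i \<le> - \<mu>" and c\<mu>: "c \<le> \<mu>"
    and K: "\<And>i. 2 * (Bw $ i $ i)\<^sup>2 / \<mu> \<le> K"
    and T: "0 \<le> T"
  defines "V \<equiv> \<lambda>t. ip (\<xi> t) (weighted p (\<xi> t)) + \<eta> t \<bullet> (P3 *v \<eta> t)
      + (ip (velocity t) (weighted p (velocity t)) + rate t \<bullet> (P3 *v rate t))"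
  defines "A \<equiv> C * (1 + 2 * (onorm ((*v) M))\<^sup>2) * (2 / \<mu>) + 1"
  shows "exp (c * T) * (V T + v T \<bullet> v T)
     \<le> V 0 + A * (v 0 \<bullet> v 0 + K * weighted_energy c w T)
        + C * (2 * (onorm ((*v) Bw))\<^sup>2) * weighted_energy c w T"
proof -
  let ?m = "2 * (onorm ((*v) M))\<^sup>2" and ?b = "2 * (onorm ((*v) Bw))\<^sup>2"
  let ?Ev = "weighted_energy c v T" and ?Ew = "weighted_energy c w T"
  have vi: "(\<lambda>s. exp (c * s) * (v s \<bullet> v s)) integrable_on {0..T}"
    by (intro integrable_on_lebesgue_on_interval continuous_energy_integrable continuous_on_subset[OF v_continuous]) auto
  have wi: "(\<lambda>s. exp (c * s) * (w s \<bullet> w s)) integrable_on {0..T}"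
    by (intro integrable_on_lebesgue_on_interval disturbance_energy_integrable w)
  have "weighted_energy c disturbed_rhs T \<le> integral {0..T} (\<lambda>s. ?m * (exp (c * s) * (v s \<bullet> v s)) + ?b * (exp (c * s) * (w s \<bullet> w s)))"
    unfolding weighted_energy_def
  proof (rule integral_le)
    show "(\<lambda>s. exp (c * s) * (disturbed_rhs s \<bullet> disturbed_rhs s)) integrable_on {0..T}"
      by (intro integrable_on_lebesgue_on_interval rhs_energy_integrable)
    show "(\<lambda>s. ?m * (exp (c * s) * (v s \<bullet> v s)) + ?b * (exp (c * s) * (w s \<bullet> w s))) integrable_on {0..T}"
      by (intro integrable_add integrable_on_mult_right vi wi)
    fix s
    have "exp (c * s) * (disturbed_rhs s \<bullet> disturbed_rhs s) \<le> exp (c * s) * (?m * (v s \<bullet> v s) + ?b * (w s \<bullet> w s))"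
      by (intro mult_left_mono disturbed_rhs_bound) auto
    then show "exp (c * s) * (disturbed_rhs s \<bullet> disturbed_rhs s) \<le> ?m * (exp (c * s) * (v s \<bullet> v s)) + ?b * (exp (c * s) * (w s \<bullet> w s))"
      by (simp add: algebra_simps)
  qed
  also have "\<dots> = ?m * ?Ev + ?b * ?Ew"
    unfolding weighted_energy_def
    by (intro integral_unique has_integral_add has_integral_mult_right integrable_integral vi wi)
  finally have g: "C * weighted_energy c disturbed_rhs T \<le> C * (?m * ?Ev + ?b * ?Ew)"
    using C by (rule mult_left_mono)
  have E: "exp (c * T) * (v T \<bullet> v T) + \<mu> / 2 * ?Ev \<le> v 0 \<bullet> v 0 + K * ?Ew"
    by (rule disturbed_energy_bound[OF diag \<mu> c\<mu> K w v_integral T])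
  have Ev0: "0 \<le> ?Ev"
    unfolding weighted_energy_def by (rule Henstock_Kurzweil_Integration.integral_nonneg[OF vi]) simp
  have "?Ev = (2 / \<mu>) * (\<mu> / 2 * ?Ev)" using \<mu>(1) by simp
  also have "\<dots> \<le> (2 / \<mu>) * (v 0 \<bullet> v 0 + K * ?Ew)"
  proof (intro mult_left_mono)
    have "0 \<le> exp (c * T) * (v T \<bullet> v T)" by simp
    then show "\<mu> / 2 * ?Ev \<le> v 0 \<bullet> v 0 + K * ?Ew" using E by linarith
  qed (use \<mu>(1) in simp)
  finally have "C * (1 + ?m) * ?Ev \<le> C * (1 + ?m) * ((2 / \<mu>) * (v 0 \<bullet> v 0 + K * ?Ew))"
    using C by (intro mult_left_mono) auto
  moreover have "exp (c * T) * (v T \<bullet> v T) \<le> v 0 \<bullet> v 0 + K * ?Ew"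
    using E Ev0 \<mu>(1) by (smt (verit) mult_nonneg_nonneg divide_nonneg_pos)
  moreover have "exp (c * T) * V T \<le> V 0 + C * ?Ev + C * weighted_energy c disturbed_rhs T"
    using state_energy_growth[OF T] velocity_energy_growth[OF T] by (simp add: V_def distrib_left)
  ultimately show ?thesis
    using g by (simp add: A_def algebra_simps add_divide_distrib)
qed

section \<open>Comparison of the energy with the state norm\<close>

text \<open>The four summands of the constant belong to \<xi>, its z-derivative, \<open>v\<close>
  and \<eta>. The weight loses at most the factor e / pm, division by c recovers the z-derivative
  from the velocity because the entries of \<Lambda> are at least c, and 4 comes from squaring a sum
  of four norms.\<close>

lemma state_norm_le_energy:
  assumes pm: "0 < pm" "\<And>i. pm \<le> p i" and \<kappa>: "0 < \<kappa>" "\<And>x. \<kappa> * (x \<bullet> x) \<le> x \<bullet> (P3 *v x)"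
    and t: "0 \<le> t"
  defines "V \<equiv> \<lambda>t. ip (\<xi> t) (weighted p (\<xi> t)) + \<eta> t \<bullet> (P3 *v \<eta> t)
      + (ip (velocity t) (weighted p (velocity t)) + rate t \<bullet> (P3 *v rate t))"
  shows "(X_norm (\<xi> t) (v t) (\<eta> t))\<^sup>2
    \<le> 4 * (exp 1 / pm + exp 1 / pm / c\<^sup>2 + 1 + 1 / \<kappa>) * (V t + v t \<bullet> v t)"
proof -
  let ?a = "ip (\<xi> t) (weighted p (\<xi> t))" and ?b = "ip (velocity t) (weighted p (velocity t))"
  have low: "ip f f \<le> exp 1 / pm * ip f (weighted p f)" if "f \<in> L2" for f :: "real \<Rightarrow> real^'n"
    using weighted_form_ge[OF that less_imp_le[OF pm(1)] pm(2)] pm(1)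
    by (simp add: exp_minus field_simps)
  have a: "(L2_norm (\<xi> t))\<^sup>2 \<le> exp 1 / pm * ?a"
    using low[OF \<xi>_L2[OF t]] by (simp add: L2_norm_power2 \<xi>_L2 t)
  have "norm (Dz (\<xi> t) z) \<le> (1 / c) * norm (velocity t z)" for z
  proof -
    have "norm (c *\<^sub>R Dz (\<xi> t) z) \<le> norm (\<Lambda> *v Dz (\<xi> t) z)"
    proof (rule norm_le_componentwise_cart)
      fix i
      have "\<bar>c\<bar> \<le> \<bar>\<Lambda> $ i $ i\<bar>" using \<Lambda>(2)[of i] c by simp
      then show "norm ((c *\<^sub>R Dz (\<xi> t) z) $ i) \<le> norm ((\<Lambda> *v Dz (\<xi> t) z) $ i)"
        by (simp add: diagonal_mx_vector_mult[OF \<Lambda>(1)] abs_mult mult_right_mono)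
    qed
    then show ?thesis using c by (simp add: field_simps)
  qed
  then have "ip (Dz (\<xi> t)) (Dz (\<xi> t)) \<le> (1 / c)\<^sup>2 * ip (velocity t) (velocity t)"
    using c by (intro ip_self_dominated Dz_L2 velocity_L2 t) auto
  also have "\<dots> \<le> (1 / c)\<^sup>2 * (exp 1 / pm * ?b)"
    by (intro mult_left_mono low velocity_L2 t) auto
  finally have b: "(L2_norm (Dz (\<xi> t)))\<^sup>2 \<le> exp 1 / pm / c\<^sup>2 * ?b"
    by (simp add: L2_norm_power2 Dz_L2 t power_divide mult.commute)
  have d: "(norm (\<eta> t))\<^sup>2 \<le> 1 / \<kappa> * (\<eta> t \<bullet> (P3 *v \<eta> t))"
    using \<kappa>(2)[of "\<eta> t"] \<kappa>(1) by (simp add: dot_square_norm field_simps)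
  have sq: "(x + y + z + u)\<^sup>2 \<le> 4 * (x\<^sup>2 + y\<^sup>2 + z\<^sup>2 + u\<^sup>2)" for x y z u :: real
  proof -
    have "0 \<le> (x - y)\<^sup>2 + (x - z)\<^sup>2 + (x - u)\<^sup>2 + (y - z)\<^sup>2 + (y - u)\<^sup>2 + (z - u)\<^sup>2" by simp
    then show ?thesis by (simp add: power2_eq_square algebra_simps)
  qed
  have nn: "0 \<le> ?a" "0 \<le> ?b" "0 \<le> \<eta> t \<bullet> (P3 *v \<eta> t)" "0 \<le> rate t \<bullet> (P3 *v rate t)" "0 \<le> v t \<bullet> v t"
    using order_trans[OF zero_le_power2 a] order_trans[OF ip_self_nonneg low[OF velocity_L2[OF t]]] pm(1)
      order_trans[OF mult_nonneg_nonneg[OF less_imp_le[OF \<kappa>(1)] inner_ge_zero] \<kappa>(2)]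
    by (auto simp: zero_le_divide_iff zero_le_mult_iff)
  let ?s = "V t + v t \<bullet> v t"
  have le: "?a \<le> ?s" "?b \<le> ?s" "\<eta> t \<bullet> (P3 *v \<eta> t) \<le> ?s" "v t \<bullet> v t \<le> ?s"
    using nn by (auto simp: V_def)
  have "(X_norm (\<xi> t) (v t) (\<eta> t))\<^sup>2 \<le> 4 * ((L2_norm (\<xi> t))\<^sup>2 + (L2_norm (Dz (\<xi> t)))\<^sup>2 + (norm (v t))\<^sup>2 + (norm (\<eta> t))\<^sup>2)"
    unfolding X_norm_def by (rule sq)
  also have "\<dots> \<le> 4 * (exp 1 / pm * ?s + exp 1 / pm / c\<^sup>2 * ?s + ?s + 1 / \<kappa> * ?s)"
  proof (intro mult_left_mono add_mono)
    show "(L2_norm (\<xi> t))\<^sup>2 \<le> exp 1 / pm * ?s"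
      using pm(1) by (intro order_trans[OF a] mult_left_mono le) auto
    show "(L2_norm (Dz (\<xi> t)))\<^sup>2 \<le> exp 1 / pm / c\<^sup>2 * ?s"
      using pm(1) by (intro order_trans[OF b] mult_left_mono le) auto
    show "(norm (v t))\<^sup>2 \<le> ?s" using le(4) by (simp add: dot_square_norm)
    show "(norm (\<eta> t))\<^sup>2 \<le> 1 / \<kappa> * ?s"
      using \<kappa>(1) by (intro order_trans[OF d] mult_left_mono le) auto
  qed simp
  finally show ?thesis by (simp add: algebra_simps add_divide_distrib)
qed

lemma initial_X_norm: "X_norm (\<xi> 0) (v 0) (\<eta> 0) = X_norm \<xi>0 v0 \<eta>0"
proof -
  have "L2_norm (\<xi> 0) = L2_norm \<xi>0" by (rule L2_norm_cong) (rule initial(1))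
  moreover have "L2_norm (Dz (\<xi> 0)) = L2_norm (Dz \<xi>0)"
    by (rule L2_norm_cong, rule Dz_cong) (use initial(1) in auto)
  ultimately show ?thesis by (simp add: X_norm_def initial)
qed

text \<open>The delicate term is the rate of \<eta>: it contains the point value
  \<open>\<xi> 0 1\<close>, which \<open>trace_bound\<close> controls. \<open>N\<close> is the
  resulting bound of the initial rate relative to the state norm.\<close>

lemma energy_le_state_norm:
  assumes pM: "\<And>i. p i \<le> pM" and \<kappa>: "0 \<le> \<kappa>" "\<And>x. x \<bullet> (P3 *v x) \<le> \<kappa> * (x \<bullet> x)"
  defines "V \<equiv> \<lambda>t. ip (\<xi> t) (weighted p (\<xi> t)) + \<eta> t \<bullet> (P3 *v \<eta> t)
      + (ip (velocity t) (weighted p (velocity t)) + rate t \<bullet> (P3 *v rate t))"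
  defines "N \<equiv> onorm ((*v) R) + onorm ((*v) S) * (2 + onorm ((*v) Dv))"
  shows "V 0 \<le> (pM + \<kappa> + pM * (onorm ((*v) \<Lambda>))\<^sup>2 + \<kappa> * N\<^sup>2) * (X_norm \<xi>0 v0 \<eta>0)\<^sup>2"
proof -
  define X where "X = X_norm (\<xi> 0) (v 0) (\<eta> 0)"
  have P: "\<bar>p i\<bar> \<le> pM" for i using pM[of i] p[of i] by simp
  have pM0: "0 \<le> pM" using P[of undefined] by linarith
  have X: "L2_norm (\<xi> 0) \<le> X" "L2_norm (Dz (\<xi> 0)) \<le> X" "norm (v 0) \<le> X" "norm (\<eta> 0) \<le> X" "0 \<le> X"
    by (auto simp: X_def X_norm_def L2_norm_nonneg add_increasing add_increasing2)
  have sq: "a\<^sup>2 \<le> X\<^sup>2" if "0 \<le> a" "a \<le> X" for a using that by (rule power_mono[rotated])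
  have 1: "ip (\<xi> 0) (weighted p (\<xi> 0)) \<le> pM * X\<^sup>2"
    using weighted_form_le[where p = p, OF \<xi>_L2[of 0] P] L2_norm_power2[OF \<xi>_L2[of 0]]
      mult_left_mono[OF sq[OF L2_norm_nonneg X(1)] pM0] by simp
  have 2: "\<eta> 0 \<bullet> (P3 *v \<eta> 0) \<le> \<kappa> * X\<^sup>2"
    using \<kappa>(2)[of "\<eta> 0"] mult_left_mono[OF sq[OF norm_ge_zero X(4)] \<kappa>(1)] by (simp add: dot_square_norm)
  have 3: "ip (velocity 0) (weighted p (velocity 0)) \<le> pM * (onorm ((*v) \<Lambda>))\<^sup>2 * X\<^sup>2"
  proof -
    have "ip (velocity 0) (velocity 0) \<le> (onorm ((*v) \<Lambda>))\<^sup>2 * ip (Dz (\<xi> 0)) (Dz (\<xi> 0))"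
      by (rule ip_self_dominated[OF velocity_L2 Dz_L2]) (auto intro!: onorm onorm_pos_le)
    also have "\<dots> \<le> (onorm ((*v) \<Lambda>))\<^sup>2 * X\<^sup>2"
      using mult_left_mono[OF sq[OF L2_norm_nonneg X(2)]] L2_norm_power2[OF Dz_L2[of 0]] by simp
    finally have "pM * ip (velocity 0) (velocity 0) \<le> pM * ((onorm ((*v) \<Lambda>))\<^sup>2 * X\<^sup>2)"
      using pM0 by (rule mult_left_mono)
    then show ?thesis using weighted_form_le[where p = p, OF velocity_L2[of 0] P] by simp
  qed
  have 4: "rate 0 \<bullet> (P3 *v rate 0) \<le> \<kappa> * N\<^sup>2 * X\<^sup>2"
  proof -
    have "\<xi> 0 1 \<bullet> \<xi> 0 1 \<le> 2 * (L2_norm (\<xi> 0))\<^sup>2 + (L2_norm (Dz (\<xi> 0)))\<^sup>2"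
      using trace_bound[OF Dz_L2[of 0] Dz_primitive[of 0]] by (simp add: L2_norm_power2 \<xi>_L2 Dz_L2)
    also have "\<dots> \<le> 3 * X\<^sup>2"
      using sq[OF L2_norm_nonneg X(1)] sq[OF L2_norm_nonneg X(2)] by linarith
    \<comment> \<open>The factor sqrt 3 of the trace bound is rounded up to 2, which is the 2 inside
      \<open>N\<close>.\<close>
    also have "\<dots> \<le> (2 * X)\<^sup>2" by (simp add: power_mult_distrib)
    finally have "(norm (\<xi> 0 1))\<^sup>2 \<le> (2 * X)\<^sup>2" unfolding dot_square_norm .
    then have x1: "norm (\<xi> 0 1) \<le> 2 * X" by (rule power2_le_imp_le) (use X(5) in simp)
    have on: "norm (A *v x) \<le> onorm ((*v) A) * norm x" "0 \<le> onorm ((*v) A)" for A :: "real^'n^'n" and x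
      by (auto intro!: onorm onorm_pos_le)
    have "norm (rate 0) \<le> norm (R *v \<eta> 0) + norm (S *v (\<xi> 0 1 + Dv *v v 0))" by (rule norm_triangle_ineq)
    also have "\<dots> \<le> onorm ((*v) R) * norm (\<eta> 0) + onorm ((*v) S) * norm (\<xi> 0 1 + Dv *v v 0)"
      by (intro add_mono on)
    also have "\<dots> \<le> onorm ((*v) R) * X + onorm ((*v) S) * (2 * X + onorm ((*v) Dv) * X)"
    proof (intro add_mono mult_left_mono on X)
      have "norm (\<xi> 0 1 + Dv *v v 0) \<le> norm (\<xi> 0 1) + norm (Dv *v v 0)" by (rule norm_triangle_ineq)
      also have "\<dots> \<le> 2 * X + onorm ((*v) Dv) * X"
        by (intro add_mono x1 order_trans[OF on(1)] mult_left_mono on(2) X(3))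
      finally show "norm (\<xi> 0 1 + Dv *v v 0) \<le> 2 * X + onorm ((*v) Dv) * X" .
    qed
    also have "\<dots> = N * X" by (simp add: N_def algebra_simps)
    finally have "(norm (rate 0))\<^sup>2 \<le> (N * X)\<^sup>2" by (intro power_mono) auto
    then have "\<kappa> * (rate 0 \<bullet> rate 0) \<le> \<kappa> * (N * X)\<^sup>2"
      unfolding dot_square_norm by (intro mult_left_mono \<kappa>(1))
    then show ?thesis using \<kappa>(2)[of "rate 0"] by (simp add: power_mult_distrib)
  qed
  show ?thesis
    using 1 2 3 4 unfolding initial_X_norm[symmetric] X_def[symmetric] V_def by (simp add: algebra_simps)
qed

end

section \<open>Uniform exponential estimate and the size of its input term\<close>

text \<open>Chains the growth of the total energy with the two comparisons between energy and state
  norm. \<open>N\<close> is fixed before the disturbance and the solution, as the uniform constants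
  of ISS require.\<close>

lemma exponential_energy_bound:
  fixes \<Lambda> H Bv M Bw Dv P3 R S :: "real^'n^'n" and Bu :: "real^'u^'n" and K1 K2 :: "real^'n^'u"
    and p :: "'n \<Rightarrow> real"
  assumes \<Lambda>: "diagonal_mx \<Lambda>" "\<And>i. c \<le> \<Lambda> $ i $ i" and c: "0 < c" and C: "0 \<le> C"
    and p: "\<And>i. 0 < p i" and P3: "symmetric_mx P3" "\<And>x. x \<noteq> 0 \<Longrightarrow> 0 < x \<bullet> (P3 *v x)"
    and dissipation: "\<And>z1 \<eta> x.
     (\<Sum>i\<in>UNIV. p i * \<Lambda> $ i $ i *
        (((H *v z1 + Bu *v (K1 *v \<eta> + K2 *v (z1 + Dv *v x)) + Bv *v x) $ i)\<^sup>2 - exp (- 1) * (z1 $ i)\<^sup>2))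
     + 2 * (\<eta> \<bullet> (P3 *v (R *v \<eta> + S *v (z1 + Dv *v x))))
     \<le> - c * (\<eta> \<bullet> (P3 *v \<eta>)) + C * (x \<bullet> x)"
    and diag: "diagonal_mx M" "diagonal_mx Bw"
    and \<mu>: "0 < \<mu>" "\<And>i. M $ i $ i \<le> - \<mu>" and c\<mu>: "c \<le> \<mu>"
  obtains N where "0 < N"
    "\<And>w \<xi>0 v0 \<eta>0 \<xi> v \<eta> t. w \<in> disturbances \<Longrightarrow>
      closed_loop_solution \<Lambda> H Bu Bv M Bw Dv K1 K2 R S w \<xi>0 v0 \<eta>0 \<xi> v \<eta> \<Longrightarrow> 0 \<le> t \<Longrightarrow>
      (X_norm (\<xi> t) (v t) (\<eta> t))\<^sup>2
        \<le> N * (exp (- c * t) * (X_norm \<xi>0 v0 \<eta>0)\<^sup>2 + exp (- c * t) * weighted_energy c w t)"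
proof -
  define pm where "pm = Min (range p)"
  define pM where "pM = Max (range p)"
  have pm: "0 < pm" "pm \<le> p i" for i using p by (auto simp: pm_def)
  have pM: "p i \<le> pM" for i by (simp add: pM_def)
  have pM0: "0 \<le> pM" using pM[of undefined] p[of undefined] by linarith
  obtain \<kappa> where \<kappa>: "0 < \<kappa>" "\<And>x. \<kappa> * (x \<bullet> x) \<le> x \<bullet> (P3 *v x)"
  proof -
    have "continuous_on UNIV (\<lambda>x. - (x \<bullet> (P3 *v x)))"
      by (intro continuous_on_minus continuous_on_inner continuous_on_id
          bounded_linear.continuous_on[OF matrix_vector_mul_bounded_linear])
    moreover have "- ((b *\<^sub>R x) \<bullet> (P3 *v (b *\<^sub>R x))) = b\<^sup>2 * - (x \<bullet> (P3 *v x))" for b x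
      by (simp add: matrix_vector_mult_scaleR power2_eq_square)
    moreover have "- (x \<bullet> (P3 *v x)) < 0" if "x \<noteq> 0" for x using P3(2)[OF that] by simp
    ultimately obtain e where "0 < e" "\<And>x. - (x \<bullet> (P3 *v x)) \<le> - e * (norm x)\<^sup>2"
      by (rule quadratic_neg_definite_bound[of "\<lambda>x. - (x \<bullet> (P3 *v x))"]) blast+
    then show ?thesis by (intro that[of e]) (auto simp: dot_square_norm)
  qed
  have \<kappa>': "x \<bullet> (P3 *v x) \<le> onorm ((*v) P3) * (x \<bullet> x)" for x
  proof -
    have "norm x * norm (P3 *v x) \<le> norm x * (onorm ((*v) P3) * norm x)"
      by (intro mult_left_mono onorm) auto
    then show ?thesis
      using norm_cauchy_schwarz[of x "P3 *v x"] by (simp add: dot_square_norm power2_eq_square mult_ac)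
  qed
  have on0: "0 \<le> onorm ((*v) A)" for A :: "real^'n^'n" by (intro onorm_pos_le) simp
  define K where "K = Max (range (\<lambda>i. 2 * (Bw $ i $ i)\<^sup>2 / \<mu>))"
  have K: "2 * (Bw $ i $ i)\<^sup>2 / \<mu> \<le> K" for i
    unfolding K_def by (rule Max_ge) auto
  have K0: "0 \<le> K" using K[of undefined] \<mu>(1) by (meson order_trans divide_nonneg_pos mult_nonneg_nonneg zero_le_numeral zero_le_power2)
  define A where "A = C * (1 + 2 * (onorm ((*v) M))\<^sup>2) * (2 / \<mu>) + 1"
  have A0: "0 \<le> A" using C \<mu>(1) by (simp add: A_def)
  define b where "b = C * (2 * (onorm ((*v) Bw))\<^sup>2)"
  have b0: "0 \<le> b" using C by (simp add: b_def)
  define N1 where "N1 = 4 * (exp 1 / pm + exp 1 / pm / c\<^sup>2 + 1 + 1 / \<kappa>)"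
  have N1: "0 \<le> N1" using pm(1) \<kappa>(1) by (simp add: N1_def)
  define r where "r = onorm ((*v) R) + onorm ((*v) S) * (2 + onorm ((*v) Dv))"
  define N2 where "N2 = pM + onorm ((*v) P3) + pM * (onorm ((*v) \<Lambda>))\<^sup>2 + onorm ((*v) P3) * r\<^sup>2"
  have N2: "0 \<le> N2" using pM0 on0 by (simp add: N2_def)
  \<comment> \<open>The added 1 makes \<open>N\<close> positive once the other constants are known
    to be nonnegative.\<close>
  define N where "N = N1 * (N2 + A + A * K + b) + 1"
  show ?thesis
  proof (rule that)
    have "0 \<le> N1 * (N2 + A + A * K + b)" using N1 N2 A0 K0 b0 by (intro mult_nonneg_nonneg add_nonneg_nonneg)
    then show "0 < N" by (simp add: N_def)
    fix w :: "real \<Rightarrow> real^'n" and \<xi>0 :: "real \<Rightarrow> real^'n" and v0 \<eta>0 :: "real^'n"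
      and \<xi> :: "real \<Rightarrow> real \<Rightarrow> real^'n" and v \<eta> :: "real \<Rightarrow> real^'n" and t :: real
    assume w: "w \<in> disturbances"
      and sol: "closed_loop_solution \<Lambda> H Bu Bv M Bw Dv K1 K2 R S w \<xi>0 v0 \<eta>0 \<xi> v \<eta>" and t: "0 \<le> t"
    note ctx = \<Lambda> c C p P3(1) dissipation w sol
    let ?X = "X_norm (\<xi> t) (v t) (\<eta> t)" and ?I = "X_norm \<xi>0 v0 \<eta>0" and ?E = "weighted_energy c w t"
    define V where "V t = ip (\<xi> t) (weighted p (\<xi> t)) + \<eta> t \<bullet> (P3 *v \<eta> t)
      + (ip (\<lambda>z. - (\<Lambda> *v Dz (\<xi> t) z)) (weighted p (\<lambda>z. - (\<Lambda> *v Dz (\<xi> t) z)))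
      + (R *v \<eta> t + S *v (\<xi> t 1 + Dv *v v t)) \<bullet> (P3 *v (R *v \<eta> t + S *v (\<xi> t 1 + Dv *v v t))))" for t
    have 1: "exp (c * t) * (V t + v t \<bullet> v t) \<le> V 0 + A * (v 0 \<bullet> v 0 + K * ?E) + b * ?E"
      unfolding V_def A_def b_def by (rule total_energy_growth[OF ctx diag \<mu> c\<mu> K t])
    have 2: "?X\<^sup>2 \<le> N1 * (V t + v t \<bullet> v t)"
      unfolding V_def N1_def by (rule state_norm_le_energy[OF ctx pm \<kappa> t])
    have 3: "V 0 \<le> N2 * ?I\<^sup>2"
      unfolding V_def N2_def r_def by (rule energy_le_state_norm[OF ctx pM on0 \<kappa>'])
    have E0: "0 \<le> ?E"
      unfolding weighted_energy_def
      by (intro Henstock_Kurzweil_Integration.integral_nonneg integrable_on_lebesgue_on_interval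
          disturbance_energy_integrable w) simp
    have "v 0 = v0" using sol by (simp add: closed_loop_solution_def Let_def)
    moreover have "norm v0 \<le> ?I" by (simp add: X_norm_def L2_norm_nonneg add_increasing add_increasing2)
    ultimately have v0: "v 0 \<bullet> v 0 \<le> ?I\<^sup>2" by (simp add: dot_square_norm power_mono)
    have "V 0 + A * (v 0 \<bullet> v 0 + K * ?E) + b * ?E \<le> N2 * ?I\<^sup>2 + A * (?I\<^sup>2 + K * ?E) + b * ?E"
      using 3 mult_left_mono[OF v0 A0] by (simp add: distrib_left)
    also have "\<dots> = N2 * ?I\<^sup>2 + A * ?I\<^sup>2 + A * K * ?E + b * ?E" by (simp add: algebra_simps)
    also have "\<dots> \<le> (N2 + A + A * K + b) * (?I\<^sup>2 + ?E)"
      using N2 A0 b0 mult_nonneg_nonneg[OF A0 K0] E0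
        mult_nonneg_nonneg[OF N2 E0] mult_nonneg_nonneg[OF A0 E0]
        mult_nonneg_nonneg[OF mult_nonneg_nonneg[OF A0 K0] zero_le_power2[of ?I]]
        mult_nonneg_nonneg[OF b0 zero_le_power2[of ?I]]
      by (simp add: distrib_left distrib_right)
    finally have "exp (c * t) * (V t + v t \<bullet> v t) \<le> (N2 + A + A * K + b) * (?I\<^sup>2 + ?E)"
      using 1 by linarith
    then have "exp (- c * t) * (exp (c * t) * (V t + v t \<bullet> v t)) \<le> exp (- c * t) * ((N2 + A + A * K + b) * (?I\<^sup>2 + ?E))"
      by (intro mult_left_mono) auto
    then have "V t + v t \<bullet> v t \<le> exp (- c * t) * ((N2 + A + A * K + b) * (?I\<^sup>2 + ?E))"
      by (simp add: mult.assoc[symmetric] exp_add[symmetric])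
    then have "N1 * (V t + v t \<bullet> v t) \<le> N1 * (exp (- c * t) * ((N2 + A + A * K + b) * (?I\<^sup>2 + ?E)))"
      using N1 by (rule mult_left_mono)
    also have "\<dots> = (N - 1) * (exp (- c * t) * ?I\<^sup>2 + exp (- c * t) * ?E)"
      by (simp add: N_def algebra_simps)
    also have "\<dots> \<le> N * (exp (- c * t) * ?I\<^sup>2 + exp (- c * t) * ?E)"
      using E0 by (intro mult_right_mono add_nonneg_nonneg mult_nonneg_nonneg) auto
    finally show "?X\<^sup>2 \<le> N * (exp (- c * t) * ?I\<^sup>2 + exp (- c * t) * ?E)" using 2 by linarith
  qed
qed

text \<open>Bound |w|^2 by its supremum; e^(-c t) times the integral of e^(c r) over [0, t] is at
  most 1 / c.\<close>

lemma disturbance_energy_le_signal_norm: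
  assumes w: "w \<in> disturbances" and c: "0 < c" and t: "0 \<le> t"
  shows "exp (- c * t) * weighted_energy c w t \<le> (signal_norm w)\<^sup>2 / c"
proof -
  define s where "s = (SUP t\<in>{0..}. w t \<bullet> w t)"
  have bdd: "bdd_above ((\<lambda>t. w t \<bullet> w t) ` {0..})"
    using w by (intro bdd_aboveI2[of _ _ 1]) (auto simp: disturbances_def)
  have ws: "w r \<bullet> w r \<le> s" if "0 \<le> r" for r
    unfolding s_def by (rule cSUP_upper2[OF bdd, of r]) (use that in auto)
  have s0: "0 \<le> s" using ws[of 0] inner_ge_zero[of "w 0"] by linarith
  have sn: "(signal_norm w)\<^sup>2 = s" using s0 by (simp add: signal_norm_def s_def)
  have pe: "is_primitive 0 t (\<lambda>r. exp (c * r) * (s / c)) (\<lambda>r. exp (c * r) * s)"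
    by (rule is_primitive_of_derivative) (use c in \<open>auto intro!: derivative_eq_intros continuous_intros\<close>)
  have "weighted_energy c w t \<le> integral {0..t} (\<lambda>r. exp (c * r) * s)"
    unfolding weighted_energy_def
    by (intro integral_le integrable_on_lebesgue_on_interval disturbance_energy_integrable w
        integrable_continuous_real continuous_intros mult_left_mono ws) auto
  also have "\<dots> = exp (c * t) * (s / c) - s / c"
    using pe t by (auto simp: is_primitive_def dest!: bspec[of _ _ t] integral_unique)
  also have "\<dots> \<le> exp (c * t) * (s / c)" using s0 c by simp
  finally have "exp (- c * t) * weighted_energy c w t \<le> exp (- c * t) * (exp (c * t) * (s / c))"
    by (intro mult_left_mono) auto
  also have "\<dots> = s / c" by (simp add: mult.assoc[symmetric] exp_add[symmetric])
  finally show ?thesis by (simp add: sn)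
qed

text \<open>Split the integral at T: the part before T is damped by e^(-c t), and the part after T
  is at most the tail \<open>L - \<Psi> T\<close> of the unweighted energy of \<open>w\<close>,
  which is small for large T.\<close>

lemma disturbance_energy_tendsto_0:
  fixes w :: "real \<Rightarrow> real^'n"
  assumes w: "w \<in> disturbances" and c: "0 < c"
  shows "((\<lambda>t. exp (- c * t) * weighted_energy c w t) \<longlongrightarrow> 0) at_top"
proof -
  define \<Psi> where "\<Psi> t = integral {0..t} (\<lambda>s. w s \<bullet> w s)" for t
  have "(\<lambda>s. w s \<bullet> w s) integrable_on {0<..}"
    using w by (intro integrable_on_lebesgue_on) (auto simp: disturbances_def)
  then have int: "(\<lambda>s. w s \<bullet> w s) integrable_on {0..}"
    by (rule integrable_spike_set) (auto intro: negligible_subset[of "{0}"])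
  \<comment> \<open>Exponent 0 in \<open>disturbance_energy_integrable\<close> yields the unweighted
    case.\<close>
  have sub: "(\<lambda>s. w s \<bullet> w s) integrable_on {a..b}" if "0 \<le> a" for a b
    using integrable_on_if_lebesgue_on(2)[OF disturbance_energy_integrable[OF w, of b 0], of a b] that by simp
  have subE: "(\<lambda>s. exp (c * s) * (w s \<bullet> w s)) integrable_on {a..b}" if "0 \<le> a" for a b
    using integrable_on_if_lebesgue_on(2)[OF disturbance_energy_integrable[OF w, of b c], of a b] that by simp
  have bdd: "bdd_above (\<Psi> ` {0..})"
  proof (rule bdd_aboveI2)
    fix t :: real assume "t \<in> {0..}"
    then show "\<Psi> t \<le> integral {0..} (\<lambda>s. w s \<bullet> w s)"
      unfolding \<Psi>_def by (intro integral_subset_le sub int) auto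
  qed
  define L where "L = (SUP t\<in>{0..}. \<Psi> t)"
  have \<Psi>L: "\<Psi> t \<le> L" if "0 \<le> t" for t
    unfolding L_def by (rule cSUP_upper2[OF bdd, of t]) (use that in auto)
  have E0: "0 \<le> weighted_energy c w t" for t
    unfolding weighted_energy_def by (rule Henstock_Kurzweil_Integration.integral_nonneg[OF subE]) auto
  have split: "exp (- c * t) * weighted_energy c w t \<le> exp (- c * t) * weighted_energy c w T + (L - \<Psi> T)"
    if T: "0 \<le> T" "T \<le> t" for T t
  proof -
    have "weighted_energy c w t = weighted_energy c w T + integral {T..t} (\<lambda>s. exp (c * s) * (w s \<bullet> w s))"
      unfolding weighted_energy_def
      by (rule Henstock_Kurzweil_Integration.integral_combine[symmetric]) (use T subE in auto)
    also have "integral {T..t} (\<lambda>s. exp (c * s) * (w s \<bullet> w s)) \<le> integral {T..t} (\<lambda>s. exp (c * t) * (w s \<bullet> w s))"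
    proof (rule integral_le[OF subE[OF T(1)]])
      show "(\<lambda>s. exp (c * t) * (w s \<bullet> w s)) integrable_on {T..t}"
        using integrable_on_mult_right[OF sub[OF T(1)]] by simp
      show "exp (c * s) * (w s \<bullet> w s) \<le> exp (c * t) * (w s \<bullet> w s)" if "s \<in> {T..t}" for s
        using that c by (intro mult_right_mono) auto
    qed
    also have "\<dots> = exp (c * t) * (\<Psi> t - \<Psi> T)"
    proof -
      have "\<Psi> T + integral {T..t} (\<lambda>s. w s \<bullet> w s) = \<Psi> t"
        unfolding \<Psi>_def by (rule Henstock_Kurzweil_Integration.integral_combine) (use T sub in auto)
      then show ?thesis by (simp flip: \<open>_ = \<Psi> t\<close>)
    qed
    also have "\<dots> \<le> exp (c * t) * (L - \<Psi> T)" using \<Psi>L[of t] T by (intro mult_left_mono) auto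
    finally have "exp (- c * t) * weighted_energy c w t \<le> exp (- c * t) * (weighted_energy c w T + exp (c * t) * (L - \<Psi> T))"
      by (intro mult_left_mono) auto
    also have "\<dots> = exp (- c * t) * weighted_energy c w T + (L - \<Psi> T)"
      by (simp add: distrib_left mult.assoc[symmetric] exp_add[symmetric])
    finally show ?thesis .
  qed
  show ?thesis
  proof (rule order_tendstoI)
    fix a :: real assume "a < 0"
    then have "a < exp (- c * t) * weighted_energy c w t" for t
      using mult_nonneg_nonneg[OF less_imp_le[OF exp_gt_zero[of "- c * t"]] E0[of t]] by linarith
    then show "\<forall>\<^sub>F t in at_top. a < exp (- c * t) * weighted_energy c w t" by simp
  next
    fix e :: real assume e: "0 < e"
    then obtain T where T: "0 \<le> T" "L - e / 2 < \<Psi> T"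
      using less_cSUP_iff[OF _ bdd, of "L - e / 2"] by (auto simp: L_def)
    have "((\<lambda>t. exp (- c * t) * weighted_energy c w T) \<longlongrightarrow> 0 * weighted_energy c w T) at_top"
      by (intro tendsto_mult tendsto_const filterlim_compose[OF exp_at_bot]
          filterlim_tendsto_neg_mult_at_bot[OF tendsto_const _ filterlim_ident]) (use c in auto)
    then have "\<forall>\<^sub>F t in at_top. exp (- c * t) * weighted_energy c w T < e / 2"
      using e by (intro order_tendstoD(2)) auto
    then show "\<forall>\<^sub>F t in at_top. exp (- c * t) * weighted_energy c w t < e"
      using eventually_ge_at_top[of T]
      by eventually_elim (use split[OF T(1)] T(2) in fastforce)
  qed
qed

section \<open>The origin lies in the sublevel set; conclusion\<close>

lemma Dz_zero: "z \<in> {0..1} \<Longrightarrow> Dz (\<lambda>_. 0 :: real^'n) z = 0"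
  unfolding Dz_def by (rule vector_derivative_within_cbox[of 0 1, simplified]) auto

text \<open>Membership asks that the second component be \<open>Dz\<close> of the first as a
  function on the whole line, while \<open>Dz\<close> of 0 is shown to vanish on [0, 1] alone; hence
  the point is written with \<open>Dz (\<lambda>_. 0)\<close> rather than with 0.\<close>

lemma zero_in_sublevel_set:
  fixes P1 P2 :: "real^'n^'n"
  shows "((\<lambda>_. 0), Dz (\<lambda>_. 0), 0, 0) \<in> sublevel_set P1 P2 P3 P4"
proof -
  have z: "(\<lambda>_. 0) \<in> (L2 :: (real \<Rightarrow> real^'n) set)" by (rule L2_continuous) simp
  then have DL: "Dz (\<lambda>_. 0) \<in> (L2 :: (real \<Rightarrow> real^'n) set)" by (rule L2_cong) (simp add: Dz_zero)
  moreover have "(Dz (\<lambda>_. 0) has_integral (0 :: real^'n)) {0..z}" if "z \<in> {0..1}" for z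
    by (rule has_integral_eq[OF _ has_integral_0]) (use that in \<open>auto simp: Dz_zero\<close>)
  moreover have "integral {0..1} (\<lambda>z. exp (- z) * (Dz (\<lambda>_. 0) z \<bullet> (P2 *v Dz (\<lambda>_. 0) z))) = 0"
    by (rule integral_unique, rule has_integral_eq[OF _ has_integral_0]) (simp add: Dz_zero)
  ultimately show ?thesis using z
    by (simp add: sublevel_set_def H1_def lyapunov_V_def)
qed

theorem theorem2:
  fixes \<Lambda> H Bv M Bw Dv :: "real^'n^'n"
    and Bu :: "real^'u^'n"
    and Q1 Q2 G P3 Pp Rp Sp Lp :: "real^'n^'n"
    and K1 Kp :: "real^'n^'u"
    and lam \<alpha> \<beta> :: real
  assumes "diagonal_mx \<Lambda>" and "pos_def_mx \<Lambda>"
    and "hurwitz_mx M"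
    and "diagonal_mx M" and "diagonal_mx Bw" and "diagonal_mx Dv"
    and "lam \<in> real_eigenvalues \<Lambda>" and "\<forall>\<mu>\<in>real_eigenvalues \<Lambda>. lam \<le> \<mu>"
    and "\<alpha> > 0" and "\<beta> > 0"
    and "2 * \<alpha> + \<beta> \<le> exp (- 1) * lam"
    and "diagonal_mx Q1" and "diagonal_mx Q2" and "diagonal_mx G"
    and "symmetric_mx P3" and "pos_def_mx Pp"
    and "neg_def_block_mx 9
           (design_blocks \<Lambda> H Bu Bv M Bw Dv \<alpha> \<beta> Q1 Q2 G P3 Pp K1 Kp Rp Sp Lp)"
  shows "exponentially_ISS \<Lambda> H Bu Bv M Bw Dv
           K1 (Kp ** matrix_inv G) (matrix_inv P3 ** Rp) (matrix_inv P3 ** Sp ** matrix_inv G)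
           disturbances
       \<and> ultimate_bound_estimate \<Lambda> H Bu Bv M Bw Dv
           K1 (Kp ** matrix_inv G) (matrix_inv P3 ** Rp) (matrix_inv P3 ** Sp ** matrix_inv G)
           disturbances
           (sublevel_set (matrix_inv Q1) (matrix_inv Q2) P3 (matrix_inv G ** Pp ** matrix_inv G))"
proof -
  let ?K2 = "Kp ** matrix_inv G" and ?R = "matrix_inv P3 ** Rp" and ?S = "matrix_inv P3 ** Sp ** matrix_inv G"
  note design = \<open>diagonal_mx \<Lambda>\<close> \<open>pos_def_mx \<Lambda>\<close> \<open>diagonal_mx Q1\<close> \<open>diagonal_mx G\<close> \<open>symmetric_mx P3\<close>
    \<open>neg_def_block_mx 9 _\<close>
  define \<mu> where "\<mu> = Min (range (\<lambda>i. - M $ i $ i))"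
  have \<mu>: "0 < \<mu>" "M $ i $ i \<le> - \<mu>" for i
  proof -
    show "0 < \<mu>"
      using hurwitz_diagonal_entry[OF \<open>hurwitz_mx M\<close> \<open>diagonal_mx M\<close>] by (auto simp: \<mu>_def)
    have "\<mu> \<le> - M $ i $ i" unfolding \<mu>_def by (rule Min_le) auto
    then show "M $ i $ i \<le> - \<mu>" by simp
  qed
  \<comment> \<open>The dissipation inequality supplies the rate 2 \<alpha> + \<beta>, and the
    energy bound for \<open>v\<close> asks for c \<le> \<mu>.\<close>
  define c where "c = min (2 * \<alpha> + \<beta>) \<mu>"
  have c: "0 < c" "c \<le> \<mu>" "c \<le> 2 * \<alpha> + \<beta>"
    using \<mu>(1) \<open>\<alpha> > 0\<close> \<open>\<beta> > 0\<close> by (auto simp: c_def)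
  have c\<Lambda>: "c \<le> \<Lambda> $ i $ i" for i
  proof -
    have "\<Lambda> *v axis i 1 = \<Lambda> $ i $ i *\<^sub>R axis i 1"
      by (simp add: diagonal_mx_vector_mult[OF \<open>diagonal_mx \<Lambda>\<close>] vec_eq_iff axis_def)
    then have "\<Lambda> $ i $ i \<in> real_eigenvalues \<Lambda>"
      unfolding real_eigenvalues_def by (auto simp: axis_eq_0_iff intro!: exI[of _ "axis i 1"])
    then have le: "lam \<le> \<Lambda> $ i $ i" using assms(8) by blast
    \<comment> \<open>This is where the condition on \<alpha> and \<beta> enters: it makes
      \<open>lam\<close> positive, so \<open>exp (- 1) * lam\<close> is at most \<open>lam\<close>,
      and thus c is at most every diagonal entry of \<Lambda>.\<close>
    have "0 < exp (- 1) * lam" using assms(9-11) by linarith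
    then have "0 < lam" by (simp add: zero_less_mult_iff)
    then have "exp (- 1) * lam \<le> 1 * lam" by (intro mult_right_mono) auto
    then show ?thesis using le c(3) assms(11) by linarith
  qed
  obtain C where C: "0 \<le> C" "\<And>z1 \<eta> x.
     (\<Sum>i\<in>UNIV. 1 / Q1 $ i $ i * \<Lambda> $ i $ i *
        (((H *v z1 + Bu *v (K1 *v \<eta> + ?K2 *v (z1 + Dv *v x)) + Bv *v x) $ i)\<^sup>2 - exp (- 1) * (z1 $ i)\<^sup>2))
     + 2 * (\<eta> \<bullet> (P3 *v (?R *v \<eta> + ?S *v (z1 + Dv *v x))))
     \<le> - (2 * \<alpha> + \<beta>) * (\<eta> \<bullet> (P3 *v \<eta>)) + C * (x \<bullet> x)"
    using closed_loop_dissipation[OF design] by blast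
  have P3: "0 < x \<bullet> (P3 *v x)" if "x \<noteq> 0" for x by (rule design_P3_positive[OF design that])
  \<comment> \<open>Lowering the rate from 2 \<alpha> + \<beta> to c is sound because P3 is positive
    definite.\<close>
  have "- (2 * \<alpha> + \<beta>) * (\<eta> \<bullet> (P3 *v \<eta>)) \<le> - c * (\<eta> \<bullet> (P3 *v \<eta>))" for \<eta>
  proof -
    have "0 \<le> \<eta> \<bullet> (P3 *v \<eta>)" using P3[of \<eta>] by (cases "\<eta> = 0") auto
    from mult_right_mono[OF c(3) this] show ?thesis by (simp only: mult_minus_left neg_le_iff_le)
  qed
  then have dissipation: "(\<Sum>i\<in>UNIV. 1 / Q1 $ i $ i * \<Lambda> $ i $ i *
        (((H *v z1 + Bu *v (K1 *v \<eta> + ?K2 *v (z1 + Dv *v x)) + Bv *v x) $ i)\<^sup>2 - exp (- 1) * (z1 $ i)\<^sup>2))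
     + 2 * (\<eta> \<bullet> (P3 *v (?R *v \<eta> + ?S *v (z1 + Dv *v x))))
     \<le> - c * (\<eta> \<bullet> (P3 *v \<eta>)) + C * (x \<bullet> x)" for z1 \<eta> x
    using C(2)[of z1 \<eta> x] by (smt (verit))
  have p: "0 < 1 / Q1 $ i $ i" for i using design_Q1_positive[OF design, of i] by simp
  obtain N where N: "0 < N"
    "\<And>w \<xi>0 v0 \<eta>0 \<xi> v \<eta> t. w \<in> disturbances \<Longrightarrow>
      closed_loop_solution \<Lambda> H Bu Bv M Bw Dv K1 ?K2 ?R ?S w \<xi>0 v0 \<eta>0 \<xi> v \<eta> \<Longrightarrow> 0 \<le> t \<Longrightarrow>
      (X_norm (\<xi> t) (v t) (\<eta> t))\<^sup>2
        \<le> N * (exp (- c * t) * (X_norm \<xi>0 v0 \<eta>0)\<^sup>2 + exp (- c * t) * weighted_energy c w t)"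
    using exponential_energy_bound[OF \<open>diagonal_mx \<Lambda>\<close> c\<Lambda> c(1) C(1) p \<open>symmetric_mx P3\<close> P3 dissipation
        \<open>diagonal_mx M\<close> \<open>diagonal_mx Bw\<close> \<mu> c(2)] by blast
  have Xnn: "0 \<le> X_norm \<zeta> x y" for \<zeta> :: "real \<Rightarrow> real^'n" and x y :: "real^'n"
    by (simp add: X_norm_def L2_norm_nonneg)
  have "exponentially_ISS \<Lambda> H Bu Bv M Bw Dv K1 ?K2 ?R ?S disturbances"
    unfolding exponentially_ISS_def
  \<comment> \<open>The available bound concerns the squared norm, so passing to the root halves the
    rate and takes square roots of the gains N and N / c.\<close>
  proof (rule exI[of _ "c / 2"], rule conjI, use c(1) in simp,
      rule exI[of _ "sqrt N"], rule conjI, use N(1) in simp,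
      rule exI[of _ "sqrt (N / c)"], rule conjI, use N(1) c(1) in simp,
      intro ballI allI impI)
    fix w :: "real \<Rightarrow> real^'n" and \<xi>0 :: "real \<Rightarrow> real^'n" and v0 \<eta>0 :: "real^'n"
      and \<xi> :: "real \<Rightarrow> real \<Rightarrow> real^'n" and v \<eta> :: "real \<Rightarrow> real^'n" and t :: real
    assume w: "w \<in> disturbances"
      and sol: "closed_loop_solution \<Lambda> H Bu Bv M Bw Dv K1 ?K2 ?R ?S w \<xi>0 v0 \<eta>0 \<xi> v \<eta>" and t: "0 \<le> t"
    let ?A = "sqrt N * exp (- (c / 2) * t) * X_norm \<xi>0 v0 \<eta>0" and ?B = "sqrt (N / c) * signal_norm w"
    have "0 \<le> w 0 \<bullet> w 0" by simp
    also have "w 0 \<bullet> w 0 \<le> (SUP t\<in>{0..}. w t \<bullet> w t)"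
      using w by (intro cSUP_upper bdd_aboveI2[of _ _ 1]) (auto simp: disturbances_def)
    finally have s0: "0 \<le> signal_norm w" by (simp add: signal_norm_def)
    have AB: "0 \<le> ?A" "0 \<le> ?B" using Xnn s0 N(1) c(1) by auto
    have "(X_norm (\<xi> t) (v t) (\<eta> t))\<^sup>2 \<le> N * (exp (- c * t) * (X_norm \<xi>0 v0 \<eta>0)\<^sup>2 + (signal_norm w)\<^sup>2 / c)"
      using N(1) disturbance_energy_le_signal_norm[OF w c(1) t]
      by (intro order_trans[OF N(2)[OF w sol t]] mult_left_mono) auto
    also have "\<dots> = ?A\<^sup>2 + ?B\<^sup>2"
    proof -
      have "(exp (- (c / 2) * t))\<^sup>2 = exp (- c * t)" by (simp add: power2_eq_square exp_add[symmetric])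
      then show ?thesis using N(1) c(1) by (simp add: power_mult_distrib distrib_left)
    qed
    also have "\<dots> \<le> (?A + ?B)\<^sup>2" using AB by (simp add: power2_sum)
    finally show "X_norm (\<xi> t) (v t) (\<eta> t) \<le> ?A + ?B"
      by (rule power2_le_imp_le) (use AB in simp)
  qed
  moreover have "ultimate_bound_estimate \<Lambda> H Bu Bv M Bw Dv K1 ?K2 ?R ?S disturbances
      (sublevel_set (matrix_inv Q1) (matrix_inv Q2) P3 (matrix_inv G ** Pp ** matrix_inv G))"
    unfolding ultimate_bound_estimate_def
  proof (intro ballI allI impI)
    fix w :: "real \<Rightarrow> real^'n" and \<xi>0 :: "real \<Rightarrow> real^'n" and v0 \<eta>0 :: "real^'n"
      and \<xi> :: "real \<Rightarrow> real \<Rightarrow> real^'n" and v \<eta> :: "real \<Rightarrow> real^'n" and \<epsilon> :: real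
    assume w: "w \<in> disturbances"
      and sol: "closed_loop_solution \<Lambda> H Bu Bv M Bw Dv K1 ?K2 ?R ?S w \<xi>0 v0 \<eta>0 \<xi> v \<eta>" and \<epsilon>: "0 < \<epsilon>"
    let ?b = "\<lambda>t. N * (exp (- c * t) * (X_norm \<xi>0 v0 \<eta>0)\<^sup>2 + exp (- c * t) * weighted_energy c w t)"
    have "((\<lambda>t. exp (- c * t)) \<longlongrightarrow> 0) at_top"
      by (intro filterlim_compose[OF exp_at_bot]
          filterlim_tendsto_neg_mult_at_bot[OF tendsto_const _ filterlim_ident]) (use c(1) in auto)
    then have "(?b \<longlongrightarrow> N * (0 * (X_norm \<xi>0 v0 \<eta>0)\<^sup>2 + 0)) at_top"
      by (intro tendsto_mult tendsto_add tendsto_const disturbance_energy_tendsto_0 w c(1))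
    then have "\<forall>\<^sub>F t in at_top. ?b t < \<epsilon>\<^sup>2"
      using \<epsilon> by (intro order_tendstoD(2)) auto
    then show "\<forall>\<^sub>F t in at_top. \<exists>q\<in>sublevel_set (matrix_inv Q1) (matrix_inv Q2) P3 (matrix_inv G ** Pp ** matrix_inv G).
        X_dist (\<xi> t, Dz (\<xi> t), v t, \<eta> t) q < \<epsilon>"
      using eventually_ge_at_top[of 0]
    proof eventually_elim
      case (elim t)
      have "(X_norm (\<xi> t) (v t) (\<eta> t))\<^sup>2 < \<epsilon>\<^sup>2" using N(2)[OF w sol elim(2)] elim(1) by linarith
      then have "X_norm (\<xi> t) (v t) (\<eta> t) < \<epsilon>" by (rule power2_less_imp_less) (use \<epsilon> in simp)
      moreover have "L2_norm (\<lambda>z. Dz (\<xi> t) z - Dz (\<lambda>_. 0) z) = L2_norm (Dz (\<xi> t))"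
        by (rule L2_norm_cong) (simp add: Dz_zero)
      ultimately have "X_dist (\<xi> t, Dz (\<xi> t), v t, \<eta> t) ((\<lambda>_. 0), Dz (\<lambda>_. 0), 0, 0) < \<epsilon>"
        by (simp add: X_dist_def X_norm_def)
      then show ?case using zero_in_sublevel_set by blast
    qed
  qed
  ultimately show ?thesis by blast
qed

end
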